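(* There is an algorithm which, given the rank $n$ of a free group $F$ with free basis $\mathcal{B}$ and a finite list of words $w_1,\dots,w_r$ in $F$ generating a malnormal family of cyclic subgroups, determines whether or not the associated decomposition space $\mathcal{D}$ is connected.
   Context: $F$ is a free group of finite rank $n$ with free basis $\mathcal{B}$, and $\mathcal{T}$ is the Cayley graph of $F$ with respect to $\mathcal{B}$ (a tree, on which $F$ acts on the left by isometries); $\partial_\infty F=\partial_\infty\mathcal{T}$ is its Gromov boundary. The family $\langle w_1\rangle,\dots,\langle w_r\rangle$ is malnormal: each $w_i\neq 1$, and if $g\langle w_i\rangle g^{-1}\cap\langle w_j\rangle\neq 1$ for some $g\in F$ then $i=j$ and $g\in\langle w_i\rangle$. The line pattern $\mathcal{L}$ is the set of lines $\{g w_i^k\}_{k\in\mathbb{Z}}$, $g\in F$, $1\le i\le r$, each identified with the bi-infinite geodesic of $\mathcal{T}$ with end points $\lim_{k\to\pm\infty} g w_i^{k}$. The decomposition space $\mathcal{D}$ is the quotient of $\partial_\infty F$ by the equivalence relation identifying the two end points of each line in $\mathcal{L}$, with the quotient topology. *)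

theory Defs
  imports
    "HOL-Library.Nat_Bijection"
    "HOL-Algebra.Generated_Groups"
    "HOL-Analysis.Analysis"
begin

section \<open>Partial recursive functions\<close>

datatype recf =
    Zero
  | Succ
  | Proj nat
  | Comp recf "recf list"
  | PrimRec recf recf
  | Mu recf

text \<open>\<open>computes f xs y\<close>: the program \<open>f\<close>, run on the arguments \<open>xs\<close>, halts with output \<open>y\<close>.
  Arguments are counted from 0; the recursion (resp. search) variable of \<^const>\<open>PrimRec\<close>
  (resp. \<^const>\<open>Mu\<close>) comes first. A program applied to too few arguments diverges.\<close>

inductive computes :: "recf \<Rightarrow> nat list \<Rightarrow> nat \<Rightarrow> bool" where
  Zero: "computes Zero xs 0"
| Succ: "computes Succ (x # xs) (Suc x)"
| Proj: "i < length xs \<Longrightarrow> computes (Proj i) xs (xs ! i)"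
| Comp: "list_all2 (\<lambda>g y. computes g xs y) gs ys \<Longrightarrow> computes f ys z \<Longrightarrow> computes (Comp f gs) xs z"
| PrimRec_0: "computes f xs y \<Longrightarrow> computes (PrimRec f g) (0 # xs) y"
| PrimRec_Suc: "computes (PrimRec f g) (k # xs) y \<Longrightarrow> computes g (k # y # xs) z \<Longrightarrow>
    computes (PrimRec f g) (Suc k # xs) z"
| Mu: "computes f (k # xs) 0 \<Longrightarrow> (\<forall>j<k. \<exists>y. 0 < y \<and> computes f (j # xs) y) \<Longrightarrow>
    computes (Mu f) xs k"

inductive_cases computes_ZeroE: "computes Zero xs y"
inductive_cases computes_SuccE: "computes Succ xs y"
inductive_cases computes_ProjE: "computes (Proj i) xs y"
inductive_cases computes_CompE: "computes (Comp f gs) xs y"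
inductive_cases computes_PrimRec_0E: "computes (PrimRec f g) (0 # xs) y"
inductive_cases computes_PrimRec_SucE: "computes (PrimRec f g) (Suc k # xs) y"
inductive_cases computes_MuE: "computes (Mu f) xs y"

lemma computes_deterministic: "computes f xs y \<Longrightarrow> computes f xs z \<Longrightarrow> y = z"
proof (induction arbitrary: z rule: computes.induct)
  case (Comp xs gs ys f z')
  from Comp.prems obtain ys' where ys': "list_all2 (\<lambda>g y. computes g xs y) gs ys'" "computes f ys' z"
    by (auto elim: computes_CompE)
  have "ys = ys'"
    using Comp.IH(1) ys'(1) by (auto simp: list_all2_conv_all_nth intro!: nth_equalityI)
  then show ?case using Comp.IH(2) ys'(2) by blast
next
  case (PrimRec_Suc f g k xs y z')
  then show ?case by (metis computes_PrimRec_SucE)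
next
  case (Mu f k xs)
  from Mu.prems have z: "computes f (z # xs) 0" "\<forall>j<z. \<exists>y. 0 < y \<and> computes f (j # xs) y"
    by (auto elim: computes_MuE)
  have "\<not> z < k" using Mu.IH(2) z(1) by force
  moreover have "\<not> k < z" using Mu.IH(1) z(2) by force
  ultimately show ?case by simp
next
  case (PrimRec_0 f xs y g)
  then show ?case by (metis computes_PrimRec_0E)
qed (auto elim: computes_ZeroE computes_SuccE computes_ProjE)


section \<open>Free groups\<close>

text \<open>The letter \<open>(i, False)\<close> is the \<open>i\<close>-th basis element, \<open>(i, True)\<close> is its inverse. The elements
  of the free group are the freely freely_reduced words.\<close>

type_synonym letter = "nat \<times> bool"

definition letter_inv :: "letter \<Rightarrow> letter" where
  "letter_inv x = (fst x, \<not> snd x)"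

definition words :: "nat \<Rightarrow> letter list set" where
  "words n = lists ({..<n} \<times> UNIV)"

definition freely_reduced :: "letter list \<Rightarrow> bool" where
  "freely_reduced = successively (\<lambda>x y. y \<noteq> letter_inv x)"

fun push :: "letter \<Rightarrow> letter list \<Rightarrow> letter list" where
  "push x [] = [x]"
| "push x (y # ys) = (if y = letter_inv x then ys else x # y # ys)"

definition free_reduce :: "letter list \<Rightarrow> letter list" where
  "free_reduce w = foldr push w []"

definition free_group :: "nat \<Rightarrow> letter list monoid" where
  "free_group n = \<lparr>carrier = {w \<in> words n. freely_reduced w}, monoid.mult = (\<lambda>u v. free_reduce (u @ v)), one = []\<rparr>"

definition free_basis :: "nat \<Rightarrow> letter list set" where
  "free_basis n = (\<lambda>i. [(i, False)]) ` {..<n}"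

lemma letter_inv_inv [simp]: "letter_inv (letter_inv x) = x"
  by (simp add: letter_inv_def)

lemma reduced_push: "freely_reduced w \<Longrightarrow> freely_reduced (push x w)"
  by (cases w) (auto simp: freely_reduced_def successively_Cons)

lemma reduced_foldr_push: "freely_reduced w \<Longrightarrow> freely_reduced (foldr push u w)"
  by (induction u) (auto intro: reduced_push)

lemma reduced_reduce: "freely_reduced (free_reduce w)"
  unfolding free_reduce_def by (rule reduced_foldr_push) (simp add: freely_reduced_def)

lemma push_push_inv:
  assumes "freely_reduced w"
  shows "push x (push (letter_inv x) w) = w"
proof (cases w)
  case (Cons y ys)
  with assms show ?thesis
    by (cases ys) (auto simp: freely_reduced_def)
qed simp

lemma foldr_push_push:
  assumes "freely_reduced z"
  shows "foldr push (push x w) z = push x (foldr push w z)"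
proof (cases w)
  case (Cons y ys)
  then show ?thesis
    using push_push_inv[OF reduced_foldr_push[OF assms], of x ys] by auto
qed simp

lemma foldr_push_reduce: "freely_reduced z \<Longrightarrow> foldr push (free_reduce w) z = foldr push w z"
  by (induction w) (simp_all add: free_reduce_def foldr_push_push)

lemma reduce_append: "free_reduce (u @ v) = foldr push u (free_reduce v)"
  by (simp add: free_reduce_def)

lemma reduce_id: "freely_reduced w \<Longrightarrow> free_reduce w = w"
proof (induction w)
  case (Cons x w)
  then have "free_reduce w = w" by (auto simp: freely_reduced_def successively_Cons free_reduce_def)
  then show ?case using Cons.prems
    by (cases w) (auto simp: free_reduce_def freely_reduced_def)
qed (simp add: free_reduce_def)

lemma reduce_words: "w \<in> words n \<Longrightarrow> free_reduce w \<in> words n"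
proof (induction w)
  case (Cons x w)
  then have "x \<in> {..<n} \<times> UNIV" "free_reduce w \<in> words n" by (auto simp: words_def)
  then have "push x (free_reduce w) \<in> words n"
    by (cases "free_reduce w") (auto simp: words_def)
  then show ?case by (simp add: free_reduce_def)
qed (simp add: free_reduce_def words_def)

lemma reduce_inv_append: "free_reduce (rev (map letter_inv w) @ w) = []"
proof -
  have "freely_reduced z \<Longrightarrow> foldr push (rev (map letter_inv w)) (foldr push w z) = z" for z
  proof (induction w)
    case (Cons x w)
    then show ?case
      using push_push_inv[OF reduced_foldr_push[OF Cons.prems], of "letter_inv x" w] by simp
  qed simp
  from this[of "[]"] show ?thesis by (simp add: free_reduce_def freely_reduced_def)
qed

lemma group_free_group: "group (free_group n)"
proof (rule groupI)
  fix x y assume "x \<in> carrier (free_group n)" "y \<in> carrier (free_group n)"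
  then show "x \<otimes>\<^bsub>free_group n\<^esub> y \<in> carrier (free_group n)"
    using reduce_words[of "x @ y" n] by (auto simp: free_group_def reduced_reduce words_def)
next
  fix x y z
  show "x \<otimes>\<^bsub>free_group n\<^esub> y \<otimes>\<^bsub>free_group n\<^esub> z = x \<otimes>\<^bsub>free_group n\<^esub> (y \<otimes>\<^bsub>free_group n\<^esub> z)"
  proof -
    have "free_reduce (free_reduce (x @ y) @ z) = foldr push (x @ y) (free_reduce z)"
      by (simp only: reduce_append[of _ z] foldr_push_reduce[OF reduced_reduce])
    also have "\<dots> = foldr push x (free_reduce (y @ z))"
      by (simp add: reduce_append)
    also have "\<dots> = free_reduce (x @ free_reduce (y @ z))"
      by (simp only: reduce_append[of x] reduce_id[OF reduced_reduce])
    finally show ?thesis by (simp add: free_group_def)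
  qed
next
  fix x assume x: "x \<in> carrier (free_group n)"
  then have "rev (map letter_inv x) \<in> words n"
    by (fastforce simp: free_group_def words_def letter_inv_def)
  then have "free_reduce (rev (map letter_inv x)) \<in> carrier (free_group n)"
    by (simp add: free_group_def reduced_reduce reduce_words)
  moreover have "free_reduce (free_reduce (rev (map letter_inv x)) @ x) = []"
    by (metis reduce_append foldr_push_reduce reduced_reduce reduce_inv_append)
  ultimately show "\<exists>y\<in>carrier (free_group n). y \<otimes>\<^bsub>free_group n\<^esub> x = \<one>\<^bsub>free_group n\<^esub>"
    by (auto simp: free_group_def)
qed (auto simp: free_group_def words_def freely_reduced_def reduce_id)

definition malnormal_family :: "('a, 'b) monoid_scheme \<Rightarrow> 'a list \<Rightarrow> bool" where
  "malnormal_family G ws \<longleftrightarrow>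
    (\<forall>w\<in>set ws. w \<noteq> \<one>\<^bsub>G\<^esub>) \<and>
    (\<forall>i<length ws. \<forall>j<length ws. \<forall>g\<in>carrier G.
      (g <#\<^bsub>G\<^esub> generate G {ws ! i} #>\<^bsub>G\<^esub> inv\<^bsub>G\<^esub> g) \<inter> generate G {ws ! j} \<noteq> {\<one>\<^bsub>G\<^esub>} \<longrightarrow>
        i = j \<and> g \<in> generate G {ws ! i})"


section \<open>Cayley graphs and Gromov boundaries\<close>

definition cayley_edges :: "('a, 'b) monoid_scheme \<Rightarrow> 'a set \<Rightarrow> ('a \<times> 'a) set" where
  "cayley_edges G B =
    (let E = {(g, g \<otimes>\<^bsub>G\<^esub> s) | g s. g \<in> carrier G \<and> s \<in> B} in E \<union> E\<inverse>)"

definition graph_dist :: "('a \<times> 'a) set \<Rightarrow> 'a \<Rightarrow> 'a \<Rightarrow> nat" where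
  "graph_dist E x y = (LEAST k. (x, y) \<in> E ^^ k)"

text \<open>A graph is represented by its vertex set \<open>V\<close> and its edge set \<open>E\<close>. Points of the boundary are
  classes of geodesic rays issuing from vertices; a ray is given by its restriction to integer
  times.\<close>

definition geodesic_rays :: "'a set \<Rightarrow> ('a \<times> 'a) set \<Rightarrow> (nat \<Rightarrow> 'a) set" where
  "geodesic_rays V E =
    {\<gamma>. range \<gamma> \<subseteq> V \<and> (\<forall>s t. int (graph_dist E (\<gamma> s) (\<gamma> t)) = \<bar>int s - int t\<bar>)}"

definition asymptotic :: "'a set \<Rightarrow> ('a \<times> 'a) set \<Rightarrow> ((nat \<Rightarrow> 'a) \<times> (nat \<Rightarrow> 'a)) set" where
  "asymptotic V E = {(\<gamma>, \<gamma>'). \<gamma> \<in> geodesic_rays V E \<and> \<gamma>' \<in> geodesic_rays V E \<and>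
    (\<exists>C. \<forall>t. graph_dist E (\<gamma> t) (\<gamma>' t) \<le> C)}"

definition boundary :: "'a set \<Rightarrow> ('a \<times> 'a) set \<Rightarrow> (nat \<Rightarrow> 'a) set set" where
  "boundary V E = geodesic_rays V E // asymptotic V E"

definition gromov_product :: "('a \<times> 'a) set \<Rightarrow> 'a \<Rightarrow> 'a \<Rightarrow> 'a \<Rightarrow> real" where
  "gromov_product E b x y =
    (real (graph_dist E b x) + real (graph_dist E b y) - real (graph_dist E x y)) / 2"

text \<open>Gromov products take values in the half integers, so the condition below says that the
  lower limit of \<open>(\<gamma> s | \<gamma>' t)\<close> is at least \<open>R\<close>. These sets form a neighbourhood basis at \<open>p\<close>.\<close>

definition boundary_nbhd ::
    "'a set \<Rightarrow> ('a \<times> 'a) set \<Rightarrow> 'a \<Rightarrow> (nat \<Rightarrow> 'a) set \<Rightarrow> nat \<Rightarrow> (nat \<Rightarrow> 'a) set set" where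
  "boundary_nbhd V E b p R = {q \<in> boundary V E. \<exists>\<gamma>\<in>p. \<exists>\<gamma>'\<in>q.
    eventually (\<lambda>(s, t). gromov_product E b (\<gamma> s) (\<gamma>' t) \<ge> real R) (sequentially \<times>\<^sub>F sequentially)}"

definition boundary_topology ::
    "'a set \<Rightarrow> ('a \<times> 'a) set \<Rightarrow> 'a \<Rightarrow> (nat \<Rightarrow> 'a) set topology" where
  "boundary_topology V E b =
    topology (\<lambda>U. U \<subseteq> boundary V E \<and> (\<forall>p\<in>U. \<exists>R. boundary_nbhd V E b p R \<subseteq> U))"

definition converges_to_boundary ::
    "'a set \<Rightarrow> ('a \<times> 'a) set \<Rightarrow> 'a \<Rightarrow> (nat \<Rightarrow> 'a) \<Rightarrow> (nat \<Rightarrow> 'a) set \<Rightarrow> bool" where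
  "converges_to_boundary V E b x p \<longleftrightarrow> p \<in> boundary V E \<and>
    (\<forall>\<gamma>\<in>p. filterlim (\<lambda>(k, t). gromov_product E b (x k) (\<gamma> t)) at_top
      (sequentially \<times>\<^sub>F sequentially))"

lemma boundary_nbhd_mono:
  assumes "R \<le> R'"
  shows "boundary_nbhd V E b p R' \<subseteq> boundary_nbhd V E b p R"
proof -
  have "eventually (\<lambda>(s, t). gromov_product E b (\<gamma> s) (\<gamma>' t) \<ge> real R) F"
    if "eventually (\<lambda>(s, t). gromov_product E b (\<gamma> s) (\<gamma>' t) \<ge> real R') F"
    for \<gamma> \<gamma>' :: "nat \<Rightarrow> 'a" and F :: "(nat \<times> nat) filter"
    using that by (rule eventually_mono) (use assms in auto)
  then show ?thesis unfolding boundary_nbhd_def by blast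
qed

lemma openin_boundary_topology:
  "openin (boundary_topology V E b) U \<longleftrightarrow>
    U \<subseteq> boundary V E \<and> (\<forall>p\<in>U. \<exists>R. boundary_nbhd V E b p R \<subseteq> U)"
proof -
  have "istopology (\<lambda>U. U \<subseteq> boundary V E \<and> (\<forall>p\<in>U. \<exists>R. boundary_nbhd V E b p R \<subseteq> U))"
    unfolding istopology_def
  proof (intro conjI allI impI ballI)
    fix S T p
    assume S: "S \<subseteq> boundary V E \<and> (\<forall>p\<in>S. \<exists>R. boundary_nbhd V E b p R \<subseteq> S)"
      and T: "T \<subseteq> boundary V E \<and> (\<forall>p\<in>T. \<exists>R. boundary_nbhd V E b p R \<subseteq> T)"
      and p: "p \<in> S \<inter> T"
    obtain R R' where "boundary_nbhd V E b p R \<subseteq> S" "boundary_nbhd V E b p R' \<subseteq> T"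
      using S T p by (meson IntE)
    then have "boundary_nbhd V E b p (max R R') \<subseteq> S \<inter> T"
      using boundary_nbhd_mono[of R "max R R'"] boundary_nbhd_mono[of R' "max R R'"]
      by (meson le_inf_iff max.cobounded1 max.cobounded2 order_trans)
    then show "\<exists>R. boundary_nbhd V E b p R \<subseteq> S \<inter> T" ..
  next
    fix K p
    assume K: "\<forall>S\<in>K. S \<subseteq> boundary V E \<and> (\<forall>p\<in>S. \<exists>R. boundary_nbhd V E b p R \<subseteq> S)"
    then show "\<Union>K \<subseteq> boundary V E" by (simp add: Sup_le_iff)
    assume "p \<in> \<Union>K"
    then obtain S where "S \<in> K" "p \<in> S" by (rule UnionE)
    moreover from this K obtain R where "boundary_nbhd V E b p R \<subseteq> S" by meson
    ultimately have "boundary_nbhd V E b p R \<subseteq> \<Union>K" by (simp add: Sup_upper2)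
    then show "\<exists>R. boundary_nbhd V E b p R \<subseteq> \<Union>K" ..
  qed (simp add: le_infI1)
  then show ?thesis by (simp add: boundary_topology_def topology_inverse')
qed

lemma topspace_boundary_topology: "topspace (boundary_topology V E b) = boundary V E"
proof -
  have "openin (boundary_topology V E b) (boundary V E)"
    by (auto simp: openin_boundary_topology boundary_nbhd_def)
  then show ?thesis
    by (metis openin_boundary_topology openin_subset openin_topspace subset_antisym)
qed


section \<open>Decomposition spaces\<close>

definition quotient_topology :: "'a topology \<Rightarrow> ('a \<times> 'a) set \<Rightarrow> 'a set topology" where
  "quotient_topology X r = topology (\<lambda>U. U \<subseteq> topspace X // r \<and> openin X (\<Union>U))"

lemma openin_quotient_topology:
  assumes "equiv (topspace X) r"
  shows "openin (quotient_topology X r) U \<longleftrightarrow> U \<subseteq> topspace X // r \<and> openin X (\<Union>U)"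
proof -
  have "istopology (\<lambda>U. U \<subseteq> topspace X // r \<and> openin X (\<Union>U))"
    unfolding istopology_def
  proof (intro conjI allI impI)
    fix S T
    assume S: "S \<subseteq> topspace X // r \<and> openin X (\<Union>S)" and T: "T \<subseteq> topspace X // r \<and> openin X (\<Union>T)"
    have "\<Union>(S \<inter> T) = \<Union>S \<inter> \<Union>T"
      using quotient_disj[OF assms] S T by fast
    then show "openin X (\<Union>(S \<inter> T))" using S T openin_Int by metis
    show "S \<inter> T \<subseteq> topspace X // r" using S by blast
  next
    fix K
    assume K: "\<forall>S\<in>K. S \<subseteq> topspace X // r \<and> openin X (\<Union>S)"
    have "\<Union>(\<Union>K) = (\<Union>S\<in>K. \<Union>S)" by blast
    then show "openin X (\<Union>(\<Union>K))" using K by auto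
    show "\<Union>K \<subseteq> topspace X // r" using K by blast
  qed
  then show ?thesis by (simp add: quotient_topology_def topology_inverse')
qed

lemma topspace_quotient_topology:
  assumes "equiv (topspace X) r"
  shows "topspace (quotient_topology X r) = topspace X // r"
proof -
  have "openin (quotient_topology X r) (topspace X // r)"
    by (simp add: openin_quotient_topology[OF assms] Union_quotient[OF assms])
  then show ?thesis
    by (metis assms openin_quotient_topology openin_subset openin_topspace subset_antisym)
qed

definition generated_equiv :: "'a set \<Rightarrow> ('a \<times> 'a) set \<Rightarrow> ('a \<times> 'a) set" where
  "generated_equiv A r = (r \<union> r\<inverse>)\<^sup>* \<inter> A \<times> A"

lemma equiv_generated_equiv: "equiv A (generated_equiv A r)"
proof (rule equivI)
  have "sym ((r \<union> r\<inverse>)\<^sup>*)" by (intro sym_rtrancl sym_Un_converse)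
  then show "sym (generated_equiv A r)" by (auto simp: generated_equiv_def sym_def)
qed (auto simp: generated_equiv_def refl_on_def trans_def)

text \<open>Each line \<open>{g w\<^sup>k}\<close> is kept with its parametrisation by \<open>k\<close>.\<close>

definition line_pattern :: "('a, 'b) monoid_scheme \<Rightarrow> 'a list \<Rightarrow> (int \<Rightarrow> 'a) set" where
  "line_pattern G ws = {\<lambda>k. g \<otimes>\<^bsub>G\<^esub> w [^]\<^bsub>G\<^esub> k | g w. g \<in> carrier G \<and> w \<in> set ws}"

definition line_ends ::
    "('a, 'b) monoid_scheme \<Rightarrow> 'a set \<Rightarrow> 'a list \<Rightarrow> ((nat \<Rightarrow> 'a) set \<times> (nat \<Rightarrow> 'a) set) set" where
  "line_ends G B ws = {(p, q). \<exists>l\<in>line_pattern G ws.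
    converges_to_boundary (carrier G) (cayley_edges G B) \<one>\<^bsub>G\<^esub> (\<lambda>k. l (int k)) p \<and>
    converges_to_boundary (carrier G) (cayley_edges G B) \<one>\<^bsub>G\<^esub> (\<lambda>k. l (- int k)) q}"

definition decomposition_space ::
    "('a, 'b) monoid_scheme \<Rightarrow> 'a set \<Rightarrow> 'a list \<Rightarrow> (nat \<Rightarrow> 'a) set set topology" where
  "decomposition_space G B ws =
    quotient_topology (boundary_topology (carrier G) (cayley_edges G B) \<one>\<^bsub>G\<^esub>)
      (generated_equiv (boundary (carrier G) (cayley_edges G B)) (line_ends G B ws))"


section \<open>Encoding the input\<close>

definition letter_code :: "letter \<Rightarrow> nat" where
  "letter_code x = 2 * fst x + of_bool (snd x)"

definition word_code :: "letter list \<Rightarrow> nat" where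
  "word_code w = list_encode (map letter_code w)"

definition words_code :: "letter list list \<Rightarrow> nat" where
  "words_code ws = list_encode (map word_code ws)"

end

theory Submission
  imports Defs
begin

text \<open>The boundary of \<open>F\<close> is the space of infinite reduced words. The decomposition space is
  disconnected iff for some \<open>R\<close> there is a nontrivial set of reduced words of length \<open>R\<close> that contains
  the initial segments of both ends of a line of the pattern or of neither. For a given \<open>R\<close> this is a
  finite condition, since the ends of a line that avoids a large ball have the same initial segment.

  It remains to bound \<open>R\<close>. Consider the part \<open>C\<close> of the boundary beyond an edge at the identity, and the
  clopen subsets of \<open>C\<close> that are saturated with respect to the lines within \<open>C\<close>. The rest of the tree
  sees of such a set \<open>A\<close> only its state: which of the finitely many lines crossing the edge end in \<open>A\<close>,
  and whether \<open>A\<close> is empty or all of \<open>C\<close>. The states realised at depth \<open>R + 1\<close> depend only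
  on those realised at depth \<open>R\<close>, by gluing along the edges that follow. They increase with \<open>R\<close> within
  a finite set, hence are constant after at most as many steps as this set has elements, and a
  disconnection of any depth can be replaced by one of that depth.\<close>


section \<open>Recursive functions\<close>

text \<open>Trying each \<open>R\<close> in turn only semi-decides disconnectedness; the algorithm
  exists because the depth that suffices has a computable bound. The mechanism is that of a finite
  tree automaton. Translation by \<open>F\<close> carries every oriented edge of the tree to one
  issuing from the identity, so a letter names its type and one finite set of states serves all
  edges. Replacing pieces by others with the same state is safe for the following reason. A line
  with both ends beyond one edge is handled by the saturation of that piece. A line joining pieces
  beyond two different edges crosses both of them, so each of its ends is recorded in the state of
  its piece. The two flags in a state keep a disconnection nontrivial under the replacement.
  Computability is not shown by writing out a program for the test: its functions are composed of
  operations on encoded lists that preserve computability, which is why all quantifiers of the test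
  range over explicit lists.\<close>

definition recursive1 :: "(nat \<Rightarrow> nat) \<Rightarrow> bool" where
  "recursive1 f \<longleftrightarrow> (\<exists>p. \<forall>x. computes p [x] (f x))"

definition recursive2 :: "(nat \<Rightarrow> nat \<Rightarrow> nat) \<Rightarrow> bool" where
  "recursive2 f \<longleftrightarrow> (\<exists>p. \<forall>x y. computes p [x, y] (f x y))"

lemma recursive1_Suc: "recursive1 Suc"
  unfolding recursive1_def by (blast intro: computes.Succ)

lemma recursive1_id: "recursive1 (\<lambda>x. x)"
proof -
  have "computes (Proj 0) [x] x" for x
    using computes.Proj[of 0 "[x]"] by simp
  then show ?thesis unfolding recursive1_def by blast
qed

lemma recursive2_fst: "recursive2 (\<lambda>x y. x)"
proof -
  have "computes (Proj 0) [x, y] x" for x y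
    using computes.Proj[of 0 "[x, y]"] by simp
  then show ?thesis unfolding recursive2_def by blast
qed

lemma recursive2_snd: "recursive2 (\<lambda>x y. y)"
proof -
  have "computes (Proj 1) [x, y] y" for x y
    using computes.Proj[of 1 "[x, y]"] by simp
  then show ?thesis unfolding recursive2_def by blast
qed

lemma recursive1_comp:
  assumes "recursive1 f" "recursive1 g"
  shows "recursive1 (\<lambda>x. f (g x))"
proof -
  obtain p q where "\<And>x. computes p [x] (f x)" "\<And>x. computes q [x] (g x)"
    using assms unfolding recursive1_def by blast
  then have "computes (Comp p [q]) [x] (f (g x))" for x
    by (intro computes.Comp[where ys = "[g x]"]) auto
  then show ?thesis unfolding recursive1_def by blast
qed

lemma recursive1_comp2:
  assumes "recursive2 h" "recursive1 f" "recursive1 g"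
  shows "recursive1 (\<lambda>x. h (f x) (g x))"
proof -
  obtain r p q where "\<And>x y. computes r [x, y] (h x y)" "\<And>x. computes p [x] (f x)"
      "\<And>x. computes q [x] (g x)"
    using assms unfolding recursive1_def recursive2_def by blast
  then have "computes (Comp r [p, q]) [x] (h (f x) (g x))" for x
    by (intro computes.Comp[where ys = "[f x, g x]"]) auto
  then show ?thesis unfolding recursive1_def by blast
qed

lemma recursive2_comp1:
  assumes "recursive1 f" "recursive2 g"
  shows "recursive2 (\<lambda>x y. f (g x y))"
proof -
  obtain p q where "\<And>x. computes p [x] (f x)" "\<And>x y. computes q [x, y] (g x y)"
    using assms unfolding recursive1_def recursive2_def by blast
  then have "computes (Comp p [q]) [x, y] (f (g x y))" for x y
    by (intro computes.Comp[where ys = "[g x y]"]) auto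
  then show ?thesis unfolding recursive2_def by blast
qed

lemma recursive2_comp2:
  assumes "recursive2 h" "recursive2 f" "recursive2 g"
  shows "recursive2 (\<lambda>x y. h (f x y) (g x y))"
proof -
  obtain r p q where "\<And>x y. computes r [x, y] (h x y)" "\<And>x y. computes p [x, y] (f x y)"
      "\<And>x y. computes q [x, y] (g x y)"
    using assms unfolding recursive2_def by blast
  then have "computes (Comp r [p, q]) [x, y] (h (f x y) (g x y))" for x y
    by (intro computes.Comp[where ys = "[f x y, g x y]"]) auto
  then show ?thesis unfolding recursive2_def by blast
qed

lemma recursive1_const: "recursive1 (\<lambda>x. c)"
proof (induction c)
  case 0
  show ?case unfolding recursive1_def by (blast intro: computes.Zero)
next
  case (Suc c)
  then show ?case by (rule recursive1_comp[OF recursive1_Suc])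
qed

lemma recursive1_rec:
  assumes "recursive2 g"
  shows "recursive1 (rec_nat a g)"
proof -
  obtain p q where p: "\<And>x. computes p [x] a" and q: "\<And>x y. computes q [x, y] (g x y)"
    using recursive1_const[of a] assms unfolding recursive1_def recursive2_def by blast
  \<comment> \<open>The base case is run on the empty argument list, where the unary program
    \<open>p\<close> might diverge. \<open>Zero\<close> halts there and supplies an
    argument.\<close>
  have "computes (PrimRec (Comp p [Zero]) q) [k] (rec_nat a g k)" for k
  proof (induction k)
    case 0
    show ?case
      by (auto intro!: computes.PrimRec_0 computes.Comp[where ys = "[0]"] computes.Zero p)
  next
    case (Suc k)
    then show ?case using computes.PrimRec_Suc[OF _ q] by simp
  qed
  then show ?thesis unfolding recursive1_def by blast
qed

lemma recursive2_iterate: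
  assumes "recursive1 f"
  shows "recursive2 (\<lambda>k x. (f ^^ k) x)"
proof -
  obtain p where p: "\<And>x. computes p [x] (f x)"
    using assms unfolding recursive1_def by blast
  have proj: "computes (Proj 0) [x] x" "computes (Proj 1) [k, y, x] y" for k x y
    using computes.Proj[of 0 "[x]"] computes.Proj[of 1 "[k, y, x]"] by simp_all
  have "computes (PrimRec (Proj 0) (Comp p [Proj 1])) [k, x] ((f ^^ k) x)" for k x
  proof (induction k)
    case 0
    show ?case using proj by (auto intro: computes.PrimRec_0)
  next
    case (Suc k)
    have "computes (Comp p [Proj 1]) [k, (f ^^ k) x, x] (f ((f ^^ k) x))"
      using proj(2) p by (intro computes.Comp[where ys = "[(f ^^ k) x]"]) auto
    with Suc show ?case by (simp add: computes.PrimRec_Suc)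
  qed
  then show ?thesis unfolding recursive2_def by blast
qed

lemma recursive1_Least:
  assumes "recursive2 h" "\<And>x. \<exists>k. h k x = 0"
  shows "recursive1 (\<lambda>x. LEAST k. h k x = 0)"
proof -
  obtain p where p: "\<And>x y. computes p [x, y] (h x y)"
    using assms(1) unfolding recursive2_def by blast
  have "computes (Mu p) [x] (LEAST k. h k x = 0)" for x
  proof (rule computes.Mu)
    have "h (LEAST k. h k x = 0) x = 0"
      using assms(2)[of x] by (rule LeastI_ex)
    then show "computes p [LEAST k. h k x = 0, x] 0"
      using p[of "LEAST k. h k x = 0" x] by simp
    show "\<forall>j<LEAST k. h k x = 0. \<exists>y>0. computes p [j, x] y"
      using p not_less_Least[of _ "\<lambda>k. h k x = 0"] by (meson gr0I)
  qed
  then show ?thesis unfolding recursive1_def by blast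
qed

section \<open>Arithmetic and the inverse of the pairing function\<close>

lemma recursive2_add: "recursive2 (+)"
proof -
  have "(Suc ^^ k) x = k + x" for k x by (induction k) auto
  then show ?thesis using recursive2_iterate[OF recursive1_Suc] by (simp add: fun_eq_iff)
qed

lemma recursive1_pred: "recursive1 (\<lambda>x. x - 1)"
proof -
  have "rec_nat 0 (\<lambda>x y. x) k = k - 1" for k :: nat by (cases k) auto
  then have "rec_nat 0 (\<lambda>x y. x) = (\<lambda>k. k - 1)" by (rule ext)
  then show ?thesis using recursive1_rec[OF recursive2_fst, of 0] by simp
qed

lemma recursive2_diff: "recursive2 (-)"
proof -
  have "((\<lambda>x. x - 1) ^^ k) x = x - k" for k x by (induction k) auto
  then have "recursive2 (\<lambda>k x. x - k)"
    using recursive2_iterate[OF recursive1_pred] by (simp add: fun_eq_iff)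
  from recursive2_comp2[OF this recursive2_snd recursive2_fst] show ?thesis .
qed

lemma recursive1_triangle: "recursive1 triangle"
proof -
  have "recursive2 (\<lambda>k y. y + Suc k)"
    by (intro recursive2_comp2[OF recursive2_add] recursive2_snd
        recursive2_comp1[OF recursive1_Suc] recursive2_fst)
  moreover have "rec_nat 0 (\<lambda>k y. y + Suc k) k = triangle k" for k by (induction k) auto
  then have "rec_nat 0 (\<lambda>k y. y + Suc k) = triangle" by (rule ext)
  ultimately show ?thesis using recursive1_rec[of "\<lambda>k y. y + Suc k" 0] by metis
qed

lemma recursive2_prod_encode: "recursive2 (\<lambda>x y. prod_encode (x, y))"
  unfolding prod_encode_def
  by (auto intro!: recursive2_comp2[OF recursive2_add] recursive2_comp1[OF recursive1_triangle]
      recursive2_fst recursive2_add)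

lemma triangle_mono: "m \<le> n \<Longrightarrow> triangle m \<le> triangle n"
  by (induction n) (auto simp: le_Suc_eq)

text \<open>\<open>prod_encode (a, b)\<close> is \<open>triangle (a + b) + a\<close>, so its
  diagonal \<open>s = a + b\<close> is determined by
  \<open>triangle s \<le> z < triangle (Suc s)\<close>. This \<open>s\<close> is found by unbounded
  search, and \<open>a\<close> and \<open>b\<close> follow by subtraction.\<close>

lemma recursive1_prod_decode:
  shows "recursive1 (\<lambda>z. fst (prod_decode z))" "recursive1 (\<lambda>z. snd (prod_decode z))"
proof -
  \<comment> \<open>With truncated subtraction the condition means
    \<open>z < triangle (Suc s)\<close>.\<close>
  define diag where "diag z = (LEAST s. Suc z - triangle (Suc s) = 0)" for z
  have "recursive2 (\<lambda>s z. Suc z - triangle (Suc s))"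
    by (intro recursive2_comp2[OF recursive2_diff] recursive2_comp1[OF recursive1_Suc]
        recursive2_comp1[OF recursive1_triangle] recursive2_fst recursive2_snd)
  moreover have "\<exists>s. Suc z - triangle (Suc s) = 0" for z by (rule exI[of _ z]) simp
  ultimately have diag: "recursive1 diag"
    unfolding diag_def[abs_def] by (rule recursive1_Least)
  have diag_eq: "diag (prod_encode (a, b)) = a + b" for a b
    unfolding diag_def
  proof (rule Least_equality)
    fix s assume s: "Suc (prod_encode (a, b)) - triangle (Suc s) = 0"
    show "a + b \<le> s"
    proof (rule ccontr)
      assume "\<not> a + b \<le> s"
      then have "triangle (Suc s) \<le> triangle (a + b)" by (intro triangle_mono) simp
      with s show False by (simp add: prod_encode_def)
    qed
  qed (simp add: prod_encode_def)
  have eq: "fst (prod_decode z) = z - triangle (diag z)"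
      "snd (prod_decode z) = diag z - (z - triangle (diag z))" for z
  proof -
    obtain a b where z: "z = prod_encode (a, b)"
      by (metis prod_decode_inverse surj_pair)
    show "fst (prod_decode z) = z - triangle (diag z)"
      by (simp add: z diag_eq) (simp add: prod_encode_def)
    show "snd (prod_decode z) = diag z - (z - triangle (diag z))"
      by (simp add: z diag_eq) (simp add: prod_encode_def)
  qed
  show "recursive1 (\<lambda>z. fst (prod_decode z))" "recursive1 (\<lambda>z. snd (prod_decode z))"
    unfolding eq
    by (intro recursive1_comp2[OF recursive2_diff] recursive1_comp[OF recursive1_triangle]
        recursive1_id diag)+
qed


section \<open>Computable functions between encoded types\<close>

class encodable =
  fixes enc :: "'a \<Rightarrow> nat"
  assumes inj_enc: "inj enc"

lemma enc_eq_iff [simp]: "enc x = enc y \<longleftrightarrow> x = y"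
  using inj_enc by (rule inj_eq)

instantiation nat :: encodable
begin

definition enc_nat :: "nat \<Rightarrow> nat" where "enc_nat n = n"

instance by standard (simp add: enc_nat_def inj_def)

end

instantiation bool :: encodable
begin

definition enc_bool :: "bool \<Rightarrow> nat" where "enc_bool b = of_bool b"

instance by standard (simp add: enc_bool_def inj_def)

end

instantiation prod :: (encodable, encodable) encodable
begin

definition enc_prod :: "'a \<times> 'b \<Rightarrow> nat" where "enc_prod p = prod_encode (enc (fst p), enc (snd p))"

instance by standard (auto simp: enc_prod_def inj_def)

end

instantiation list :: (encodable) encodable
begin

definition enc_list :: "'a list \<Rightarrow> nat" where "enc_list xs = list_encode (map enc xs)"

instance by standard (auto simp: enc_list_def inj_def list_encode_eq inj_map_eq_map[OF inj_enc])

end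

text \<open>Codes are injective but not onto, as for \<open>bool\<close>, so \<open>g\<close> is
  constrained on codes only and never has to recognise them.\<close>

definition computable :: "('a::encodable \<Rightarrow> 'b::encodable) \<Rightarrow> bool" where
  "computable f \<longleftrightarrow> (\<exists>g. recursive1 g \<and> (\<forall>x. g (enc x) = enc (f x)))"

lemma computable_nat_iff: "computable (f :: nat \<Rightarrow> nat) \<longleftrightarrow> recursive1 f"
proof -
  have "g = f" if "\<forall>x. g x = f x" for g using that by auto
  then show ?thesis unfolding computable_def enc_nat_def by blast
qed

lemma computable_via_enc:
  assumes "computable g" "\<And>x. g (enc x) = enc (f x)"
  shows "computable f"
  using assms computable_nat_iff[of g] unfolding computable_def by blast

lemma computable_enc: "computable enc"
  unfolding computable_def by (rule exI[of _ "\<lambda>x. x"]) (simp add: recursive1_id enc_nat_def)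

lemma computable_id: "computable (\<lambda>x. x)"
  unfolding computable_def by (rule exI[of _ "\<lambda>x. x"]) (simp add: recursive1_id)

lemma computable_const: "computable (\<lambda>x. c)"
  unfolding computable_def by (rule exI[of _ "\<lambda>x. enc c"]) (simp add: recursive1_const)

lemma computable_comp:
  assumes "computable f" "computable g"
  shows "computable (\<lambda>x. f (g x))"
proof -
  obtain f' g' where "recursive1 f'" "recursive1 g'" "\<And>x. f' (enc x) = enc (f x)"
      "\<And>x. g' (enc x) = enc (g x)"
    using assms unfolding computable_def by blast
  then show ?thesis unfolding computable_def
    by (intro exI[of _ "\<lambda>x. f' (g' x)"]) (auto intro: recursive1_comp[of f' g'])
qed

lemma computable_Pair:
  assumes "computable f" "computable g"
  shows "computable (\<lambda>x. (f x, g x))"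
proof -
  obtain f' g' where "recursive1 f'" "recursive1 g'" "\<And>x. f' (enc x) = enc (f x)"
      "\<And>x. g' (enc x) = enc (g x)"
    using assms unfolding computable_def by blast
  then show ?thesis unfolding computable_def enc_prod_def
    by (intro exI[of _ "\<lambda>x. prod_encode (f' x, g' x)"] conjI
        recursive1_comp2[OF recursive2_prod_encode]) auto
qed

lemma computable_comp2:
  assumes "computable (\<lambda>p. h (fst p) (snd p))" "computable f" "computable g"
  shows "computable (\<lambda>x. h (f x) (g x))"
  using computable_comp[OF assms(1) computable_Pair[OF assms(2,3)]] by simp

lemma computable_fst: "computable f \<Longrightarrow> computable (\<lambda>x. fst (f x))"
  and computable_snd: "computable f \<Longrightarrow> computable (\<lambda>x. snd (f x))"
proof -
  have "computable (fst :: 'b \<times> 'c \<Rightarrow> 'b)" "computable (snd :: 'b \<times> 'c \<Rightarrow> 'c)"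
    unfolding computable_def using recursive1_prod_decode
    by (intro exI[of _ "\<lambda>z. fst (prod_decode z)"], simp add: enc_prod_def)
      (intro exI[of _ "\<lambda>z. snd (prod_decode z)"], simp add: enc_prod_def recursive1_prod_decode)
  then show "computable f \<Longrightarrow> computable (\<lambda>x. fst (f x))" "computable f \<Longrightarrow> computable (\<lambda>x. snd (f x))"
    by (simp_all add: computable_comp[of fst] computable_comp[of snd])
qed

lemma computable_nat2:
  assumes "recursive2 h" "computable f" "computable g"
  shows "computable (\<lambda>x. h (f x) (g x))"
proof (rule computable_comp2[OF _ assms(2,3)])
  have "recursive1 (\<lambda>z. h (fst (prod_decode z)) (snd (prod_decode z)))"
    by (intro recursive1_comp2[OF assms(1)] recursive1_prod_decode)
  then show "computable (\<lambda>p. h (fst p) (snd p))"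
    unfolding computable_def
    by (intro exI[of _ "\<lambda>z. h (fst (prod_decode z)) (snd (prod_decode z))"])
      (simp add: enc_prod_def enc_nat_def)
qed

lemma computable_Suc: "computable f \<Longrightarrow> computable (\<lambda>x. Suc (f x))"
  by (rule computable_comp[of Suc]) (simp_all add: computable_nat_iff recursive1_Suc)

lemmas computable_add = computable_nat2[OF recursive2_add]
lemmas computable_diff = computable_nat2[OF recursive2_diff]

text \<open>\<open>recursive2_iterate\<close> takes a unary step, so the parameter \<open>x\<close>
  is paired with the current value and copied along unchanged.\<close>

lemma computable_iterate:
  fixes h :: "'a::encodable \<Rightarrow> 'b::encodable \<Rightarrow> 'b"
  assumes "computable (\<lambda>p. h (fst p) (snd p))" "computable k" "computable z"
  shows "computable (\<lambda>x. (h x ^^ k x) (z x))"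
proof -
  obtain H where H: "recursive1 H" "\<And>p. H (enc p) = enc (h (fst p) (snd p))"
    using assms(1) unfolding computable_def by blast
  obtain K where K: "recursive1 K" "\<And>x. K (enc x) = k x"
    using assms(2) unfolding computable_def enc_nat_def by blast
  obtain Z where Z: "recursive1 Z" "\<And>x. Z (enc x) = enc (z x)"
    using assms(3) unfolding computable_def by blast
  define step where "step w = prod_encode (fst (prod_decode w), H w)" for w
  have "recursive1 step" unfolding step_def[abs_def]
    by (intro recursive1_comp2[OF recursive2_prod_encode] recursive1_prod_decode H)
  then have "recursive1 (\<lambda>x. snd (prod_decode ((step ^^ K x) (prod_encode (x, Z x)))))"
    by (intro recursive1_comp[OF recursive1_prod_decode(2)]
        recursive1_comp2[OF recursive2_iterate] K
        recursive1_comp2[OF recursive2_prod_encode] recursive1_id Z)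
  moreover have "(step ^^ m) (prod_encode (enc x, enc b)) = prod_encode (enc x, enc ((h x ^^ m) b))"
    for m x b
  proof (induction m)
    case (Suc m)
    then show ?case using H(2)[of "(x, (h x ^^ m) b)"] by (simp add: step_def enc_prod_def)
  qed simp
  ultimately show ?thesis unfolding computable_def
    by (intro exI[of _ "\<lambda>x. snd (prod_decode ((step ^^ K x) (prod_encode (x, Z x))))"])
      (simp add: K Z)
qed

text \<open>A case distinction by iteration: the step overwrites the first component of
  \<open>(f x, g x)\<close> with the second, and any positive number of steps has the same
  effect.\<close>

lemma computable_if_zero:
  fixes k :: "'a::encodable \<Rightarrow> nat" and f g :: "'a \<Rightarrow> 'b::encodable"
  assumes "computable k" "computable f" "computable g"
  shows "computable (\<lambda>x. if k x = 0 then f x else g x)"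
proof -
  define h :: "'a \<Rightarrow> 'b \<times> 'b \<Rightarrow> 'b \<times> 'b" where "h x q = (snd q, snd q)" for x q
  have "computable (\<lambda>x. fst ((h x ^^ k x) (f x, g x)))"
    unfolding h_def[abs_def]
    by (intro computable_iterate computable_fst computable_Pair computable_snd computable_id assms)
  moreover have "fst ((h x ^^ m) (a, b)) = (if m = 0 then a else b)" for m x a b
  proof -
    have "(h x ^^ Suc m) (a, b) = (b, b)" for m by (induction m) (auto simp: h_def)
    then show ?thesis by (cases m) auto
  qed
  ultimately show ?thesis by simp
qed

lemma computable_if:
  assumes "computable b" "computable f" "computable g"
  shows "computable (\<lambda>x. if b x then f x else g x)"
proof -
  have "(if enc (b x) = 0 then g x else f x) = (if b x then f x else g x)" for x
    by (simp add: enc_bool_def)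
  then show ?thesis
    using computable_if_zero[OF computable_comp[OF computable_enc assms(1)] assms(3,2)] by simp
qed

text \<open>As codes are injective, equality is tested on them: two numbers agree iff both of their
  truncated differences vanish.\<close>

lemma computable_eq:
  assumes "computable f" "computable g"
  shows "computable (\<lambda>x. f x = g x)"
proof -
  have "computable (\<lambda>x. if (enc (f x) - enc (g x)) + (enc (g x) - enc (f x)) = 0 then True else False)"
    by (intro computable_if_zero computable_add computable_diff computable_const
        computable_comp[OF computable_enc] assms)
  moreover have "(if (enc (f x) - enc (g x)) + (enc (g x) - enc (f x)) = 0 then True else False)
      \<longleftrightarrow> f x = g x" for x
    by (metis add_is_0 diff_is_0_eq diff_self_eq_0 enc_eq_iff le_antisym)
  ultimately show ?thesis by (simp only:)
qed

lemma computable_not: "computable b \<Longrightarrow> computable (\<lambda>x. \<not> b x)"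
  using computable_if[of b, OF _ computable_const[of False] computable_const[of True]]
  by (simp add: if_bool_eq_conj)

lemma computable_conj:
  assumes "computable b" "computable c"
  shows "computable (\<lambda>x. b x \<and> c x)"
proof -
  have "(if b x then c x else False) = (b x \<and> c x)" for x by simp
  then show ?thesis using computable_if[OF assms computable_const[of False]] by simp
qed

section \<open>Operations on lists\<close>

lemma computable_Cons:
  assumes "computable f" "computable g"
  shows "computable (\<lambda>x. f x # g x)"
proof (rule computable_comp2[OF _ assms])
  \<comment> \<open>\<open>list_encode\<close> of a nonempty list is the successor of the code of
    the pair of head and tail, so on codes the operation is \<open>Suc\<close>.\<close>
  have "computable (\<lambda>n :: nat. Suc n)" by (intro computable_Suc computable_id)
  then show "computable (\<lambda>p. fst p # snd p)"
    by (rule computable_via_enc) (simp add: enc_prod_def enc_list_def)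
qed

lemma computable_prod_decode: "computable f \<Longrightarrow> computable (\<lambda>x. prod_decode (f x))"
proof -
  have "computable prod_decode"
    by (rule computable_via_enc[OF computable_id]) (simp add: enc_prod_def enc_nat_def)
  then show "computable f \<Longrightarrow> computable (\<lambda>x. prod_decode (f x))" by (rule computable_comp)
qed

text \<open>A list is folded by iterating a step on pairs (code of the remaining list, accumulator). The
  code of a list serves as the number of iterations: it bounds the length, and the pair is
  stationary once the list is used up.\<close>

lemma computable_foldl:
  assumes "computable (\<lambda>p. h (fst p) (fst (snd p)) (snd (snd p)))" "computable z" "computable l"
  shows "computable (\<lambda>x. foldl (h x) (z x) (l x))"
proof -
  obtain H where H: "recursive1 H"
      "\<And>p. H (enc p) = enc (h (fst p) (fst (snd p)) (snd (snd p)))"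
    using assms(1) unfolding computable_def by blast
  have H': "H (prod_encode (enc x, prod_encode (enc b, enc a))) = enc (h x b a)" for x b a
    using H(2)[of "(x, b, a)"] by (simp add: enc_prod_def)
  have cH: "computable H" using H(1) by (simp add: computable_nat_iff)
  define step :: "nat \<Rightarrow> nat \<times> nat \<Rightarrow> nat \<times> nat" where
    "step x q = (if fst q = 0 then q else
      (snd (prod_decode (fst q - 1)),
       H (prod_encode (x, prod_encode (snd q, fst (prod_decode (fst q - 1)))))))" for x q
  have cstep: "computable (\<lambda>p. step (fst p) (snd p))"
    unfolding step_def
    by (intro computable_if_zero computable_fst computable_snd computable_id computable_Pair
        computable_comp[OF cH] computable_nat2[OF recursive2_prod_encode] computable_prod_decode
        computable_diff computable_const)
  have stop: "(step x ^^ m) (0, c) = (0, c)" for x m c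
    by (induction m) (auto simp: step_def)
  have iter: "length as \<le> m \<Longrightarrow> (step (enc x) ^^ m) (enc as, enc b) = (0, enc (foldl (h x) b as))"
    for as b m x
  proof (induction as arbitrary: b m)
    case Nil
    then show ?case using stop by (simp add: enc_list_def)
  next
    case (Cons a as)
    then obtain m' where m: "m = Suc m'" "length as \<le> m'" by (cases m) auto
    have "step (enc x) (enc (a # as), enc b) = (enc as, enc (h x b a))"
      by (simp add: step_def enc_list_def H')
    then show ?case using Cons.IH[OF m(2), of "h x b a"] by (simp only: m(1) funpow_Suc_right) simp
  qed
  have length_le: "length as \<le> list_encode as" for as
  proof (induction as)
    case (Cons a as)
    then show ?case using le_prod_encode_2[of "list_encode as" a] by simp
  qed simp
  have "length as \<le> enc as" for as :: "'c list"
    using length_le[of "map enc as"] by (simp add: enc_list_def)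
  then have eq: "snd ((step (enc x) ^^ enc (l x)) (enc (l x), enc (z x))) = enc (foldl (h x) (z x) (l x))"
    for x by (simp add: iter)
  have "computable (\<lambda>x. snd ((step (enc x) ^^ enc (l x)) (enc (l x), enc (z x))))"
    by (intro computable_snd computable_iterate
        computable_comp2[OF cstep] computable_Pair computable_comp[OF computable_enc]
        computable_fst computable_id assms(2,3))
  then have "computable (\<lambda>x. enc (foldl (h x) (z x) (l x)))" by (simp only: eq)
  then show ?thesis
    unfolding computable_def enc_nat_def by simp
qed

lemma computable_rev:
  assumes "computable l"
  shows "computable (\<lambda>x. rev (l x))"
proof -
  have "computable (\<lambda>x. foldl (\<lambda>b a. a # b) [] (l x))"
    by (intro computable_foldl computable_Cons computable_fst computable_snd computable_id
        computable_const assms)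
  moreover have "foldl (\<lambda>b a. a # b) ys xs = rev xs @ ys" for ys xs :: "'b list"
    by (induction xs arbitrary: ys) auto
  ultimately show ?thesis by simp
qed

lemma computable_foldr:
  assumes "computable (\<lambda>p. h (fst p) (fst (snd p)) (snd (snd p)))" "computable l" "computable z"
  shows "computable (\<lambda>x. foldr (h x) (l x) (z x))"
proof -
  have "computable (\<lambda>p. h (fst (fst p, snd (snd p), fst (snd p)))
      (fst (snd (fst p, snd (snd p), fst (snd p)))) (snd (snd (fst p, snd (snd p), fst (snd p)))))"
    by (rule computable_comp[OF assms(1)])
      (intro computable_Pair computable_fst computable_snd computable_id)
  then have "computable (\<lambda>x. foldl (\<lambda>b a. h x a b) (z x) (rev (l x)))"
    by (intro computable_foldl computable_rev assms(2,3)) simp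
  then show ?thesis by (simp add: foldr_conv_foldl)
qed


lemma computable_append:
  assumes "computable f" "computable g"
  shows "computable (\<lambda>x. f x @ g x)"
proof -
  have "computable (\<lambda>x. foldr (\<lambda>a b. a # b) (f x) (g x))"
    by (intro computable_foldr computable_Cons computable_fst computable_snd computable_id assms)
  moreover have "foldr (\<lambda>a b. a # b) xs ys = xs @ ys" for xs ys :: "'b list"
    by (induction xs) auto
  ultimately show ?thesis by simp
qed

lemma computable_map:
  assumes "computable (\<lambda>p. h (fst p) (snd p))" "computable l"
  shows "computable (\<lambda>x. map (h x) (l x))"
proof -
  have "computable (\<lambda>x. foldr (\<lambda>a b. h x a # b) (l x) [])"
    by (intro computable_foldr computable_Cons computable_comp2[OF assms(1)] computable_fst
        computable_snd computable_id computable_const assms(2))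
  moreover have "foldr (\<lambda>a b. h x a # b) as [] = map (h x) as" for x as
    by (induction as) auto
  ultimately show ?thesis by simp
qed

lemma computable_concat:
  assumes "computable l"
  shows "computable (\<lambda>x. concat (l x))"
proof -
  have "computable (\<lambda>x. foldr (\<lambda>a b. a @ b) (l x) [])"
    by (intro computable_foldr computable_append computable_fst computable_snd computable_id
        computable_const assms)
  then show ?thesis by (simp add: concat_conv_foldr)
qed

lemma computable_filter:
  assumes "computable (\<lambda>p. P (fst p) (snd p))" "computable l"
  shows "computable (\<lambda>x. filter (P x) (l x))"
proof -
  have "computable (\<lambda>x. foldr (\<lambda>a b. if P x a then a # b else b) (l x) [])"
    by (intro computable_foldr computable_if computable_Cons computable_comp2[OF assms(1)]
        computable_fst computable_snd computable_id computable_const assms(2))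
  moreover have "foldr (\<lambda>a b. if P x a then a # b else b) as [] = filter (P x) as" for x as
    by (induction as) auto
  ultimately show ?thesis by simp
qed

lemma computable_ball:
  assumes "computable (\<lambda>p. P (fst p) (snd p))" "computable l"
  shows "computable (\<lambda>x. \<forall>a\<in>set (l x). P x a)"
proof -
  have "computable (\<lambda>x. foldr (\<lambda>a b. P x a \<and> b) (l x) True)"
    by (intro computable_foldr computable_conj computable_comp2[OF assms(1)]
        computable_fst computable_snd computable_id computable_const assms(2))
  moreover have "foldr (\<lambda>a b. P x a \<and> b) as True = (\<forall>a\<in>set as. P x a)" for x as
    by (induction as) auto
  ultimately show ?thesis by simp
qed

lemma computable_bex:
  assumes "computable (\<lambda>p. P (fst p) (snd p))" "computable l"
  shows "computable (\<lambda>x. \<exists>a\<in>set (l x). P x a)"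
proof -
  have "computable (\<lambda>x. \<not> (\<forall>a\<in>set (l x). \<not> P x a))"
    by (intro computable_not computable_ball assms)
  then show ?thesis by simp
qed

lemma computable_member:
  assumes "computable f" "computable l"
  shows "computable (\<lambda>x. f x \<in> set (l x))"
proof -
  have "computable (\<lambda>x. \<exists>a\<in>set (l x). a = f x)"
    by (intro computable_bex computable_eq computable_fst computable_snd computable_id
        computable_comp[OF assms(1)] assms(2))
  then show ?thesis by simp
qed

lemma computable_length:
  assumes "computable l"
  shows "computable (\<lambda>x. length (l x))"
proof -
  have "computable (\<lambda>x. foldr (\<lambda>a b. Suc b) (l x) 0)"
    by (intro computable_foldr computable_Suc computable_snd computable_id computable_const assms)
  moreover have "foldr (\<lambda>a b. Suc b) as 0 = length as" for as :: "'b list"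
    by (induction as) auto
  ultimately show ?thesis by simp
qed

lemma computable_subseqs:
  assumes "computable l"
  shows "computable (\<lambda>x. subseqs (l x))"
proof -
  have "computable (\<lambda>x. foldr (\<lambda>a b. map (\<lambda>c. a # c) b @ b) (l x) [[]])"
    by (intro computable_foldr computable_append computable_map computable_Cons computable_fst
        computable_snd computable_id computable_const assms)
  moreover have "foldr (\<lambda>a b. map (\<lambda>c. a # c) b @ b) as [[]] = subseqs as" for as :: "'b list"
    by (induction as) (auto simp: Let_def)
  ultimately show ?thesis by simp
qed

text \<open>As for the primitive recursive predecessor, the fold carries the list built so far next
  to its own tail.\<close>

lemma computable_tl:
  assumes "computable l"
  shows "computable (\<lambda>x. tl (l x))"
proof -
  have "computable (\<lambda>x. snd (foldr (\<lambda>a b. (a # fst b, fst b)) (l x) ([], [])))"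
    by (intro computable_foldr computable_Pair computable_Cons computable_fst computable_snd
        computable_id computable_const assms)
  moreover have "foldr (\<lambda>a b. (a # fst b, fst b)) as ([], []) = (as, tl as)" for as :: "'b list"
    by (induction as) auto
  ultimately show ?thesis by simp
qed

lemma computable_take:
  assumes "computable k" "computable l"
  shows "computable (\<lambda>x. take (k x) (l x))"
proof -
  \<comment> \<open>The inner fold yields the head as a list of length at most one, so an exhausted
    list needs no case distinction.\<close>
  define step :: "'a \<Rightarrow> 'b list \<times> 'b list \<Rightarrow> 'b list \<times> 'b list" where
    "step x q = (fst q @ foldr (\<lambda>a b. [a]) (snd q) [], tl (snd q))" for x q
  have "computable (\<lambda>x. fst ((step x ^^ k x) ([], l x)))"
    unfolding step_def[abs_def]
    by (intro computable_iterate computable_foldr computable_Pair computable_append computable_tl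
        computable_Cons computable_fst computable_snd computable_id computable_const assms)
  moreover have "(step x ^^ m) ([], as) = (take m as, drop m as)" for x m as
  proof (induction m)
    case (Suc m)
    have "foldr (\<lambda>a b. [a]) bs [] = take 1 bs" for bs :: "'b list" by (cases bs) auto
    then show ?case using Suc take_add[of m 1 as] by (simp add: step_def drop_Suc tl_drop)
  qed simp
  ultimately show ?thesis by simp
qed

lemma computable_upt:
  assumes "computable k"
  shows "computable (\<lambda>x. [0..<k x])"
proof -
  have "computable (\<lambda>x. ((\<lambda>l. l @ [length l]) ^^ k x) [])"
    by (intro computable_iterate computable_append computable_Cons computable_length
        computable_fst computable_snd computable_id computable_const assms)
  moreover have "((\<lambda>l. l @ [length l]) ^^ m) [] = [0..<m]" for m by (induction m) auto
  ultimately show ?thesis by simp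
qed

lemma computable_mult:
  fixes f g :: "'a::encodable \<Rightarrow> nat"
  assumes "computable f" "computable g"
  shows "computable (\<lambda>x. f x * g x)"
proof -
  have "computable (\<lambda>x. ((\<lambda>b. g x + b) ^^ f x) 0)"
    by (intro computable_iterate computable_add computable_comp[OF assms(2)]
        computable_fst computable_snd computable_id computable_const assms(1))
  moreover have "((\<lambda>b. n + b) ^^ m) 0 = m * n" for m n :: nat by (induction m) auto
  ultimately show ?thesis by simp
qed

lemma computable_power2:
  assumes "computable f"
  shows "computable (\<lambda>x. 2 ^ f x :: nat)"
proof -
  have "computable (\<lambda>x. ((\<lambda>b. b + b) ^^ f x) (1 :: nat))"
    by (intro computable_iterate computable_add computable_snd computable_id computable_const assms)
  moreover have "((\<lambda>b. b + b) ^^ m) 1 = (2 ^ m :: nat)" for m by (induction m) auto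
  ultimately show ?thesis by simp
qed

section \<open>Decoding letters and free reduction\<close>

definition letter_of_code :: "nat \<Rightarrow> letter" where
  "letter_of_code c = (c div 2, odd c)"

lemma letter_of_code_inverse: "letter_of_code (letter_code x) = x"
  by (cases x) (auto simp: letter_of_code_def letter_code_def)

text \<open>Counting up to the code while carrying quotient and parity gives division by two with
  remainder.\<close>

lemma computable_letter_of_code:
  assumes "computable f"
  shows "computable (\<lambda>x. letter_of_code (f x))"
proof -
  have "computable (\<lambda>x. ((\<lambda>p. if snd p then (Suc (fst p), False) else (fst p, True)) ^^ f x) (0, False))"
    by (intro computable_iterate computable_if computable_Pair computable_Suc
        computable_fst computable_snd computable_id computable_const assms)
  moreover have "((\<lambda>p. if snd p then (Suc (fst p), False) else (fst p, True)) ^^ c) (0, False) =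
      letter_of_code c" for c
    by (induction c) (auto simp: letter_of_code_def)
  ultimately show ?thesis by simp
qed

lemma computable_letter_inv: "computable f \<Longrightarrow> computable (\<lambda>x. letter_inv (f x))"
  unfolding letter_inv_def
  by (intro computable_Pair computable_not computable_fst computable_snd)

lemma computable_free_reduce:
  assumes "computable f"
  shows "computable (\<lambda>x. free_reduce (f x))"
proof -
  \<comment> \<open>Pattern matching becomes an equality of lists: the fold returns the head of
    \<open>ys\<close> as a list of length at most one.\<close>
  have push: "push x ys =
      (if foldr (\<lambda>a b. [a]) ys [] = [letter_inv x] then tl ys else x # ys)" for x ys
    by (cases ys) auto
  show ?thesis
    unfolding free_reduce_def push[abs_def]
    by (intro computable_foldr computable_if computable_eq computable_Cons computable_tl
        computable_letter_inv computable_fst computable_snd computable_id computable_const assms)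
qed


section \<open>The decision procedure\<close>

definition inv_word :: "letter list \<Rightarrow> letter list" where
  "inv_word w = rev (map letter_inv w)"

definition power_word :: "letter list \<Rightarrow> nat \<Rightarrow> letter list" where
  "power_word w k = concat (replicate k w)"

definition letter_list :: "nat \<Rightarrow> letter list" where
  "letter_list n = concat (map (\<lambda>i. [(i, False), (i, True)]) [0..<n])"

definition words_of_length :: "nat \<Rightarrow> nat \<Rightarrow> letter list list" where
  "words_of_length n R =
    ((\<lambda>W. concat (map (\<lambda>w. map (\<lambda>x. x # w) (letter_list n)) W)) ^^ R) [[]]"

definition words_up_to :: "nat \<Rightarrow> nat \<Rightarrow> letter list list" where
  "words_up_to n R = concat (map (words_of_length n) [0..<Suc R])"

definition total_length :: "letter list list \<Rightarrow> nat" where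
  "total_length ws = length (concat ws)"

text \<open>The first \<open>R\<close> letters of the end of the line through \<open>g\<close> in the direction \<open>w\<close>, provided that
  \<open>k\<close> is large.\<close>

definition end_prefix :: "nat \<Rightarrow> nat \<Rightarrow> letter list \<Rightarrow> letter list \<Rightarrow> letter list" where
  "end_prefix R k g w = take R (free_reduce (g @ power_word w k))"

text \<open>By \<open>short_representative\<close>, a line whose ends differ within \<open>R\<close>
  letters can be based at some \<open>g\<close> with fewer than \<open>R + length w\<close> letters,
  so the listed \<open>g\<close> suffice. The first \<open>R\<close> letters of an end are settled
  once the exponent reaches \<open>R + length g + length w\<close> (\<open>line_seq_limit\<close>),
  which is at most the exponent used.\<close>

definition saturated_colouring :: "nat \<Rightarrow> letter list list \<Rightarrow> nat \<Rightarrow> letter list list \<Rightarrow> bool" where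
  "saturated_colouring n ws R c \<longleftrightarrow>
    (\<forall>g\<in>set (words_up_to n (R + total_length ws)). \<forall>w\<in>set ws.
      end_prefix R (2 * (R + total_length ws)) g w \<in> set c \<longleftrightarrow>
      end_prefix R (2 * (R + total_length ws)) g (inv_word w) \<in> set c)"

text \<open>\<open>c\<close> is one colour class of a two-colouring of the cylinders of depth
  \<open>R\<close>: a clopen set in finite form.\<close>

definition disconnected_at :: "nat \<Rightarrow> letter list list \<Rightarrow> nat \<Rightarrow> bool" where
  "disconnected_at n ws R \<longleftrightarrow>
    (\<exists>c\<in>set (subseqs (filter (\<lambda>u. free_reduce u = u) (words_of_length n R))).
      (\<exists>u\<in>set (filter (\<lambda>u. free_reduce u = u) (words_of_length n R)). u \<in> set c) \<and>
      (\<exists>u\<in>set (filter (\<lambda>u. free_reduce u = u) (words_of_length n R)). u \<notin> set c) \<and>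
      saturated_colouring n ws R c)"

text \<open>A bound on the pairs of a letter and a state: \<open>2 * n\<close> letters, 4 values of
  the two flags, and at most \<open>2 ^ N\<close> sets of crossing ends, where \<open>N\<close>
  bounds the number of triples of a short \<open>g\<close>, a word \<open>w\<close> and a
  direction.\<close>

definition depth_bound :: "nat \<Rightarrow> letter list list \<Rightarrow> nat" where
  "depth_bound n ws =
    8 * n * 2 ^ (2 * (length (words_up_to n (total_length ws)) * length ws))"

text \<open>Decoding and free reduction belong to the algorithm, as the given words may be
  unreduced. \<open>Suc\<close> is there because states that are stable from index \<open>r\<close>
  on reduce a disconnection to depth \<open>Suc r\<close>.\<close>

definition decide_connected :: "nat \<Rightarrow> nat list list \<Rightarrow> nat" where
  "decide_connected n codes =
    (if disconnected_at n (map (\<lambda>w. free_reduce (map letter_of_code w)) codes)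
      (Suc (depth_bound n (map (\<lambda>w. free_reduce (map letter_of_code w)) codes)))
     then 0 else 1)"

section \<open>Computability of the procedure\<close>

lemma computable_inv_word: "computable f \<Longrightarrow> computable (\<lambda>x. inv_word (f x))"
  unfolding inv_word_def
  by (intro computable_rev computable_map computable_letter_inv computable_snd computable_id)

lemma computable_power_word:
  assumes "computable f" "computable k"
  shows "computable (\<lambda>x. power_word (f x) (k x))"
proof -
  have "power_word w m = ((\<lambda>v. w @ v) ^^ m) []" for w m
    by (induction m) (auto simp: power_word_def)
  then show ?thesis
    by simp (intro computable_iterate computable_append computable_comp[OF assms(1)]
        computable_fst computable_snd computable_id computable_const assms(2))
qed

lemma computable_words_of_length:
  assumes "computable f" "computable k"
  shows "computable (\<lambda>x. words_of_length (f x) (k x))"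
  unfolding words_of_length_def letter_list_def
  by (intro computable_iterate computable_concat computable_map computable_Cons computable_upt
      computable_Pair computable_comp[OF assms(1)]
      computable_fst computable_snd computable_id computable_const assms(2))

lemma computable_words_up_to:
  assumes "computable f" "computable k"
  shows "computable (\<lambda>x. words_up_to (f x) (k x))"
  unfolding words_up_to_def
  by (intro computable_concat computable_map computable_words_of_length computable_upt
      computable_Suc computable_comp[OF assms(1)]
      computable_fst computable_snd computable_id computable_const assms(2))

lemma computable_total_length: "computable f \<Longrightarrow> computable (\<lambda>x. total_length (f x))"
  unfolding total_length_def by (intro computable_length computable_concat)

lemma computable_end_prefix:
  "computable R \<Longrightarrow> computable k \<Longrightarrow> computable g \<Longrightarrow> computable w \<Longrightarrow>
    computable (\<lambda>x. end_prefix (R x) (k x) (g x) (w x))"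
  unfolding end_prefix_def
  by (intro computable_take computable_free_reduce computable_append computable_power_word)

lemma computable_saturated_colouring:
  assumes "computable n" "computable ws" "computable R" "computable c"
  shows "computable (\<lambda>x. saturated_colouring (n x) (ws x) (R x) (c x))"
  unfolding saturated_colouring_def
  by (intro computable_ball computable_eq computable_member computable_end_prefix
      computable_inv_word computable_words_up_to computable_mult computable_add
      computable_total_length assms assms[THEN computable_comp]
      computable_fst computable_snd computable_id computable_const)

lemma computable_disconnected_at:
  assumes "computable n" "computable ws" "computable R"
  shows "computable (\<lambda>x. disconnected_at (n x) (ws x) (R x))"
  unfolding disconnected_at_def
  by (intro computable_bex computable_conj computable_not computable_eq computable_member
      computable_subseqs computable_filter computable_free_reduce computable_words_of_length
      computable_saturated_colouring assms assms[THEN computable_comp]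
      computable_fst computable_snd computable_id computable_const)

lemma computable_depth_bound:
  assumes "computable n" "computable ws"
  shows "computable (\<lambda>x. depth_bound (n x) (ws x))"
  unfolding depth_bound_def
  by (intro computable_mult computable_power2 computable_length computable_words_up_to
      computable_total_length computable_const assms)

lemma computable_decide_connected: "computable (\<lambda>p. decide_connected (fst p) (snd p))"
  unfolding decide_connected_def
  by (intro computable_if computable_disconnected_at computable_depth_bound computable_Suc
      computable_map computable_free_reduce computable_letter_of_code
      computable_fst computable_snd computable_id computable_const)

lemma words_code_enc: "words_code ws = enc (map (map letter_code) ws)"
  by (simp add: words_code_def word_code_def[abs_def] enc_list_def enc_nat_def comp_def)

text \<open>\<open>computable\<close> speaks of a single coded argument, while the program receives
  \<open>n\<close> and the list separately; a pairing program in front bridges this.\<close>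

lemma exists_deciding_program:
  "\<exists>alg. \<forall>n ws. computes alg [n, words_code ws] (decide_connected n (map (map letter_code) ws))"
proof -
  obtain f where f: "recursive1 f"
      "\<And>p. f (enc p) = enc (decide_connected (fst p) (snd p))"
    using computable_decide_connected unfolding computable_def by blast
  then obtain p where p: "\<And>n ws. computes p [enc (n, map (map letter_code) ws)]
      (decide_connected n (map (map letter_code) ws))"
    unfolding recursive1_def enc_nat_def by (metis fst_conv snd_conv)
  obtain q where q: "\<And>x y. computes q [x, y] (prod_encode (x, y))"
    using recursive2_prod_encode unfolding recursive2_def by blast
  have "computes (Comp p [q]) [n, words_code ws] (decide_connected n (map (map letter_code) ws))"
    for n ws
    using p[of n ws] q[of n "words_code ws"]
    by (intro computes.Comp[where ys = "[enc (n, map (map letter_code) ws)]"])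
      (simp_all add: enc_prod_def words_code_enc enc_nat_def[of n])
  then show ?thesis by blast
qed


section \<open>Lengths in the free group\<close>

lemma freely_reduced_Nil [simp]: "freely_reduced []"
  by (simp add: freely_reduced_def)

lemma freely_reduced_append:
  "freely_reduced (u @ v) \<longleftrightarrow>
    freely_reduced u \<and> freely_reduced v \<and> (u = [] \<or> v = [] \<or> hd v \<noteq> letter_inv (last u))"
  by (auto simp: freely_reduced_def successively_append_iff)

lemma freely_reduced_iff_free_reduce: "freely_reduced w \<longleftrightarrow> free_reduce w = w"
  using reduce_id reduced_reduce by metis

lemma inv_word_append: "inv_word (u @ v) = inv_word v @ inv_word u"
  by (simp add: inv_word_def)

lemma inv_word_inv_word [simp]: "inv_word (inv_word w) = w"
  by (simp add: inv_word_def rev_map[symmetric] comp_def)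

lemma length_inv_word [simp]: "length (inv_word w) = length w"
  by (simp add: inv_word_def)

lemma inv_word_eq_Nil [simp]: "inv_word w = [] \<longleftrightarrow> w = []"
  by (simp add: inv_word_def)

lemma last_inv_word: "w \<noteq> [] \<Longrightarrow> last (inv_word w) = letter_inv (hd w)"
  by (cases w) (auto simp: inv_word_def)

lemma freely_reduced_inv_word: "freely_reduced w \<Longrightarrow> freely_reduced (inv_word w)"
proof (induction w)
  case (Cons x w)
  have "inv_word (x # w) = inv_word w @ [letter_inv x]" by (simp add: inv_word_def)
  moreover have "freely_reduced w" "w = [] \<or> hd w \<noteq> letter_inv x"
    using Cons.prems freely_reduced_append[of "[x]" w] by auto
  ultimately show ?case
    using Cons.IH by (auto simp: freely_reduced_append last_inv_word)
      (auto simp: freely_reduced_def last_inv_word)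
qed (simp add: inv_word_def)

lemma words_append [simp]: "u @ v \<in> words n \<longleftrightarrow> u \<in> words n \<and> v \<in> words n"
  by (auto simp: words_def)

lemma words_Cons [simp]: "x # v \<in> words n \<longleftrightarrow> fst x < n \<and> v \<in> words n"
  by (cases x) (auto simp: words_def)

lemma words_Nil [simp]: "[] \<in> words n"
  by (auto simp: words_def)

lemma fst_letter_inv [simp]: "fst (letter_inv x) = fst x"
  by (simp add: letter_inv_def)

lemma letter_inv_neq [simp]: "letter_inv x \<noteq> x" "x \<noteq> letter_inv x"
  by (auto simp: letter_inv_def prod_eq_iff)

lemma inv_word_words: "w \<in> words n \<Longrightarrow> inv_word w \<in> words n"
  by (induction w) (auto simp: inv_word_def)

lemma free_reduce_append_left: "free_reduce (free_reduce u @ v) = free_reduce (u @ v)"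
  by (simp add: reduce_append foldr_push_reduce reduced_reduce)

lemma free_reduce_append_right: "free_reduce (u @ free_reduce v) = free_reduce (u @ v)"
  by (simp add: reduce_append reduce_id reduced_reduce)

lemma free_reduce_cancel_left: "free_reduce (inv_word w @ w @ v) = free_reduce v"
proof -
  have "free_reduce (free_reduce (inv_word w @ w) @ v) = free_reduce v"
    by (simp add: inv_word_def reduce_inv_append)
  then show ?thesis by (simp add: free_reduce_append_left)
qed

lemma free_reduce_cancel_right: "free_reduce (w @ inv_word w @ v) = free_reduce v"
  using free_reduce_cancel_left[of "inv_word w" v] by simp

lemma free_reduce_Nil [simp]: "free_reduce [] = []"
  by (simp add: free_reduce_def)

lemma length_free_reduce: "length (free_reduce w) \<le> length w"
proof (induction w)
  case (Cons x w)
  have "length (push x v) \<le> Suc (length v)" for v by (cases v) auto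
  then show ?case using Cons by (simp add: free_reduce_def) (meson le_trans not_less_eq_eq)
qed simp

lemma length_free_reduce_append: "length (free_reduce v) \<le> length (free_reduce (u @ v)) + length u"
proof -
  have "length (free_reduce (inv_word u @ free_reduce (u @ v))) \<le> length u + length (free_reduce (u @ v))"
    using length_free_reduce[of "inv_word u @ free_reduce (u @ v)"] by simp
  then show ?thesis by (simp add: free_reduce_append_right free_reduce_cancel_left)
qed

section \<open>Word metric and common prefixes\<close>

lemma common_prefix_split:
  "\<exists>p u v. x = p @ u \<and> y = p @ v \<and> (u = [] \<or> v = [] \<or> hd u \<noteq> hd v)"
proof (induction x arbitrary: y)
  case (Cons a x)
  show ?case
  proof (cases "\<exists>z. y = a # z")
    case True
    then obtain z where "y = a # z" by blast
    moreover obtain p u v where "x = p @ u" "z = p @ v" "u = [] \<or> v = [] \<or> hd u \<noteq> hd v"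
      using Cons by metis
    ultimately show ?thesis by (metis append_Cons)
  next
    case False
    then have "y = [] \<or> hd (a # x) \<noteq> hd y" by (cases y) auto
    then show ?thesis by (metis append_Nil)
  qed
qed simp

definition word_dist :: "letter list \<Rightarrow> letter list \<Rightarrow> nat" where
  "word_dist x y = length (free_reduce (inv_word x @ y))"

text \<open>After the longest common prefix is cancelled, \<open>inv_word u @ v\<close> is already
  reduced, because \<open>u\<close> and \<open>v\<close> do not start with the same letter. So
  \<open>l\<close> is the length of that prefix, the branch point of the two words in the
  tree.\<close>

lemma word_dist_prefix:
  assumes "freely_reduced x" "freely_reduced y"
  obtains l where "l \<le> length x" "l \<le> length y" "word_dist x y = (length x - l) + (length y - l)"
    "\<And>R. R \<le> length x \<Longrightarrow> R \<le> length y \<Longrightarrow> take R x = take R y \<longleftrightarrow> R \<le> l"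
proof -
  obtain p u v where x: "x = p @ u" and y: "y = p @ v"
      and uv: "u = [] \<or> v = [] \<or> hd u \<noteq> hd v"
    using common_prefix_split by blast
  have red: "freely_reduced u" "freely_reduced v"
    using assms by (auto simp: x y freely_reduced_append)
  have "freely_reduced (inv_word u @ v)"
    using uv red by (auto simp: freely_reduced_append freely_reduced_inv_word last_inv_word)
  moreover have "free_reduce (inv_word x @ y) = free_reduce (inv_word u @ v)"
    using free_reduce_append_right[of "inv_word u" "inv_word p @ p @ v"]
    by (simp add: x y inv_word_append free_reduce_cancel_left free_reduce_append_right)
  ultimately have "word_dist x y = length u + length v"
    by (simp add: word_dist_def reduce_id)
  moreover have "take R x = take R y \<longleftrightarrow> R \<le> length p" if "R \<le> length x" "R \<le> length y" for R
  proof
    assume eq: "take R x = take R y"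
    show "R \<le> length p"
    proof (rule ccontr)
      assume "\<not> R \<le> length p"
      then have R: "length p < R" by simp
      with that have "u \<noteq> []" "v \<noteq> []" by (auto simp: x y)
      moreover from eq R have "x ! length p = y ! length p" by (metis nth_take)
      ultimately show False using uv by (simp add: x y nth_append hd_conv_nth)
    qed
  qed (simp add: x y)
  ultimately show ?thesis using that[of "length p"] by (simp add: x y)
qed

text \<open>The path from \<open>x\<close> to \<open>y\<close> first goes back to the branch point.
  This takes \<open>length x - l\<close> steps, at most the distance, which leaves
  \<open>R \<le> l\<close>.\<close>

lemma take_eq_of_word_dist:
  assumes "freely_reduced x" "freely_reduced y" "R + word_dist x y \<le> length x"
  shows "take R x = take R y"
proof -
  obtain l where l: "l \<le> length x" "l \<le> length y" "word_dist x y = (length x - l) + (length y - l)"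
      "\<And>R. R \<le> length x \<Longrightarrow> R \<le> length y \<Longrightarrow> take R x = take R y \<longleftrightarrow> R \<le> l"
    using word_dist_prefix assms(1,2) by blast
  have "R \<le> l" using assms(3) l(1-3) by linarith
  then show ?thesis using l(1,2) l(4)[of R] by simp
qed

text \<open>Conjugation reduces to a cyclically reduced word, whose powers are reduced as written.\<close>

lemma cyclic_decomposition:
  assumes "freely_reduced w" "w \<noteq> []"
  shows "\<exists>u c. w = u @ c @ inv_word u \<and> c \<noteq> [] \<and> freely_reduced (c @ c)"
  using assms
proof (induction "length w" arbitrary: w rule: less_induct)
  case less
  show ?case
  proof (cases "hd w = letter_inv (last w)")
    case False
    then have "freely_reduced (w @ w)" using less.prems by (simp add: freely_reduced_append)
    then show ?thesis using less.prems by (intro exI[of _ "[]"] exI[of _ w]) (simp add: inv_word_def)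
  next
    case True
    then obtain x v where w: "w = x # v" using less.prems by (cases w) auto
    with True have "v \<noteq> []" by auto
    then obtain c y where v: "v = c @ [y]" by (cases v rule: rev_cases) auto
    have y: "y = letter_inv x" using True by (simp add: w v)
    have wc: "w = [x] @ c @ [letter_inv x]" by (simp add: w v y)
    have "c \<noteq> []" using less.prems(1) by (auto simp: wc freely_reduced_def)
    moreover have "freely_reduced c" using less.prems(1) unfolding wc freely_reduced_append by blast
    ultimately obtain u d where "c = u @ d @ inv_word u" "d \<noteq> []" "freely_reduced (d @ d)"
      using less.hyps[of c] by (auto simp: wc)
    then show ?thesis
      by (intro exI[of _ "x # u"] exI[of _ d]) (simp add: wc inv_word_def)
  qed
qed

lemma power_word_Suc: "power_word w (Suc k) = w @ power_word w k"
  by (simp add: power_word_def)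

lemma power_word_0 [simp]: "power_word w 0 = []"
  by (simp add: power_word_def)

lemma power_word_add: "power_word w (j + k) = power_word w j @ power_word w k"
  by (simp add: power_word_def replicate_add)

lemma power_word_Suc2: "power_word w (Suc k) = power_word w k @ w"
  using power_word_add[of w k 1] by (simp add: power_word_Suc)

lemma inv_word_power_word: "inv_word (power_word w k) = power_word (inv_word w) k"
proof (induction k)
  case (Suc k)
  then show ?case
    by (simp only: power_word_Suc[of w] power_word_Suc2[of "inv_word w"] inv_word_append)
qed simp

lemma power_word_words: "w \<in> words n \<Longrightarrow> power_word w k \<in> words n"
  by (induction k) (auto simp: power_word_Suc)

lemma length_free_reduce_power_word:
  assumes "freely_reduced w" "w \<noteq> []"
  shows "k \<le> length (free_reduce (power_word w k))"
proof (cases k)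
  case (Suc k')
  obtain u c where w: "w = u @ c @ inv_word u" and c: "c \<noteq> []" "freely_reduced (c @ c)"
    using cyclic_decomposition[OF assms] by blast
  have power: "free_reduce (power_word w (Suc k)) = free_reduce (u @ power_word c (Suc k) @ inv_word u)" for k
  proof (induction k)
    case (Suc k)
    have "free_reduce (power_word w (Suc (Suc k))) = free_reduce (w @ free_reduce (power_word w (Suc k)))"
      by (simp add: power_word_Suc[of w "Suc k"] free_reduce_append_right)
    also have "\<dots> = free_reduce (w @ u @ power_word c (Suc k) @ inv_word u)"
      by (simp only: Suc free_reduce_append_right)
    also have "\<dots> = free_reduce ((u @ c) @ inv_word u @ u @ power_word c (Suc k) @ inv_word u)"
      by (simp add: w)
    also have "\<dots> = free_reduce ((u @ c) @ power_word c (Suc k) @ inv_word u)"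
      by (metis free_reduce_append_right free_reduce_cancel_left)
    finally show ?case by (simp add: power_word_Suc[of c "Suc k"])
  qed (simp add: power_word_Suc w)
  have power_c: "freely_reduced (power_word c (Suc k)) \<and> hd (power_word c (Suc k)) = hd c \<and>
      last (power_word c (Suc k)) = last c \<and> Suc k \<le> length (power_word c (Suc k))" for k
  proof (induction k)
    case 0
    show ?case using c freely_reduced_append[of c c] by (cases c) (auto simp: power_word_Suc)
  next
    case (Suc k)
    define p where "p = power_word c (Suc k)"
    have "p \<noteq> []" using c by (simp add: p_def power_word_Suc)
    moreover have "power_word c (Suc (Suc k)) = c @ p" by (simp add: p_def power_word_Suc)
    moreover have "Suc k < length c + length p"
      using Suc c(1) unfolding p_def[symmetric] by (cases c) auto
    ultimately show ?case
      using Suc c unfolding p_def[symmetric] by (auto simp: freely_reduced_append Suc_le_eq)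
  qed
  have "power_word c k \<noteq> []" using c by (simp add: Suc power_word_Suc)
  \<comment> \<open>Both junctions already occur in the reduced word \<open>w\<close>, since a
    positive power of \<open>c\<close> begins and ends like \<open>c\<close>.\<close>
  then have "freely_reduced (u @ power_word c k @ inv_word u)"
    using power_c[of k'] assms(1) c(1) unfolding w Suc by (auto simp: freely_reduced_append)
  then show ?thesis using power[of k'] power_c[of k'] by (simp add: Suc reduce_id)
qed simp


section \<open>Infinite reduced words and the ends of lines\<close>

definition inf_words :: "nat \<Rightarrow> (nat \<Rightarrow> letter) set" where
  "inf_words n = {\<xi>. (\<forall>i. fst (\<xi> i) < n) \<and> (\<forall>i. \<xi> (Suc i) \<noteq> letter_inv (\<xi> i))}"

definition initial :: "nat \<Rightarrow> (nat \<Rightarrow> letter) \<Rightarrow> letter list" where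
  "initial R \<xi> = map \<xi> [0..<R]"

text \<open>Convergence to a boundary point, letter by letter. The equation forces
  \<open>R \<le> length (x k)\<close>, so the words also leave every ball.\<close>

definition tends :: "(nat \<Rightarrow> letter list) \<Rightarrow> (nat \<Rightarrow> letter) \<Rightarrow> bool" where
  "tends x \<xi> \<longleftrightarrow> (\<forall>R. \<exists>K. \<forall>k\<ge>K. take R (x k) = initial R \<xi>)"

definition line_seq :: "letter list \<Rightarrow> letter list \<Rightarrow> nat \<Rightarrow> letter list" where
  "line_seq g w k = free_reduce (g @ power_word w k)"

lemma length_initial [simp]: "length (initial R \<xi>) = R"
  by (simp add: initial_def)

lemma initial_nth [simp]: "i < R \<Longrightarrow> initial R \<xi> ! i = \<xi> i"
  by (simp add: initial_def)

lemma initial_eq_iff: "initial R \<xi> = initial R \<eta> \<longleftrightarrow> (\<forall>i<R. \<xi> i = \<eta> i)"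
  by (auto simp: initial_def)

lemma initial_Suc: "initial (Suc R) \<xi> = \<xi> 0 # initial R (\<lambda>i. \<xi> (Suc i))"
  by (simp add: initial_def map_upt_Suc del: upt_Suc)

lemma take_initial: "R \<le> S \<Longrightarrow> take R (initial S \<xi>) = initial R \<xi>"
  by (simp add: initial_def take_map)

lemma initial_mono: "R \<le> S \<Longrightarrow> initial S \<xi> = initial S \<eta> \<Longrightarrow> initial R \<xi> = initial R \<eta>"
  by (simp add: initial_eq_iff)

lemma freely_reduced_conv_nth:
  "freely_reduced w \<longleftrightarrow> (\<forall>i. Suc i < length w \<longrightarrow> w ! Suc i \<noteq> letter_inv (w ! i))"
  by (simp add: freely_reduced_def successively_conv_nth)

lemma freely_reduced_initial: "\<xi> \<in> inf_words n \<Longrightarrow> freely_reduced (initial R \<xi>)"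
  by (auto simp: freely_reduced_conv_nth inf_words_def)

lemma initial_words: "\<xi> \<in> inf_words n \<Longrightarrow> initial R \<xi> \<in> words n"
  by (auto simp: initial_def inf_words_def words_def in_lists_conv_set mem_Times_iff)

lemma tends_unique: "tends x \<xi> \<Longrightarrow> tends x \<eta> \<Longrightarrow> \<xi> = \<eta>"
proof
  fix i assume "tends x \<xi>" "tends x \<eta>"
  then obtain K L where "\<And>k. K \<le> k \<Longrightarrow> take (Suc i) (x k) = initial (Suc i) \<xi>"
      "\<And>k. L \<le> k \<Longrightarrow> take (Suc i) (x k) = initial (Suc i) \<eta>"
    unfolding tends_def by meson
  from this(1)[of "max K L"] this(2)[of "max K L"] show "\<xi> i = \<eta> i"
    by (simp add: initial_eq_iff)
qed

lemma tends_inf_words: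
  assumes "tends x \<xi>" "\<And>k. x k \<in> words n" "\<And>k. freely_reduced (x k)"
  shows "\<xi> \<in> inf_words n"
proof -
  have "fst (\<xi> i) < n \<and> \<xi> (Suc i) \<noteq> letter_inv (\<xi> i)" for i
  proof -
    obtain k where k: "take (Suc (Suc i)) (x k) = initial (Suc (Suc i)) \<xi>"
      using assms(1) unfolding tends_def by blast
    then have len: "Suc i < length (x k)"
      by (metis length_initial length_take lessI min.strict_boundedE)
    have nth: "\<xi> i = x k ! i" "\<xi> (Suc i) = x k ! Suc i"
      using k by (metis initial_nth lessI less_SucI nth_take)+
    have "x k ! i \<in> {..<n} \<times> UNIV"
      using assms(2)[of k] len unfolding words_def by (metis Suc_lessD in_listsD nth_mem)
    then show ?thesis
      using assms(3)[of k] len by (auto simp: nth freely_reduced_conv_nth)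
  qed
  then show ?thesis by (simp add: inf_words_def)
qed

section \<open>Sequences along a line and their ends\<close>

lemma line_seq_Suc: "line_seq g w (Suc k) = free_reduce (line_seq g w k @ w)"
  by (simp add: line_seq_def power_word_Suc2 free_reduce_append_left)

lemma freely_reduced_line_seq: "freely_reduced (line_seq g w k)"
  by (simp add: line_seq_def reduced_reduce)

lemma line_seq_words: "g \<in> words n \<Longrightarrow> w \<in> words n \<Longrightarrow> line_seq g w k \<in> words n"
  by (simp add: line_seq_def reduce_words power_word_words)

lemma word_dist_mult: "word_dist x (free_reduce (x @ w)) \<le> length w"
  unfolding word_dist_def
  by (simp add: free_reduce_append_right free_reduce_cancel_left length_free_reduce)

lemma take_line_seq_Suc:
  assumes "R + length w \<le> length (line_seq g w k)"
  shows "take R (line_seq g w (Suc k)) = take R (line_seq g w k)"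
proof -
  have "word_dist (line_seq g w k) (line_seq g w (Suc k)) \<le> length w"
    unfolding line_seq_Suc by (rule word_dist_mult)
  then show ?thesis
    using assms take_eq_of_word_dist[OF freely_reduced_line_seq freely_reduced_line_seq, of R g w k g w "Suc k"]
    by simp
qed

lemma length_line_seq:
  assumes "freely_reduced w" "w \<noteq> []"
  shows "k \<le> length (line_seq g w k) + length g"
  using length_free_reduce_power_word[OF assms, of k] length_free_reduce_append[of "power_word w k" g]
  by (simp add: line_seq_def)

text \<open>Once \<open>R + b + d \<le> k\<close>, the word \<open>x k\<close> has at least
  \<open>R + d\<close> letters, and a step of length at most \<open>d\<close> cannot change the
  first \<open>R\<close> of them. The bound on \<open>k\<close> is kept explicit because the
  algorithm has to compute initial segments of ends; the lemma serves geodesic rays as well.\<close>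

lemma bounded_steps_limit:
  assumes "\<And>k. freely_reduced (x k)" "\<And>k. word_dist (x k) (x (Suc k)) \<le> d"
    "\<And>k. k \<le> length (x k) + b"
  obtains \<xi> where "\<And>R k. R + b + d \<le> k \<Longrightarrow> take R (x k) = initial R \<xi>"
proof -
  define K where "K R = R + b + d" for R
  have stable: "take R (x k) = take R (x (K R))" if "K R \<le> k" for R k
    using that
  proof (induction k rule: dec_induct)
    case (step k)
    then show ?case
      using take_eq_of_word_dist[OF assms(1) assms(1), of R k "Suc k"] assms(2)[of k] assms(3)[of k]
      by (simp add: K_def)
  qed simp
  define \<xi> where "\<xi> i = x (K (Suc i)) ! i" for i
  have "take R (x k) = initial R \<xi>" if k: "R + b + d \<le> k" for R k
  proof (rule nth_equalityI)
    have len: "R \<le> length (x k)"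
      using k assms(3)[of k] by simp
    then show "length (take R (x k)) = length (initial R \<xi>)" by simp
    fix i assume "i < length (take R (x k))"
    then have i: "i < R" by simp
    have "take (Suc i) (x k) = take (Suc i) (x (K (Suc i)))"
      by (rule stable) (use i k in \<open>simp add: K_def\<close>)
    then have "x k ! i = \<xi> i" unfolding \<xi>_def by (metis lessI nth_take)
    then show "take R (x k) ! i = initial R \<xi> ! i" using i by simp
  qed
  then show ?thesis by (rule that)
qed

lemma line_seq_limit:
  assumes "freely_reduced w" "w \<noteq> []"
  obtains \<xi> where "\<And>R k. R + length g + length w \<le> k \<Longrightarrow> take R (line_seq g w k) = initial R \<xi>"
proof -
  have "word_dist (line_seq g w k) (line_seq g w (Suc k)) \<le> length w" for k
    unfolding line_seq_Suc by (rule word_dist_mult)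
  from bounded_steps_limit[OF freely_reduced_line_seq this length_line_seq[OF assms]] that
  show ?thesis by blast
qed

lemma line_seq_limit_tends:
  assumes "\<And>R k. R + length g + length w \<le> k \<Longrightarrow> take R (line_seq g w k) = initial R \<xi>"
  shows "tends (line_seq g w) \<xi>"
  unfolding tends_def using assms by blast

lemma tends_shift: "tends (\<lambda>k. x (k + j)) \<xi> \<longleftrightarrow> tends x \<xi>"
proof
  assume "tends (\<lambda>k. x (k + j)) \<xi>"
  then have "\<exists>K. \<forall>k\<ge>K. take R (x (k + j)) = initial R \<xi>" for R by (simp add: tends_def)
  then have "\<exists>K. \<forall>k\<ge>K. take R (x k) = initial R \<xi>" for R
    by (metis add_leD2 le_add_diff_inverse2 le_diff_conv2)
  then show "tends x \<xi>" by (simp add: tends_def)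
qed (auto simp: tends_def, meson trans_le_add1)

lemma line_seq_line_seq: "line_seq (line_seq g w j) w k = line_seq g w (k + j)"
  by (simp add: line_seq_def free_reduce_append_left add.commute power_word_add)

lemma line_seq_line_seq_inv: "line_seq (line_seq g w j) (inv_word w) (k + j) = line_seq g (inv_word w) k"
proof -
  have "line_seq (line_seq g w j) (inv_word w) (k + j) =
      free_reduce ((g @ power_word w j) @ power_word (inv_word w) j @ power_word (inv_word w) k)"
    by (simp add: line_seq_def free_reduce_append_left add.commute power_word_add)
  also have "\<dots> = free_reduce (g @ free_reduce (power_word w j @ inv_word (power_word w j) @ power_word (inv_word w) k))"
    by (simp add: inv_word_power_word free_reduce_append_right)
  finally show ?thesis by (simp only: free_reduce_cancel_right free_reduce_append_right line_seq_def)
qed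

text \<open>Moving the base point along its line cuts a start off one half-line and adds one to the
  other, which affects neither end.\<close>

lemma tends_line_seq_shift:
  "tends (line_seq (line_seq g w j) w) \<xi> \<longleftrightarrow> tends (line_seq g w) \<xi>"
  "tends (line_seq (line_seq g w j) (inv_word w)) \<xi> \<longleftrightarrow> tends (line_seq g (inv_word w)) \<xi>"
proof -
  have "line_seq (line_seq g w j) w = (\<lambda>k. line_seq g w (k + j))"
    by (simp add: fun_eq_iff line_seq_line_seq)
  then show "tends (line_seq (line_seq g w j) w) \<xi> \<longleftrightarrow> tends (line_seq g w) \<xi>"
    using tends_shift[of "line_seq g w" j \<xi>] by simp
  show "tends (line_seq (line_seq g w j) (inv_word w)) \<xi> \<longleftrightarrow> tends (line_seq g (inv_word w)) \<xi>"
    using tends_shift[of "line_seq (line_seq g w j) (inv_word w)" j \<xi>]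
    by (simp add: line_seq_line_seq_inv)
qed

text \<open>A line that stays far from the identity has ends with a common initial segment.\<close>

lemma short_representative:
  assumes "tends (line_seq g w) \<xi>" "tends (line_seq g (inv_word w)) \<eta>" "initial R \<xi> \<noteq> initial R \<eta>"
    "g \<in> words n" "w \<in> words n"
  obtains h where "h \<in> words n" "length h < R + length w"
    "tends (line_seq h w) \<xi>" "tends (line_seq h (inv_word w)) \<eta>"
proof -
  have "\<exists>j. length (line_seq g w j) < R + length w \<or> length (line_seq g (inv_word w) j) < R + length w"
  proof (rule ccontr)
    assume "\<not> ?thesis"
    then have far: "R + length w \<le> length (line_seq g w j)"
        "R + length w \<le> length (line_seq g (inv_word w) j)" for j
      by (auto simp: not_less)
    \<comment> \<open>As long as a half-line stays far from the identity, no step changes its first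
      \<open>R\<close> letters, so both ends inherit them from the common starting point.\<close>
    have "take R (line_seq g w k) = take R (free_reduce g)"
        "take R (line_seq g (inv_word w) k) = take R (free_reduce g)" for k
      using far take_line_seq_Suc[of R w g] take_line_seq_Suc[of R "inv_word w" g]
      by (induction k) (simp_all, simp_all add: line_seq_def)
    then have "initial R \<xi> = take R (free_reduce g)" "initial R \<eta> = take R (free_reduce g)"
      using assms(1,2) unfolding tends_def by (metis order_refl)+
    with assms(3) show False by simp
  qed
  then obtain j where
    "length (line_seq g w j) < R + length w \<or> length (line_seq g (inv_word w) j) < R + length w" ..
  then show ?thesis
  proof
    assume "length (line_seq g w j) < R + length w"
    then show ?thesis
      using that[of "line_seq g w j"] assms(1,2,4,5) by (simp add: line_seq_words tends_line_seq_shift)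
  next
    assume "length (line_seq g (inv_word w) j) < R + length w"
    then show ?thesis
      using that[of "line_seq g (inv_word w) j"] assms(1,2,4,5)
        tends_line_seq_shift[of g "inv_word w" j]
      by (simp add: line_seq_words inv_word_words)
  qed
qed

text \<open>With unreduced \<open>g\<close> allowed, translation of a line by a letter is a plain
  Cons. No lines are added, since \<open>line_seq g w\<close> depends on
  \<open>free_reduce g\<close> only.\<close>

definition pattern_ends :: "nat \<Rightarrow> letter list list \<Rightarrow> ((nat \<Rightarrow> letter) \<times> (nat \<Rightarrow> letter)) set" where
  "pattern_ends n ws = {(\<xi>, \<eta>). \<exists>g\<in>words n. \<exists>w\<in>set ws.
    tends (line_seq g w) \<xi> \<and> tends (line_seq g (inv_word w)) \<eta>}"

text \<open>The action of a letter on the boundary of the tree.\<close>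

definition inf_push :: "letter \<Rightarrow> (nat \<Rightarrow> letter) \<Rightarrow> nat \<Rightarrow> letter" where
  "inf_push x \<xi> = (if \<xi> 0 = letter_inv x then (\<lambda>i. \<xi> (Suc i)) else case_nat x \<xi>)"

lemma tends_push:
  assumes "tends x \<xi>"
  shows "tends (\<lambda>k. push a (x k)) (inf_push a \<xi>)"
  unfolding tends_def
proof
  fix R
  \<comment> \<open>One letter more than \<open>R\<close>, as a cancellation uses one up.\<close>
  obtain K where K: "\<And>k. K \<le> k \<Longrightarrow> take (Suc R) (x k) = initial (Suc R) \<xi>"
    using assms unfolding tends_def by blast
  have "take R (push a (x k)) = initial R (inf_push a \<xi>)" if k: "K \<le> k" for k
  proof -
    obtain v where v: "x k = \<xi> 0 # v" "take R v = initial R (\<lambda>i. \<xi> (Suc i))"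
      using K[OF k] unfolding initial_Suc by (cases "x k") auto
    have "initial R (case_nat a \<xi>) = take R (a # initial (Suc R) \<xi>)"
      by (rule nth_equalityI) (auto simp: nth_Cons split: nat.split)
    also have "\<dots> = take R (a # x k)" 
      unfolding K[OF k, symmetric] by (cases R) (auto simp: min_def)
    finally show ?thesis using v by (auto simp: inf_push_def)
  qed
  then show "\<exists>K. \<forall>k\<ge>K. take R (push a (x k)) = initial R (inf_push a \<xi>)" by blast
qed

lemma line_seq_Cons: "line_seq (x # g) w k = push x (line_seq g w k)"
  by (simp add: line_seq_def free_reduce_def)

lemma pattern_ends_push:
  "(\<xi>, \<eta>) \<in> pattern_ends n ws \<Longrightarrow> fst x < n \<Longrightarrow>
    (inf_push x \<xi>, inf_push x \<eta>) \<in> pattern_ends n ws"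
proof -
  assume x: "fst x < n" and "(\<xi>, \<eta>) \<in> pattern_ends n ws"
  then obtain g w where gw: "g \<in> words n" "w \<in> set ws" "tends (line_seq g w) \<xi>"
      "tends (line_seq g (inv_word w)) \<eta>"
    unfolding pattern_ends_def by blast
  have "line_seq (x # g) v = (\<lambda>k. push x (line_seq g v k))" for v
    by (simp add: fun_eq_iff line_seq_Cons)
  then have "tends (line_seq (x # g) w) (inf_push x \<xi>)"
      "tends (line_seq (x # g) (inv_word w)) (inf_push x \<eta>)"
    using gw(3,4) by (simp_all add: tends_push)
  moreover have "x # g \<in> words n" using x gw(1) by simp
  ultimately show ?thesis unfolding pattern_ends_def using gw(2) by blast
qed

lemma pattern_ends_inf_words:
  assumes "(\<xi>, \<eta>) \<in> pattern_ends n ws" "set ws \<subseteq> words n"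
  shows "\<xi> \<in> inf_words n" "\<eta> \<in> inf_words n"
  using assms unfolding pattern_ends_def
  by (auto intro!: tends_inf_words[of "line_seq _ _"] line_seq_words inv_word_words freely_reduced_line_seq)


section \<open>Bounding the depth of a disconnection\<close>

lemma increasing_chain_stabilises:
  fixes S :: "nat \<Rightarrow> 'a set"
  assumes "\<And>r. S r \<subseteq> S (Suc r)" "\<And>r. S r \<subseteq> U" "finite U" "card U \<le> M"
  shows "\<exists>r\<le>M. S r = S (Suc r)"
proof (rule ccontr)
  assume "\<not> ?thesis"
  then have strict: "S r \<subset> S (Suc r)" if "r \<le> M" for r using assms(1) that by blast
  have "r \<le> card (S r)" if "r \<le> Suc M" for r
    using that
  proof (induction r)
    case (Suc r)
    then have "card (S r) < card (S (Suc r))"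
      using strict[of r] finite_subset[OF assms(2,3)] by (intro psubset_card_mono) auto
    with Suc show ?case by simp
  qed simp
  from this[of "Suc M"] have "Suc M \<le> card U"
    using card_mono[OF assms(3,2)] by (meson le_trans order_refl)
  with assms(4) show False by simp
qed

text \<open>The relation \<open>E\<close> pairs the two ends of the lines. A clopen set of infinite words is one that
  has a depth, and it is pulled back from the decomposition space if it is saturated.\<close>

locale end_relation =
  fixes n :: nat and E :: "((nat \<Rightarrow> letter) \<times> (nat \<Rightarrow> letter)) set"
  assumes E_inf_words: "(\<xi>, \<eta>) \<in> E \<Longrightarrow> \<xi> \<in> inf_words n" "(\<xi>, \<eta>) \<in> E \<Longrightarrow> \<eta> \<in> inf_words n"
    and E_sym: "(\<xi>, \<eta>) \<in> E \<Longrightarrow> (\<eta>, \<xi>) \<in> E"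
    and E_push: "(\<xi>, \<eta>) \<in> E \<Longrightarrow> fst x < n \<Longrightarrow> (inf_push x \<xi>, inf_push x \<eta>) \<in> E"
begin

definition has_depth :: "nat \<Rightarrow> (nat \<Rightarrow> letter) set \<Rightarrow> bool" where
  "has_depth R A \<longleftrightarrow>
    (\<forall>\<xi>\<in>inf_words n. \<forall>\<eta>\<in>inf_words n. initial R \<xi> = initial R \<eta> \<longrightarrow> (\<xi> \<in> A \<longleftrightarrow> \<eta> \<in> A))"

definition separated :: "nat \<Rightarrow> bool" where
  "separated R \<longleftrightarrow> (\<exists>A \<subseteq> inf_words n. has_depth R A \<and>
    (\<forall>\<xi> \<eta>. (\<xi>, \<eta>) \<in> E \<longrightarrow> (\<xi> \<in> A \<longleftrightarrow> \<eta> \<in> A)) \<and> A \<noteq> {} \<and> A \<noteq> inf_words n)"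

text \<open>\<open>cylinder x\<close> is the part of the boundary beyond the edge of the Cayley tree from the identity
  to \<open>x\<close>.\<close>

definition cylinder :: "letter \<Rightarrow> (nat \<Rightarrow> letter) set" where
  "cylinder x = {\<xi> \<in> inf_words n. \<xi> 0 = x}"

text \<open>The ends of the lines through the identity. A line crossing the edge to \<open>x\<close>
  passes through the identity and has exactly one end in \<open>cylinder x\<close>, so this one set
  serves the edges of all letters.\<close>

definition crossing_ends :: "(nat \<Rightarrow> letter) set" where
  "crossing_ends = {\<xi>. \<exists>\<eta>. (\<xi>, \<eta>) \<in> E \<and> \<xi> 0 \<noteq> \<eta> 0}"

text \<open>The index counts letters after \<open>x\<close>, so passing to the next edge lowers it
  by one. At index 0 only the empty set and the cylinder remain.\<close>

definition saturated_in :: "letter \<Rightarrow> nat \<Rightarrow> (nat \<Rightarrow> letter) set \<Rightarrow> bool" where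
  "saturated_in x R A \<longleftrightarrow> A \<subseteq> cylinder x \<and> has_depth (Suc R) A \<and>
    (\<forall>\<xi> \<eta>. (\<xi>, \<eta>) \<in> E \<longrightarrow> \<xi> \<in> cylinder x \<longrightarrow> \<eta> \<in> cylinder x \<longrightarrow> (\<xi> \<in> A \<longleftrightarrow> \<eta> \<in> A))"

text \<open>All that the rest of the tree sees of a saturated subset of a cylinder.\<close>

definition state :: "letter \<Rightarrow> (nat \<Rightarrow> letter) set \<Rightarrow> (nat \<Rightarrow> letter) set \<times> bool \<times> bool" where
  "state x A = (A \<inter> crossing_ends, A = {}, A = cylinder x)"

definition states :: "nat \<Rightarrow> (letter \<times> (nat \<Rightarrow> letter) set \<times> bool \<times> bool) set" where
  "states R = {(x, state x A) | x A. fst x < n \<and> saturated_in x R A}"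

definition tail :: "(nat \<Rightarrow> letter) \<Rightarrow> nat \<Rightarrow> letter" where
  "tail \<xi> = (\<lambda>i. \<xi> (Suc i))"

text \<open>The part of \<open>A\<close> beyond the edge that follows \<open>x\<close> in direction
  \<open>y\<close>, translated so that this edge starts at the identity.\<close>

definition restrict :: "letter \<Rightarrow> (nat \<Rightarrow> letter) set \<Rightarrow> letter \<Rightarrow> (nat \<Rightarrow> letter) set" where
  "restrict x A y = {\<zeta> \<in> cylinder y. case_nat x \<zeta> \<in> A}"

definition glue :: "letter \<Rightarrow> (letter \<Rightarrow> (nat \<Rightarrow> letter) set) \<Rightarrow> (nat \<Rightarrow> letter) set" where
  "glue x B = {\<xi> \<in> cylinder x. tail \<xi> \<in> B (\<xi> 1)}"

lemma has_depth_mono: "has_depth R A \<Longrightarrow> R \<le> S \<Longrightarrow> has_depth S A"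
  unfolding has_depth_def using initial_mono[of R S] by meson

lemma separated_mono: "separated R \<Longrightarrow> R \<le> S \<Longrightarrow> separated S"
  unfolding separated_def using has_depth_mono[of R _ S] by meson

lemma states_mono: "states R \<subseteq> states (Suc R)"
proof
  fix s assume "s \<in> states R"
  then obtain x A where "s = (x, state x A)" "fst x < n" "saturated_in x R A"
    unfolding states_def by blast
  moreover from this have "saturated_in x (Suc R) A"
    using has_depth_mono[of "Suc R" A "Suc (Suc R)"] by (simp add: saturated_in_def)
  ultimately show "s \<in> states (Suc R)" unfolding states_def by blast
qed

section \<open>Passing from one edge to the next\<close>

lemma cylinder_letter: "\<xi> \<in> cylinder x \<Longrightarrow> fst x < n"
  by (auto simp: cylinder_def inf_words_def)

lemma tail_cylinder:
  assumes "\<xi> \<in> cylinder x"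
  shows "tail \<xi> \<in> cylinder (\<xi> 1)" "\<xi> 1 \<noteq> letter_inv x" "case_nat x (tail \<xi>) = \<xi>"
proof -
  show "tail \<xi> \<in> cylinder (\<xi> 1)" "\<xi> 1 \<noteq> letter_inv x"
    using assms by (auto simp: cylinder_def inf_words_def tail_def dest: spec[of _ 0])
  show "case_nat x (tail \<xi>) = \<xi>"
    using assms by (auto simp: fun_eq_iff tail_def cylinder_def split: nat.split)
qed

lemma case_nat_cylinder:
  assumes "\<zeta> \<in> cylinder y" "y \<noteq> letter_inv x" "fst x < n"
  shows "case_nat x \<zeta> \<in> cylinder x" "tail (case_nat x \<zeta>) = \<zeta>" "(case_nat x \<zeta>) 1 = y"
  using assms by (auto simp: cylinder_def inf_words_def tail_def split: nat.split)

text \<open>Translation by the inverse of \<open>x\<close> removes the first letter of the words in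
  \<open>cylinder x\<close> and puts \<open>letter_inv x\<close> in front of all others.\<close>

lemma E_tail:
  assumes "(\<xi>, \<eta>) \<in> E" "\<xi> \<in> cylinder x"
  shows "\<eta> \<in> cylinder x \<Longrightarrow> (tail \<xi>, tail \<eta>) \<in> E"
    and "\<eta> \<notin> cylinder x \<Longrightarrow> \<exists>\<eta>'. (tail \<xi>, \<eta>') \<in> E \<and> \<eta>' 0 = letter_inv x"
proof -
  have push: "(inf_push (letter_inv x) \<xi>, inf_push (letter_inv x) \<eta>) \<in> E"
    using assms cylinder_letter by (intro E_push) auto
  have tail: "inf_push (letter_inv x) \<xi>' = tail \<xi>'" if "\<xi>' \<in> cylinder x" for \<xi>'
    using that by (simp add: inf_push_def tail_def cylinder_def)
  show "(tail \<xi>, tail \<eta>) \<in> E" if "\<eta> \<in> cylinder x"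
    using push that assms(2) by (simp add: tail)
  assume "\<eta> \<notin> cylinder x"
  then have "\<eta> 0 \<noteq> x" using E_inf_words assms(1) by (auto simp: cylinder_def)
  then have "inf_push (letter_inv x) \<eta> 0 = letter_inv x" by (simp add: inf_push_def)
  with push assms(2) show "\<exists>\<eta>'. (tail \<xi>, \<eta>') \<in> E \<and> \<eta>' 0 = letter_inv x"
    by (auto simp: tail)
qed

text \<open>A line through the identity and \<open>x\<close> is carried by the inverse of
  \<open>x\<close> to a line that again passes through the identity. So an end recorded in the state
  at one edge is recorded at the next edge too, and the states of the pieces determine that of the
  glued set.\<close>

lemma tail_crossing:
  assumes "\<xi> \<in> cylinder x" "\<xi> \<in> crossing_ends"
  shows "tail \<xi> \<in> crossing_ends"
proof -
  obtain \<eta> where \<eta>: "(\<xi>, \<eta>) \<in> E" "\<xi> 0 \<noteq> \<eta> 0"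
    using assms(2) unfolding crossing_ends_def by blast
  then have "\<eta> \<notin> cylinder x" using assms(1) by (auto simp: cylinder_def)
  then obtain \<eta>' where "(tail \<xi>, \<eta>') \<in> E" "\<eta>' 0 = letter_inv x"
    using E_tail(2) \<eta>(1) assms(1) by blast
  moreover have "tail \<xi> 0 \<noteq> letter_inv x"
    using tail_cylinder(2)[OF assms(1)] by (simp add: tail_def)
  ultimately show ?thesis unfolding crossing_ends_def by auto
qed

lemma glue_restrict:
  assumes "A \<subseteq> cylinder x"
  shows "glue x (restrict x A) = A"
proof -
  have "\<xi> \<in> glue x (restrict x A) \<longleftrightarrow> \<xi> \<in> A" if "\<xi> \<in> cylinder x" for \<xi>
    using tail_cylinder[OF that] that by (simp add: glue_def restrict_def)
  moreover have "glue x (restrict x A) \<subseteq> cylinder x" by (simp add: glue_def)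
  ultimately show ?thesis using assms by blast
qed

lemma glue_eq_empty:
  assumes "fst x < n" "\<And>y. fst y < n \<Longrightarrow> y \<noteq> letter_inv x \<Longrightarrow> B y \<subseteq> cylinder y"
  shows "glue x B = {} \<longleftrightarrow> (\<forall>y. fst y < n \<longrightarrow> y \<noteq> letter_inv x \<longrightarrow> B y = {})"
proof
  assume empty: "glue x B = {}"
  have False if "\<zeta> \<in> B y" "fst y < n" "y \<noteq> letter_inv x" for \<zeta> y
  proof -
    have "\<zeta> \<in> cylinder y" using assms(2)[OF that(2,3)] that(1) by blast
    then have "case_nat x \<zeta> \<in> glue x B"
      using case_nat_cylinder[of \<zeta> y x] assms(1) that unfolding glue_def by simp
    with empty show False by simp
  qed
  then show "\<forall>y. fst y < n \<longrightarrow> y \<noteq> letter_inv x \<longrightarrow> B y = {}" by blast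
next
  assume all: "\<forall>y. fst y < n \<longrightarrow> y \<noteq> letter_inv x \<longrightarrow> B y = {}"
  have "tail \<xi> \<notin> B (\<xi> 1)" if "\<xi> \<in> cylinder x" for \<xi>
    using tail_cylinder[OF that] all cylinder_letter by blast
  then show "glue x B = {}" by (auto simp: glue_def)
qed

lemma glue_eq_cylinder:
  assumes "fst x < n" "\<And>y. fst y < n \<Longrightarrow> y \<noteq> letter_inv x \<Longrightarrow> B y \<subseteq> cylinder y"
  shows "glue x B = cylinder x \<longleftrightarrow> (\<forall>y. fst y < n \<longrightarrow> y \<noteq> letter_inv x \<longrightarrow> B y = cylinder y)"
proof
  assume full: "glue x B = cylinder x"
  have "\<zeta> \<in> B y" if "\<zeta> \<in> cylinder y" "y \<noteq> letter_inv x" for \<zeta> y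
  proof -
    have "case_nat x \<zeta> \<in> glue x B" using case_nat_cylinder[of \<zeta> y x] assms(1) that full by simp
    then show ?thesis using case_nat_cylinder[of \<zeta> y x] assms(1) that by (simp add: glue_def)
  qed
  then show "\<forall>y. fst y < n \<longrightarrow> y \<noteq> letter_inv x \<longrightarrow> B y = cylinder y" using assms(2) by blast
next
  assume all: "\<forall>y. fst y < n \<longrightarrow> y \<noteq> letter_inv x \<longrightarrow> B y = cylinder y"
  have "tail \<xi> \<in> B (\<xi> 1)" if "\<xi> \<in> cylinder x" for \<xi>
    using tail_cylinder[OF that] all cylinder_letter by metis
  then show "glue x B = cylinder x" by (auto simp: glue_def)
qed

lemma inf_words_tail: "\<xi> \<in> inf_words n \<Longrightarrow> tail \<xi> \<in> inf_words n"
  by (auto simp: inf_words_def tail_def)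

section \<open>Replacing pieces by others with the same state\<close>

lemma saturated_in_restrict:
  assumes "saturated_in x (Suc R) A" "fst x < n" "y \<noteq> letter_inv x"
  shows "saturated_in y R (restrict x A y)"
proof -
  have "has_depth (Suc R) (restrict x A y)"
    unfolding has_depth_def
  proof (intro ballI impI)
    fix \<xi> \<eta> assume X: "\<xi> \<in> inf_words n" "\<eta> \<in> inf_words n" and eq: "initial (Suc R) \<xi> = initial (Suc R) \<eta>"
    have "\<xi> 0 = \<eta> 0" using eq by (simp add: initial_Suc)
    then have cyl: "\<xi> \<in> cylinder y \<longleftrightarrow> \<eta> \<in> cylinder y" using X by (simp add: cylinder_def)
    have "initial (Suc (Suc R)) (case_nat x \<xi>) = initial (Suc (Suc R)) (case_nat x \<eta>)"
      using eq by (simp add: initial_Suc[of "Suc R"])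
    then have "case_nat x \<xi> \<in> A \<longleftrightarrow> case_nat x \<eta> \<in> A" if "\<xi> \<in> cylinder y"
      using assms that cyl case_nat_cylinder(1)[of _ y x]
      unfolding saturated_in_def has_depth_def by (auto simp: cylinder_def)
    then show "\<xi> \<in> restrict x A y \<longleftrightarrow> \<eta> \<in> restrict x A y"
      using cyl by (auto simp: restrict_def)
  qed
  moreover have "\<xi> \<in> restrict x A y \<longleftrightarrow> \<eta> \<in> restrict x A y"
    if E: "(\<xi>, \<eta>) \<in> E" and cyl: "\<xi> \<in> cylinder y" "\<eta> \<in> cylinder y" for \<xi> \<eta>
  proof -
    have "inf_push x \<zeta> = case_nat x \<zeta>" if "\<zeta> \<in> cylinder y" for \<zeta>
      using that assms(3) by (simp add: inf_push_def cylinder_def)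
    then have "(case_nat x \<xi>, case_nat x \<eta>) \<in> E" using E_push[OF E assms(2)] cyl by simp
    then show ?thesis
      using assms case_nat_cylinder(1)[of _ y x] cyl
      unfolding saturated_in_def restrict_def by blast
  qed
  ultimately show ?thesis unfolding saturated_in_def by (auto simp: restrict_def)
qed

text \<open>The index \<open>S\<close> of \<open>A\<close> is absent from the conclusion: the depth
  of the glued set comes from the new pieces alone. This is what shortens a disconnection.\<close>

lemma glue_same_states:
  assumes A: "saturated_in x (Suc S) A" and x: "fst x < n"
    and B: "\<And>y. fst y < n \<Longrightarrow> y \<noteq> letter_inv x \<Longrightarrow>
      saturated_in y R (B y) \<and> state y (B y) = state y (restrict x A y)"
  shows "saturated_in x (Suc R) (glue x B)" "state x (glue x B) = state x A"
proof -
  define A' where "A' = restrict x A"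
  have A_glue: "A = glue x A'"
    using A glue_restrict unfolding A'_def saturated_in_def by blast
  have A': "saturated_in y S (A' y)" if "y \<noteq> letter_inv x" for y
    using saturated_in_restrict[OF A x that] by (simp add: A'_def)
  have same: "\<zeta> \<in> B y \<longleftrightarrow> \<zeta> \<in> A' y"
    if "\<zeta> \<in> crossing_ends" "fst y < n" "y \<noteq> letter_inv x" for \<zeta> y
    using B[of y] that unfolding state_def A'_def by blast
  have next_letter: "fst (\<xi> 1) < n" "\<xi> 1 \<noteq> letter_inv x" if "\<xi> \<in> cylinder x" for \<xi>
    using tail_cylinder[OF that] cylinder_letter by auto
  have glue_same: "\<xi> \<in> glue x B \<longleftrightarrow> \<xi> \<in> A" if "\<xi> \<in> cylinder x" "tail \<xi> \<in> crossing_ends" for \<xi>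
    using that(1) same[OF that(2) next_letter[OF that(1)]] unfolding A_glue glue_def by simp
  have "has_depth (Suc (Suc R)) (glue x B)"
    unfolding has_depth_def
  proof (intro ballI impI)
    fix \<xi> \<eta> assume X: "\<xi> \<in> inf_words n" "\<eta> \<in> inf_words n"
      and eq: "initial (Suc (Suc R)) \<xi> = initial (Suc (Suc R)) \<eta>"
    have cyl: "\<xi> \<in> cylinder x \<longleftrightarrow> \<eta> \<in> cylinder x"
      using X eq by (simp add: initial_Suc cylinder_def)
    have first: "\<xi> 1 = \<eta> 1" "initial (Suc R) (tail \<xi>) = initial (Suc R) (tail \<eta>)"
      using eq by (simp_all add: initial_Suc tail_def)
    have "tail \<xi> \<in> B (\<xi> 1) \<longleftrightarrow> tail \<eta> \<in> B (\<xi> 1)" if "\<xi> \<in> cylinder x"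
      using B[OF next_letter[OF that]] first(2) X inf_words_tail
      unfolding saturated_in_def has_depth_def by blast
    then show "\<xi> \<in> glue x B \<longleftrightarrow> \<eta> \<in> glue x B" using cyl first by (auto simp: glue_def)
  qed
  moreover have "\<xi> \<in> glue x B \<longleftrightarrow> \<eta> \<in> glue x B"
    if E: "(\<xi>, \<eta>) \<in> E" and cyl: "\<xi> \<in> cylinder x" "\<eta> \<in> cylinder x" for \<xi> \<eta>
  proof (cases "\<xi> 1 = \<eta> 1")
    case True
    then have "tail \<xi> \<in> B (\<xi> 1) \<longleftrightarrow> tail \<eta> \<in> B (\<xi> 1)"
      using B[OF next_letter[OF cyl(1)]] E_tail(1)[OF E cyl] tail_cylinder(1)[OF cyl(1)]
        tail_cylinder(1)[OF cyl(2)]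
      unfolding saturated_in_def by metis
    then show ?thesis using cyl True by (simp add: glue_def)
  next
    case False
    \<comment> \<open>A line between two different pieces becomes, after translation, a line through
      the identity. The states record both of its ends, so \<open>glue x B\<close> treats them as
      \<open>A\<close> does.\<close>
    have tails: "(tail \<xi>, tail \<eta>) \<in> E" by (rule E_tail(1)[OF E cyl])
    moreover have "tail \<xi> 0 \<noteq> tail \<eta> 0" using False by (simp add: tail_def)
    ultimately have "tail \<xi> \<in> crossing_ends" "tail \<eta> \<in> crossing_ends"
      using E_sym[OF tails] unfolding crossing_ends_def by fastforce+
    then have "\<xi> \<in> glue x B \<longleftrightarrow> \<xi> \<in> A" "\<eta> \<in> glue x B \<longleftrightarrow> \<eta> \<in> A"
      using glue_same cyl by blast+
    moreover have "\<xi> \<in> A \<longleftrightarrow> \<eta> \<in> A" using A E cyl unfolding saturated_in_def by blast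
    ultimately show ?thesis by simp
  qed
  ultimately show "saturated_in x (Suc R) (glue x B)"
    unfolding saturated_in_def by (auto simp: glue_def)
  have "glue x B \<inter> crossing_ends = A \<inter> crossing_ends"
  proof -
    have "glue x B \<subseteq> cylinder x" "A \<subseteq> cylinder x"
      using A unfolding saturated_in_def by (auto simp: glue_def)
    then show ?thesis using glue_same tail_crossing by blast
  qed
  moreover have B_cylinder: "B y \<subseteq> cylinder y" if "fst y < n" "y \<noteq> letter_inv x" for y
    using B[OF that] unfolding saturated_in_def by blast
  have A'_cylinder: "A' y \<subseteq> cylinder y" for y by (auto simp: A'_def restrict_def)
  have flags: "B y = {} \<longleftrightarrow> A' y = {}" "B y = cylinder y \<longleftrightarrow> A' y = cylinder y"
    if "fst y < n" "y \<noteq> letter_inv x" for y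
    using B[OF that] by (simp_all add: state_def A'_def)
  have "glue x B = {} \<longleftrightarrow> glue x A' = {}"
    using glue_eq_empty[OF x, of B] glue_eq_empty[OF x, of A'] B_cylinder A'_cylinder flags(1)
    by simp
  moreover have "glue x B = cylinder x \<longleftrightarrow> glue x A' = cylinder x"
    using glue_eq_cylinder[OF x, of B] glue_eq_cylinder[OF x, of A'] B_cylinder A'_cylinder flags(2)
    by simp
  ultimately show "state x (glue x B) = state x A" 
    unfolding state_def A_glue[symmetric] by simp
qed

text \<open>A set of index \<open>Suc (Suc R)\<close> enters its state only through the states of
  its pieces beyond the next edges. These occur at index \<open>Suc R\<close>, hence by assumption
  at index \<open>R\<close>, and gluing raises the index by one.\<close>

lemma states_stable_step:
  assumes "states R = states (Suc R)"
  shows "states (Suc R) = states (Suc (Suc R))"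
proof
  show "states (Suc (Suc R)) \<subseteq> states (Suc R)"
  proof
    fix s assume "s \<in> states (Suc (Suc R))"
    then obtain x A where s: "s = (x, state x A)" and x: "fst x < n"
        and A: "saturated_in x (Suc (Suc R)) A"
      unfolding states_def by blast
    have "\<exists>B. saturated_in y R B \<and> state y B = state y (restrict x A y)"
      if "fst y < n" "y \<noteq> letter_inv x" for y
    proof -
      have "(y, state y (restrict x A y)) \<in> states (Suc R)"
        using saturated_in_restrict[OF A x that(2)] that(1) unfolding states_def by blast
      then have "(y, state y (restrict x A y)) \<in> states R" by (simp only: assms)
      then show ?thesis unfolding states_def by auto
    qed
    then obtain B where B: "\<And>y. fst y < n \<Longrightarrow> y \<noteq> letter_inv x \<Longrightarrow>
        saturated_in y R (B y) \<and> state y (B y) = state y (restrict x A y)"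
      by metis
    have "saturated_in x (Suc R) (glue x B)" "state x (glue x B) = state x A"
      using glue_same_states[OF A x] B by blast+
    then show "s \<in> states (Suc R)"
      unfolding s states_def using x by (intro CollectI exI[of _ x] exI[of _ "glue x B"]) simp
  qed
qed (rule states_mono)

text \<open>The same replacement at the identity, where the cylinders of all letters meet and
  together make up the whole boundary.\<close>

lemma separated_step:
  assumes "states R = states (Suc R)" "separated (Suc (Suc R))"
  shows "separated (Suc R)"
proof -
  obtain A where A: "A \<subseteq> inf_words n" "has_depth (Suc (Suc R)) A"
      "\<And>\<xi> \<eta>. (\<xi>, \<eta>) \<in> E \<Longrightarrow> \<xi> \<in> A \<longleftrightarrow> \<eta> \<in> A" "A \<noteq> {}" "A \<noteq> inf_words n"
    using assms(2) unfolding separated_def by blast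
  have letter: "fst (\<xi> 0) < n" "\<xi> \<in> cylinder (\<xi> 0)" if "\<xi> \<in> inf_words n" for \<xi>
    using that by (auto simp: inf_words_def cylinder_def)
  have "\<exists>B. saturated_in y R B \<and> state y B = state y (A \<inter> cylinder y)" if "fst y < n" for y
  proof -
    have "has_depth (Suc (Suc R)) (A \<inter> cylinder y)"
      unfolding has_depth_def
    proof (intro ballI impI)
      fix \<xi> \<eta> assume X: "\<xi> \<in> inf_words n" "\<eta> \<in> inf_words n"
        and eq: "initial (Suc (Suc R)) \<xi> = initial (Suc (Suc R)) \<eta>"
      have "\<xi> \<in> cylinder y \<longleftrightarrow> \<eta> \<in> cylinder y"
        using X eq by (simp add: initial_Suc cylinder_def)
      moreover have "\<xi> \<in> A \<longleftrightarrow> \<eta> \<in> A" using A(2) X eq unfolding has_depth_def by blast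
      ultimately show "\<xi> \<in> A \<inter> cylinder y \<longleftrightarrow> \<eta> \<in> A \<inter> cylinder y" by blast
    qed
    then have "saturated_in y (Suc R) (A \<inter> cylinder y)"
      using A(3) unfolding saturated_in_def by blast
    then have "(y, state y (A \<inter> cylinder y)) \<in> states (Suc R)"
      using that unfolding states_def by blast
    then have "(y, state y (A \<inter> cylinder y)) \<in> states R" by (simp only: assms(1))
    then show ?thesis unfolding states_def by auto
  qed
  then obtain B where B: "\<And>y. fst y < n \<Longrightarrow> saturated_in y R (B y)"
      "\<And>y. fst y < n \<Longrightarrow> state y (B y) = state y (A \<inter> cylinder y)"
    by metis
  define C where "C = {\<xi> \<in> inf_words n. \<xi> \<in> B (\<xi> 0)}"
  have C_B: "C \<inter> cylinder y = B y" if "fst y < n" for y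
    using B(1)[OF that] by (auto simp: C_def saturated_in_def cylinder_def)
  have "has_depth (Suc R) C"
    unfolding has_depth_def
  proof (intro ballI impI)
    fix \<xi> \<eta> assume X: "\<xi> \<in> inf_words n" "\<eta> \<in> inf_words n" and eq: "initial (Suc R) \<xi> = initial (Suc R) \<eta>"
    have "\<xi> 0 = \<eta> 0" using eq by (simp add: initial_Suc)
    moreover have "\<xi> \<in> B (\<xi> 0) \<longleftrightarrow> \<eta> \<in> B (\<xi> 0)"
      using B(1)[OF letter(1)[OF X(1)]] X eq unfolding saturated_in_def has_depth_def by blast
    ultimately show "\<xi> \<in> C \<longleftrightarrow> \<eta> \<in> C" using X by (simp add: C_def)
  qed
  moreover have "\<forall>\<xi> \<eta>. (\<xi>, \<eta>) \<in> E \<longrightarrow> (\<xi> \<in> C \<longleftrightarrow> \<eta> \<in> C)"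
  proof (intro allI impI)
    fix \<xi> \<eta> assume E: "(\<xi>, \<eta>) \<in> E"
    have X: "\<xi> \<in> inf_words n" "\<eta> \<in> inf_words n" using E_inf_words[OF E] .
    show "\<xi> \<in> C \<longleftrightarrow> \<eta> \<in> C"
    proof (cases "\<xi> 0 = \<eta> 0")
      case True
      then have "\<xi> \<in> B (\<xi> 0) \<longleftrightarrow> \<eta> \<in> B (\<xi> 0)"
        using B(1)[OF letter(1)[OF X(1)]] letter(2)[OF X(1)] letter(2)[OF X(2)] E
        unfolding saturated_in_def by metis
      then show ?thesis using X True by (simp add: C_def)
    next
      case False
      then have cross: "\<xi> \<in> crossing_ends" "\<eta> \<in> crossing_ends"
        using E E_sym[OF E] unfolding crossing_ends_def by fastforce+
      have "\<zeta> \<in> B (\<zeta> 0) \<longleftrightarrow> \<zeta> \<in> A" if "\<zeta> \<in> inf_words n" "\<zeta> \<in> crossing_ends" for \<zeta>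
        using B(2)[OF letter(1)[OF that(1)]] letter(2)[OF that(1)] that(2) unfolding state_def by blast
      then show ?thesis using cross X A(3)[OF E] by (simp add: C_def)
    qed
  qed
  \<comment> \<open>Here the emptiness flag carries nontriviality over from \<open>A\<close> to
    \<open>C\<close>; the flag for the full cylinder does so for the complement below.\<close>
  moreover have "C \<noteq> {}"
  proof -
    obtain \<xi> where \<xi>: "\<xi> \<in> A" using A(4) by blast
    then have "fst (\<xi> 0) < n" "A \<inter> cylinder (\<xi> 0) \<noteq> {}" using A(1) letter by blast+
    then have "B (\<xi> 0) \<noteq> {}" using B(2) unfolding state_def by blast
    then show ?thesis using C_B[OF \<open>fst (\<xi> 0) < n\<close>] by blast
  qed
  moreover have "C \<noteq> inf_words n"
  proof -
    obtain \<xi> where \<xi>: "\<xi> \<in> inf_words n" "\<xi> \<notin> A" using A(1,5) by blast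
    then have "fst (\<xi> 0) < n" "A \<inter> cylinder (\<xi> 0) \<noteq> cylinder (\<xi> 0)" using letter by blast+
    then have "B (\<xi> 0) \<noteq> cylinder (\<xi> 0)" using B(2) unfolding state_def by blast
    then show ?thesis using C_B[OF \<open>fst (\<xi> 0) < n\<close>] by (auto simp: cylinder_def)
  qed
  moreover have "C \<subseteq> inf_words n" by (auto simp: C_def)
  ultimately show ?thesis unfolding separated_def by (intro exI[of _ C] conjI)
qed

lemma separated_bound:
  assumes "finite crossing_ends" "card crossing_ends \<le> N" "separated R"
  shows "separated (Suc (8 * n * 2 ^ N))"
proof -
  define U where "U = ({..<n} \<times> (UNIV :: bool set)) \<times> Pow crossing_ends \<times> (UNIV :: bool set) \<times> (UNIV :: bool set)"
  have "card U = 8 * n * 2 ^ card crossing_ends"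
    by (simp add: U_def card_cartesian_product card_Pow assms(1))
  also have "\<dots> \<le> 8 * n * 2 ^ N"
    using assms(2) by (intro mult_le_mono power_increasing) auto
  finally have card: "card U \<le> 8 * n * 2 ^ N" .
  have "finite U" using assms(1) by (simp add: U_def)
  moreover have "states r \<subseteq> U" for r
    by (auto simp: states_def state_def U_def)
  ultimately obtain r where r: "r \<le> 8 * n * 2 ^ N" "states r = states (Suc r)"
    using increasing_chain_stabilises[of states, OF states_mono _ _ card] by blast
  have stable: "states k = states (Suc k)" if "r \<le> k" for k
    using that
  proof (induction k rule: dec_induct)
    case (step k)
    then show ?case using states_stable_step by blast
  qed (rule r(2))
  \<comment> \<open>The states agree from \<open>r\<close> on, so the depth can be lowered one step
    at a time down to \<open>Suc r\<close>. A disconnection of smaller depth is first regarded as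
    one of larger depth.\<close>
  have "separated (Suc r)" if "separated (Suc k)" "r \<le> k" for k
    using that(2,1)
  proof (induction k rule: dec_induct)
    case (step k)
    then show ?case using separated_step[OF stable] by blast
  qed
  moreover have "separated (Suc (max r R))" by (rule separated_mono[OF assms(3)]) simp
  ultimately have "separated (Suc r)" by simp
  then show ?thesis by (rule separated_mono) (use r(1) in simp)
qed

end


section \<open>Correctness of the finite test\<close>

lemma set_letter_list: "set (letter_list n) = {x. fst x < n}"
proof -
  have "x \<in> set (letter_list n)" if "fst x < n" for x
    using that by (cases x; cases "snd x") (auto simp: letter_list_def)
  then show ?thesis by (auto simp: letter_list_def)
qed

lemma set_words_of_length: "set (words_of_length n R) = {w \<in> words n. length w = R}"
proof (induction R)
  case (Suc R)
  have "set (words_of_length n (Suc R)) = {x # w | x w. fst x < n \<and> w \<in> set (words_of_length n R)}"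
    by (auto simp: words_of_length_def set_letter_list)
  also have "\<dots> = {w \<in> words n. length w = Suc R}"
    unfolding Suc by (auto simp: length_Suc_conv)
  finally show ?case .
qed (auto simp: words_of_length_def)

lemma set_words_up_to: "set (words_up_to n R) = {w \<in> words n. length w \<le> R}"
  by (auto simp: words_up_to_def set_words_of_length simp del: upt_Suc)

lemma length_le_total_length: "w \<in> set ws \<Longrightarrow> length w \<le> total_length ws"
  unfolding total_length_def by (induction ws) auto

definition line_limit :: "letter list \<Rightarrow> letter list \<Rightarrow> nat \<Rightarrow> letter" where
  "line_limit g w = (THE \<xi>. tends (line_seq g w) \<xi>)"

lemma line_limit_eq: "tends (line_seq g w) \<xi> \<Longrightarrow> line_limit g w = \<xi>"
  unfolding line_limit_def using tends_unique by blast

lemma take_line_seq_limit: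
  assumes "freely_reduced w" "w \<noteq> []" "R + length g + length w \<le> k"
  shows "take R (line_seq g w k) = initial R (line_limit g w)"
proof -
  obtain \<xi> where \<xi>: "\<And>R k. R + length g + length w \<le> k \<Longrightarrow> take R (line_seq g w k) = initial R \<xi>"
    using line_seq_limit[OF assms(1,2)] by blast
  then have "line_limit g w = \<xi>" by (intro line_limit_eq line_seq_limit_tends)
  with \<xi> assms(3) show ?thesis by simp
qed

lemma tends_line_limit:
  "freely_reduced w \<Longrightarrow> w \<noteq> [] \<Longrightarrow> tends (line_seq g w) (line_limit g w)"
  by (rule line_seq_limit_tends) (rule take_line_seq_limit)

text \<open>The last letter is repeated forever, which never cancels since no letter is its own
  inverse. In rank 0 the empty word has no extension.\<close>

lemma extend_reduced_word:
  assumes "u \<in> words n" "freely_reduced u" "u \<noteq> []"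
  obtains \<xi> where "\<xi> \<in> inf_words n" "initial (length u) \<xi> = u"
proof -
  define \<xi> where "\<xi> i = (if i < length u then u ! i else last u)" for i
  have "initial (length u) \<xi> = u" by (rule nth_equalityI) (auto simp: \<xi>_def)
  moreover have "\<xi> \<in> inf_words n"
    unfolding inf_words_def
  proof (intro CollectI conjI allI)
    have "x \<in> set u \<Longrightarrow> fst x < n" for x using assms(1) by (auto simp: words_def in_lists_conv_set)
    moreover have "\<xi> i \<in> set u" for i using assms(3) by (simp add: \<xi>_def)
    ultimately show "fst (\<xi> i) < n" for i by blast
    fix i
    consider "Suc i < length u" | "Suc i = length u" | "length u \<le> i" by linarith
    then show "\<xi> (Suc i) \<noteq> letter_inv (\<xi> i)"
    proof cases
      case 1
      then show ?thesis using assms(2) by (simp add: \<xi>_def freely_reduced_conv_nth)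
    next
      case 2
      then have "i = length u - 1" by simp
      then show ?thesis using 2 assms(3) by (simp add: \<xi>_def last_conv_nth)
    qed (simp add: \<xi>_def)
  qed
  ultimately show ?thesis by (rule that[rotated])
qed

section \<open>The pattern of a list of nonempty reduced words\<close>

locale reduced_words =
  fixes n :: nat and ws :: "letter list list"
  assumes ws_words: "set ws \<subseteq> words n"
    and ws_reduced: "w \<in> set ws \<Longrightarrow> freely_reduced w"
    and ws_nonempty: "w \<in> set ws \<Longrightarrow> w \<noteq> []"
begin

text \<open>A pair in \<open>pattern_ends\<close> is oriented by the direction of \<open>w\<close>;
  the converse makes the relation symmetric.\<close>

sublocale end_relation n "pattern_ends n ws \<union> (pattern_ends n ws)\<inverse>"
  by unfold_locales (use pattern_ends_inf_words ws_words pattern_ends_push in blast)+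

lemma inv_ws: "w \<in> set ws \<Longrightarrow> freely_reduced (inv_word w) \<and> inv_word w \<noteq> []"
  using ws_reduced ws_nonempty freely_reduced_inv_word by simp

lemma pattern_ends_short:
  assumes "(\<xi>, \<eta>) \<in> pattern_ends n ws" "initial R \<xi> \<noteq> initial R \<eta>"
  obtains h w where "h \<in> words n" "w \<in> set ws" "length h < R + length w"
    "\<xi> = line_limit h w" "\<eta> = line_limit h (inv_word w)"
proof -
  obtain g w where "g \<in> words n" "w \<in> set ws" "tends (line_seq g w) \<xi>"
      "tends (line_seq g (inv_word w)) \<eta>"
    using assms(1) unfolding pattern_ends_def by blast
  moreover from this obtain h where "h \<in> words n" "length h < R + length w"
      "tends (line_seq h w) \<xi>" "tends (line_seq h (inv_word w)) \<eta>"
    using short_representative[of g w \<xi> \<eta> R n] assms(2) ws_words by blast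
  ultimately show ?thesis using that line_limit_eq by metis
qed

text \<open>Distinct first letters are the case \<open>R = 1\<close> of
  \<open>pattern_ends_short\<close>, which yields a base point \<open>h\<close> with
  \<open>length h \<le> length w\<close>. Together with \<open>w\<close> and a direction it
  determines the end.\<close>

lemma crossing_ends_bound:
  "finite crossing_ends"
  "card crossing_ends \<le> 2 * (length (words_up_to n (total_length ws)) * length ws)"
proof -
  let ?W = "words_up_to n (total_length ws)"
  let ?I = "set ?W \<times> set ws \<times> (UNIV :: bool set)"
  let ?f = "\<lambda>(g, w, b). line_limit g (if b then w else inv_word w)"
  have "crossing_ends \<subseteq> ?f ` ?I"
  proof
    fix \<xi> assume "\<xi> \<in> crossing_ends"
    then obtain \<eta> where \<eta>: "(\<xi>, \<eta>) \<in> pattern_ends n ws \<or> (\<eta>, \<xi>) \<in> pattern_ends n ws" "\<xi> 0 \<noteq> \<eta> 0"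
      unfolding crossing_ends_def by blast
    from \<eta>(2) have ne: "initial 1 \<xi> \<noteq> initial 1 \<eta>" "initial 1 \<eta> \<noteq> initial 1 \<xi>"
      by (auto simp: initial_eq_iff)
    have image: "line_limit h (if b then w else inv_word w) \<in> ?f ` ?I"
      if "h \<in> words n" "w \<in> set ws" "length h < 1 + length w" for h w b
      using that length_le_total_length[OF that(2)]
      by (intro image_eqI[of _ _ "(h, w, b)"]) (auto simp: set_words_up_to)
    from \<eta>(1) show "\<xi> \<in> ?f ` ?I"
    proof
      assume "(\<xi>, \<eta>) \<in> pattern_ends n ws"
      from pattern_ends_short[OF this ne(1)] obtain h w where "h \<in> words n" "w \<in> set ws"
          "length h < 1 + length w" "\<xi> = line_limit h w" .
      then show ?thesis using image[of h w True] by simp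
    next
      assume "(\<eta>, \<xi>) \<in> pattern_ends n ws"
      from pattern_ends_short[OF this ne(2)] obtain h w where "h \<in> words n" "w \<in> set ws"
          "length h < 1 + length w" "\<xi> = line_limit h (inv_word w)" .
      then show ?thesis using image[of h w False] by simp
    qed
  qed
  moreover have fin: "finite (?f ` ?I)" by simp
  ultimately show "finite crossing_ends" by (rule finite_subset)
  have "card crossing_ends \<le> card (?f ` ?I)"
    using \<open>crossing_ends \<subseteq> ?f ` ?I\<close> fin by (rule card_mono[rotated])
  also have "\<dots> \<le> card ?I" by (rule card_image_le) simp
  also have "\<dots> = 2 * (card (set ?W) * card (set ws))" by (simp add: card_cartesian_product)
  also have "\<dots> \<le> 2 * (length ?W * length ws)"
    by (intro mult_le_mono card_length order_refl)
  finally show "card crossing_ends \<le> 2 * (length ?W * length ws)" .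
qed

lemma separated_imp_depth_bound: "separated R \<Longrightarrow> separated (Suc (depth_bound n ws))"
  unfolding depth_bound_def by (rule separated_bound[OF crossing_ends_bound])

lemma end_prefix_eq:
  assumes "w \<in> set ws" "length g \<le> R + total_length ws"
  shows "end_prefix R (2 * (R + total_length ws)) g w = initial R (line_limit g w)"
    and "end_prefix R (2 * (R + total_length ws)) g (inv_word w) = initial R (line_limit g (inv_word w))"
proof -
  have le: "R + length g + length w \<le> 2 * (R + total_length ws)"
    using length_le_total_length[OF assms(1)] assms(2) by simp
  then show "end_prefix R (2 * (R + total_length ws)) g w = initial R (line_limit g w)"
    unfolding end_prefix_def line_seq_def[symmetric]
    by (intro take_line_seq_limit ws_reduced ws_nonempty assms(1))
  show "end_prefix R (2 * (R + total_length ws)) g (inv_word w) = initial R (line_limit g (inv_word w))"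
    unfolding end_prefix_def line_seq_def[symmetric]
    using le inv_ws[OF assms(1)] by (intro take_line_seq_limit) auto
qed

lemma pattern_ends_line_limit:
  "g \<in> words n \<Longrightarrow> w \<in> set ws \<Longrightarrow> (line_limit g w, line_limit g (inv_word w)) \<in> pattern_ends n ws"
  unfolding pattern_ends_def using tends_line_limit ws_reduced ws_nonempty inv_ws by blast

text \<open>A line whose ends share their first \<open>R\<close> letters meets the condition
  trivially; any other line has a short base point, which is among those tested.\<close>

lemma saturated_colouring_iff:
  "saturated_colouring n ws R c \<longleftrightarrow>
    (\<forall>\<xi> \<eta>. (\<xi>, \<eta>) \<in> pattern_ends n ws \<longrightarrow> (initial R \<xi> \<in> set c \<longleftrightarrow> initial R \<eta> \<in> set c))"
proof
  assume sat: "saturated_colouring n ws R c"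
  show "\<forall>\<xi> \<eta>. (\<xi>, \<eta>) \<in> pattern_ends n ws \<longrightarrow> (initial R \<xi> \<in> set c \<longleftrightarrow> initial R \<eta> \<in> set c)"
  proof (intro allI impI)
    fix \<xi> \<eta> assume ends: "(\<xi>, \<eta>) \<in> pattern_ends n ws"
    show "initial R \<xi> \<in> set c \<longleftrightarrow> initial R \<eta> \<in> set c"
    proof (cases "initial R \<xi> = initial R \<eta>")
      case False
      then obtain h w where h: "h \<in> words n" "w \<in> set ws" "length h < R + length w"
          "\<xi> = line_limit h w" "\<eta> = line_limit h (inv_word w)"
        using pattern_ends_short[OF ends] by blast
      have "length h \<le> R + total_length ws"
        using h(3) length_le_total_length[OF h(2)] by simp
      moreover from this have "h \<in> set (words_up_to n (R + total_length ws))"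
        using h(1) by (simp add: set_words_up_to)
      then have "end_prefix R (2 * (R + total_length ws)) h w \<in> set c \<longleftrightarrow>
          end_prefix R (2 * (R + total_length ws)) h (inv_word w) \<in> set c"
        using sat h(2) unfolding saturated_colouring_def by blast
      ultimately show ?thesis by (simp only: end_prefix_eq[OF h(2)] h(4,5))
    qed simp
  qed
next
  assume sat: "\<forall>\<xi> \<eta>. (\<xi>, \<eta>) \<in> pattern_ends n ws \<longrightarrow> (initial R \<xi> \<in> set c \<longleftrightarrow> initial R \<eta> \<in> set c)"
  show "saturated_colouring n ws R c"
    unfolding saturated_colouring_def
  proof (intro ballI)
    fix g w assume "g \<in> set (words_up_to n (R + total_length ws))" and w: "w \<in> set ws"
    then have g: "g \<in> words n" "length g \<le> R + total_length ws"
      by (auto simp: set_words_up_to)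
    show "end_prefix R (2 * (R + total_length ws)) g w \<in> set c \<longleftrightarrow>
        end_prefix R (2 * (R + total_length ws)) g (inv_word w) \<in> set c"
      using sat pattern_ends_line_limit[OF g(1) w] unfolding end_prefix_eq[OF w g(2)] by blast
  qed
qed

text \<open>Sets of depth \<open>R\<close> correspond to sets of reduced words of length
  \<open>R\<close>. Nontriviality passes from words to infinite words because nonempty reduced words
  extend; this is the use of \<open>0 < R\<close>.\<close>

lemma disconnected_at_iff:
  assumes "0 < R"
  shows "disconnected_at n ws R \<longleftrightarrow> separated R"
proof
  let ?W = "filter (\<lambda>u. free_reduce u = u) (words_of_length n R)"
  have W: "set ?W = {u \<in> words n. freely_reduced u \<and> length u = R}"
    by (auto simp: set_words_of_length freely_reduced_iff_free_reduce)
  have initial_W: "initial R \<xi> \<in> set ?W" if "\<xi> \<in> inf_words n" for \<xi>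
    unfolding W using that by (simp add: initial_words freely_reduced_initial)
  show "separated R" if dis: "disconnected_at n ws R"
  proof -
    obtain c u v where c: "u \<in> set ?W" "u \<in> set c" "v \<in> set ?W" "v \<notin> set c"
        "saturated_colouring n ws R c"
      using dis unfolding disconnected_at_def by blast
    define A where "A = {\<xi> \<in> inf_words n. initial R \<xi> \<in> set c}"
    have "A \<subseteq> inf_words n" "has_depth R A" by (auto simp: A_def has_depth_def)
    moreover have "\<forall>\<xi> \<eta>. (\<xi>, \<eta>) \<in> pattern_ends n ws \<union> (pattern_ends n ws)\<inverse> \<longrightarrow> (\<xi> \<in> A \<longleftrightarrow> \<eta> \<in> A)"
      using c(5) pattern_ends_inf_words[OF _ ws_words] unfolding saturated_colouring_iff A_def by blast
    moreover have "\<exists>\<xi>\<in>inf_words n. initial R \<xi> = z" if "z \<in> set ?W" for z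
    proof -
      have z: "z \<in> words n" "freely_reduced z" "z \<noteq> []" "length z = R"
        using that assms unfolding W by auto
      show ?thesis using extend_reduced_word[OF z(1-3)] z(4) by metis
    qed
    then have "A \<noteq> {}" "A \<noteq> inf_words n" using c(1-4) unfolding A_def by blast+
    ultimately show ?thesis unfolding separated_def by (intro exI[of _ A] conjI)
  qed
  show "disconnected_at n ws R" if "separated R"
  proof -
    obtain A where A: "A \<subseteq> inf_words n" "has_depth R A"
        "\<And>\<xi> \<eta>. (\<xi>, \<eta>) \<in> pattern_ends n ws \<Longrightarrow> \<xi> \<in> A \<longleftrightarrow> \<eta> \<in> A" "A \<noteq> {}" "A \<noteq> inf_words n"
      using \<open>separated R\<close> unfolding separated_def by blast
    have "initial R ` A \<in> Pow (set ?W)" using initial_W A(1) by blast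
    then obtain c where c: "c \<in> set (subseqs ?W)" "set c = initial R ` A"
      unfolding subseqs_powset[symmetric] by blast
    have mem: "initial R \<xi> \<in> set c \<longleftrightarrow> \<xi> \<in> A" if "\<xi> \<in> inf_words n" for \<xi>
      using A(1,2) that unfolding c(2) has_depth_def by blast
    obtain \<xi> \<eta> where "\<xi> \<in> A" "\<eta> \<in> inf_words n" "\<eta> \<notin> A" using A(1,4,5) by blast
    then have "\<exists>u\<in>set ?W. u \<in> set c" "\<exists>u\<in>set ?W. u \<notin> set c"
      using mem initial_W A(1) by blast+
    moreover have "saturated_colouring n ws R c"
      unfolding saturated_colouring_iff
      using mem A(3) pattern_ends_inf_words[OF _ ws_words] by blast
    ultimately show ?thesis unfolding disconnected_at_def using c(1) by blast
  qed
qed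

lemma disconnected_at_depth_bound_iff:
  "disconnected_at n ws (Suc (depth_bound n ws)) \<longleftrightarrow> (\<exists>R. separated R)"
  using disconnected_at_iff separated_imp_depth_bound by blast

end


section \<open>The boundary of the Cayley tree\<close>

lemma carrier_free_group: "x \<in> carrier (free_group n) \<longleftrightarrow> x \<in> words n \<and> freely_reduced x"
  by (simp add: free_group_def)

lemma mult_free_group: "x \<otimes>\<^bsub>free_group n\<^esub> y = free_reduce (x @ y)"
  by (simp add: free_group_def)

lemma one_free_group: "\<one>\<^bsub>free_group n\<^esub> = []"
  by (simp add: free_group_def)

abbreviation tree_edges :: "nat \<Rightarrow> (letter list \<times> letter list) set" where
  "tree_edges n \<equiv> cayley_edges (free_group n) (free_basis n)"

lemma free_reduce_in_carrier: "x \<in> words n \<Longrightarrow> free_reduce x \<in> carrier (free_group n)"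
  by (simp add: carrier_free_group reduce_words reduced_reduce)

lemma free_reduce_append_inv:
  assumes "freely_reduced x"
  shows "free_reduce (free_reduce (x @ [a]) @ [letter_inv a]) = x"
proof -
  have "free_reduce (free_reduce (x @ [a]) @ [letter_inv a]) = free_reduce (x @ free_reduce ([a] @ inv_word [a] @ []))"
    by (simp add: free_reduce_append_left free_reduce_append_right inv_word_def)
  also have "\<dots> = x" using assms by (simp only: free_reduce_cancel_right) (simp add: reduce_id)
  finally show ?thesis .
qed

lemma tree_edges_cases:
  "(x, y) \<in> tree_edges n \<longleftrightarrow>
    (\<exists>i<n. x \<in> carrier (free_group n) \<and> y = free_reduce (x @ [(i, False)])) \<or>
    (\<exists>i<n. y \<in> carrier (free_group n) \<and> x = free_reduce (y @ [(i, False)]))"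
  by (auto simp: cayley_edges_def Let_def free_basis_def mult_free_group)

text \<open>An edge along a letter, read backwards, is an edge along the inverse letter, so the
  symmetrised edges are the right multiplications by all letters.\<close>

lemma tree_edges_iff:
  "(x, y) \<in> tree_edges n \<longleftrightarrow>
    x \<in> carrier (free_group n) \<and> (\<exists>a. fst a < n \<and> y = free_reduce (x @ [a]))"
proof -
  have undo: "v = free_reduce (u @ [letter_inv a])" "v \<in> carrier (free_group n)"
      "u \<in> carrier (free_group n)"
    if "v \<in> carrier (free_group n)" "fst a < n" "u = free_reduce (v @ [a])" for u v a
    using that free_reduce_append_inv[of v a] free_reduce_in_carrier[of "v @ [a]" n]
    by (simp_all add: carrier_free_group)
  show ?thesis
  proof
    assume "(x, y) \<in> tree_edges n"
    then consider i where "i < n" "x \<in> carrier (free_group n)" "y = free_reduce (x @ [(i, False)])"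
      | i where "i < n" "y \<in> carrier (free_group n)" "x = free_reduce (y @ [(i, False)])"
      unfolding tree_edges_cases by blast
    then show "x \<in> carrier (free_group n) \<and> (\<exists>a. fst a < n \<and> y = free_reduce (x @ [a]))"
    proof cases
      case 1
      then show ?thesis by (intro conjI exI[of _ "(i, False)"]) auto
    next
      case 2
      then show ?thesis
        using undo[of y "(i, False)" x] by (intro conjI exI[of _ "letter_inv (i, False)"]) auto
    qed
  next
    assume "x \<in> carrier (free_group n) \<and> (\<exists>a. fst a < n \<and> y = free_reduce (x @ [a]))"
    then obtain a where a: "x \<in> carrier (free_group n)" "fst a < n" "y = free_reduce (x @ [a])"
      by blast
    show "(x, y) \<in> tree_edges n"
    proof (cases "snd a")
      case False
      then have "a = (fst a, False)" by (simp add: prod_eq_iff)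
      with a show ?thesis unfolding tree_edges_cases by metis
    next
      case True
      then have "letter_inv a = (fst a, False)" by (simp add: letter_inv_def)
      with undo[OF a] a(2) show ?thesis unfolding tree_edges_cases by metis
    qed
  qed
qed

text \<open>An edge path may backtrack, hence \<open>w\<close> need not be reduced.\<close>

lemma tree_edges_relpow:
  assumes "x \<in> carrier (free_group n)"
  shows "(x, y) \<in> tree_edges n ^^ k \<longleftrightarrow> (\<exists>w\<in>words n. length w = k \<and> y = free_reduce (x @ w))"
proof (induction k arbitrary: y)
  case 0
  then show ?case using assms by (auto simp: carrier_free_group reduce_id)
next
  case (Suc k)
  have "(x, y) \<in> tree_edges n ^^ Suc k \<longleftrightarrow>
      (\<exists>w\<in>words n. length w = k \<and> (free_reduce (x @ w), y) \<in> tree_edges n)"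
    using Suc by auto
  also have "\<dots> \<longleftrightarrow> (\<exists>w\<in>words n. length w = k \<and> (\<exists>a. fst a < n \<and> y = free_reduce (x @ w @ [a])))"
  proof -
    have "free_reduce (x @ w) \<in> carrier (free_group n)" if "w \<in> words n" for w
      using assms that by (intro free_reduce_in_carrier) (simp add: carrier_free_group)
    then show ?thesis by (auto simp: tree_edges_iff free_reduce_append_left)
  qed
  also have "\<dots> \<longleftrightarrow> (\<exists>w\<in>words n. length w = Suc k \<and> y = free_reduce (x @ w))"
  proof
    assume "\<exists>w\<in>words n. length w = k \<and> (\<exists>a. fst a < n \<and> y = free_reduce (x @ w @ [a]))"
    then obtain w a where "w \<in> words n" "length w = k" "fst a < n" "y = free_reduce (x @ w @ [a])" by blast
    then show "\<exists>w\<in>words n. length w = Suc k \<and> y = free_reduce (x @ w)"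
      by (intro bexI[of _ "w @ [a]"]) auto
  next
    assume "\<exists>w\<in>words n. length w = Suc k \<and> y = free_reduce (x @ w)"
    then obtain w where w: "w \<in> words n" "length w = Suc k" "y = free_reduce (x @ w)" by blast
    then obtain v a where "w = v @ [a]" by (cases w rule: rev_cases) auto
    with w show "\<exists>w\<in>words n. length w = k \<and> (\<exists>a. fst a < n \<and> y = free_reduce (x @ w @ [a]))"
      by (intro bexI[of _ v] conjI exI[of _ a]) auto
  qed
  finally show ?case .
qed

lemma graph_dist_tree:
  assumes "x \<in> carrier (free_group n)" "y \<in> carrier (free_group n)"
  shows "graph_dist (tree_edges n) x y = word_dist x y"
  unfolding graph_dist_def
proof (rule Least_equality)
  let ?w = "free_reduce (inv_word x @ y)"
  have "?w \<in> words n"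
    using assms by (simp add: carrier_free_group reduce_words inv_word_words)
  moreover have "free_reduce (x @ ?w) = y"
    using assms by (simp add: free_reduce_append_right free_reduce_cancel_right carrier_free_group reduce_id)
  ultimately show "(x, y) \<in> tree_edges n ^^ word_dist x y"
    unfolding tree_edges_relpow[OF assms(1)] word_dist_def by metis
next
  fix k assume "(x, y) \<in> tree_edges n ^^ k"
  then obtain w where "length w = k" "y = free_reduce (x @ w)"
    unfolding tree_edges_relpow[OF assms(1)] by blast
  then show "word_dist x y \<le> k" using word_dist_mult[of x w] by simp
qed

text \<open>In a tree the Gromov product at the identity is the distance to the branch point, here
  the length of the common prefix. The conditions on the lengths exclude equal words shorter than
  \<open>R\<close>, on which \<open>take R\<close> agrees as well.\<close>

lemma gromov_product_ge_iff:
  assumes "x \<in> carrier (free_group n)" "y \<in> carrier (free_group n)"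
  shows "real R \<le> gromov_product (tree_edges n) [] x y \<longleftrightarrow>
    R \<le> length x \<and> R \<le> length y \<and> take R x = take R y"
proof -
  have red: "freely_reduced x" "freely_reduced y" using assms by (simp_all add: carrier_free_group)
  obtain l where l: "l \<le> length x" "l \<le> length y" "word_dist x y = (length x - l) + (length y - l)"
    "\<And>R. R \<le> length x \<Longrightarrow> R \<le> length y \<Longrightarrow> take R x = take R y \<longleftrightarrow> R \<le> l"
    using word_dist_prefix[OF red] by blast
  have "[] \<in> carrier (free_group n)" by (simp add: carrier_free_group)
  then have "gromov_product (tree_edges n) [] x y = real l"
    using assms l(1-3) unfolding gromov_product_def
    by (simp add: graph_dist_tree of_nat_diff) (simp add: word_dist_def inv_word_def reduce_id red)
  then show ?thesis using l by auto
qed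

section \<open>Geodesic rays and boundary points as infinite words\<close>

abbreviation tree_rays :: "nat \<Rightarrow> (nat \<Rightarrow> letter list) set" where
  "tree_rays n \<equiv> geodesic_rays (carrier (free_group n)) (tree_edges n)"

abbreviation tree_boundary :: "nat \<Rightarrow> (nat \<Rightarrow> letter list) set set" where
  "tree_boundary n \<equiv> boundary (carrier (free_group n)) (tree_edges n)"

abbreviation tree_asymptotic :: "nat \<Rightarrow> ((nat \<Rightarrow> letter list) \<times> (nat \<Rightarrow> letter list)) set" where
  "tree_asymptotic n \<equiv> asymptotic (carrier (free_group n)) (tree_edges n)"

lemma tree_rays_carrier: "\<gamma> \<in> tree_rays n \<Longrightarrow> \<gamma> t \<in> carrier (free_group n)"
  by (auto simp: geodesic_rays_def)

lemma tree_rays_dist: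
  assumes "\<gamma> \<in> tree_rays n"
  shows "int (word_dist (\<gamma> s) (\<gamma> t)) = \<bar>int s - int t\<bar>"
proof -
  have "int (graph_dist (tree_edges n) (\<gamma> s) (\<gamma> t)) = \<bar>int s - int t\<bar>"
    using assms by (simp add: geodesic_rays_def)
  then show ?thesis by (simp only: graph_dist_tree tree_rays_carrier[OF assms])
qed

text \<open>A geodesic ray moves by one at each step and by the triangle inequality satisfies
  \<open>t \<le> length (\<gamma> t) + length (\<gamma> 0)\<close>, so
  \<open>bounded_steps_limit\<close> applies.\<close>

lemma tree_rays_limit:
  assumes \<gamma>: "\<gamma> \<in> tree_rays n"
  obtains \<xi> where "\<xi> \<in> inf_words n" "tends \<gamma> \<xi>"
proof -
  have red: "freely_reduced (\<gamma> t)" "\<gamma> t \<in> words n" for t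
    using tree_rays_carrier[OF \<gamma>] by (simp_all add: carrier_free_group)
  have "word_dist (\<gamma> 0) (\<gamma> t) = t" for t
    using tree_rays_dist[OF \<gamma>, of 0 t] by simp
  moreover have "word_dist (\<gamma> 0) (\<gamma> t) \<le> length (\<gamma> 0) + length (\<gamma> t)" for t
    using length_free_reduce[of "inv_word (\<gamma> 0) @ \<gamma> t"] by (simp add: word_dist_def)
  ultimately have growth: "t \<le> length (\<gamma> t) + length (\<gamma> 0)" for t
    by (metis add.commute)
  have step: "word_dist (\<gamma> t) (\<gamma> (Suc t)) \<le> 1" for t
    using tree_rays_dist[OF \<gamma>, of t "Suc t"] by simp
  obtain \<xi> where \<xi>: "\<And>R k. R + length (\<gamma> 0) + 1 \<le> k \<Longrightarrow> take R (\<gamma> k) = initial R \<xi>"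
    using bounded_steps_limit[OF red(1) step growth] by blast
  then have "tends \<gamma> \<xi>" unfolding tends_def by blast
  then show ?thesis using that tends_inf_words red by blast
qed

definition ray_of :: "(nat \<Rightarrow> letter) \<Rightarrow> nat \<Rightarrow> letter list" where
  "ray_of \<xi> t = initial t \<xi>"

lemma ray_of_in_tree_rays:
  assumes "\<xi> \<in> inf_words n"
  shows "ray_of \<xi> \<in> tree_rays n"
proof -
  have car: "initial t \<xi> \<in> carrier (free_group n)" for t
    using assms by (simp add: carrier_free_group initial_words freely_reduced_initial)
  have "int (word_dist (initial s \<xi>) (initial t \<xi>)) = \<bar>int s - int t\<bar>" for s t
  proof -
    obtain l where l: "l \<le> length (initial s \<xi>)" "l \<le> length (initial t \<xi>)"
      "word_dist (initial s \<xi>) (initial t \<xi>) = (length (initial s \<xi>) - l) + (length (initial t \<xi>) - l)"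
      "\<And>R. R \<le> length (initial s \<xi>) \<Longrightarrow> R \<le> length (initial t \<xi>) \<Longrightarrow>
        take R (initial s \<xi>) = take R (initial t \<xi>) \<longleftrightarrow> R \<le> l"
      using word_dist_prefix[OF freely_reduced_initial[OF assms] freely_reduced_initial[OF assms]]
      by blast
    have "min s t \<le> l" using l(4)[of "min s t"] by (simp add: take_initial)
    then have "l = min s t" using l(1,2) by simp
    then show ?thesis using l(3) by (simp add: min_def split: if_splits)
  qed
  then show ?thesis
    using car by (auto simp: geodesic_rays_def ray_of_def[abs_def] graph_dist_tree)
qed

lemma tends_ray_of: "tends (ray_of \<xi>) \<xi>"
  unfolding tends_def ray_of_def using take_initial by blast

text \<open>A word within distance \<open>C\<close> of one with at least \<open>R + C\<close>
  letters shares its first \<open>R\<close> letters.\<close>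

lemma tends_asymptotic:
  assumes "(\<gamma>, \<gamma>') \<in> tree_asymptotic n" "tends \<gamma> \<xi>"
  shows "tends \<gamma>' \<xi>"
  unfolding tends_def
proof
  fix R
  have rays: "\<gamma> \<in> tree_rays n" "\<gamma>' \<in> tree_rays n" using assms(1) by (auto simp: asymptotic_def)
  obtain C where "graph_dist (tree_edges n) (\<gamma> t) (\<gamma>' t) \<le> C" for t
    using assms(1) by (auto simp: asymptotic_def)
  then have C: "word_dist (\<gamma> t) (\<gamma>' t) \<le> C" for t
    using graph_dist_tree[OF tree_rays_carrier tree_rays_carrier] rays by metis
  obtain K where K: "\<And>k. K \<le> k \<Longrightarrow> take (R + C) (\<gamma> k) = initial (R + C) \<xi>"
    using assms(2) unfolding tends_def by blast
  have "take R (\<gamma>' k) = initial R \<xi>" if k: "K \<le> k" for k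
  proof -
    have "R + C \<le> length (\<gamma> k)" using K[OF k] by (metis length_initial length_take min.cobounded1)
    then have "take R (\<gamma> k) = take R (\<gamma>' k)"
      using C[of k] rays[THEN tree_rays_carrier] take_eq_of_word_dist[of "\<gamma> k" "\<gamma>' k" R]
      by (simp add: carrier_free_group)
    moreover have "take R (\<gamma> k) = take R (take (R + C) (\<gamma> k))" by simp
    ultimately show ?thesis unfolding K[OF k] by (simp add: take_initial)
  qed
  then show "\<exists>K. \<forall>k\<ge>K. take R (\<gamma>' k) = initial R \<xi>" by blast
qed

definition boundary_word :: "(nat \<Rightarrow> letter list) set \<Rightarrow> nat \<Rightarrow> letter" where
  "boundary_word p = (SOME \<xi>. \<forall>\<gamma>\<in>p. tends \<gamma> \<xi>)"

definition boundary_point :: "nat \<Rightarrow> (nat \<Rightarrow> letter) \<Rightarrow> (nat \<Rightarrow> letter list) set" where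
  "boundary_point n \<xi> = tree_asymptotic n `` {ray_of \<xi>}"

lemma tree_boundary_nonempty: "p \<in> tree_boundary n \<Longrightarrow> \<exists>\<gamma>. \<gamma> \<in> p"
proof -
  assume "p \<in> tree_boundary n"
  then obtain \<gamma> where \<gamma>: "\<gamma> \<in> tree_rays n" "p = tree_asymptotic n `` {\<gamma>}"
    unfolding boundary_def quotient_def by blast
  have "graph_dist (tree_edges n) x x = 0" for x
    unfolding graph_dist_def by (rule Least_equality) auto
  then have "(\<gamma>, \<gamma>) \<in> tree_asymptotic n" using \<gamma>(1) by (simp add: asymptotic_def)
  then show ?thesis using \<gamma>(2) by blast
qed

lemma tree_boundary_rays: "p \<in> tree_boundary n \<Longrightarrow> \<gamma> \<in> p \<Longrightarrow> \<gamma> \<in> tree_rays n"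
  by (auto simp: boundary_def quotient_def asymptotic_def)

lemma tends_boundary_word:
  assumes "p \<in> tree_boundary n" "\<gamma> \<in> p"
  shows "tends \<gamma> (boundary_word p)"
proof -
  obtain \<delta> where \<delta>: "\<delta> \<in> tree_rays n" "p = tree_asymptotic n `` {\<delta>}"
    using assms(1) unfolding boundary_def quotient_def by blast
  obtain \<xi> where "tends \<delta> \<xi>" using tree_rays_limit[OF \<delta>(1)] by blast
  then have "\<exists>\<xi>. \<forall>\<gamma>\<in>p. tends \<gamma> \<xi>" using \<delta>(2) tends_asymptotic by blast
  then have "\<forall>\<gamma>\<in>p. tends \<gamma> (boundary_word p)"
    unfolding boundary_word_def by (rule someI_ex)
  then show ?thesis using assms(2) by blast
qed

lemma boundary_word_in_inf_words:
  assumes "p \<in> tree_boundary n"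
  shows "boundary_word p \<in> inf_words n"
proof -
  obtain \<gamma> where \<gamma>: "\<gamma> \<in> p" using tree_boundary_nonempty[OF assms] ..
  obtain \<xi> where \<xi>: "\<xi> \<in> inf_words n" "tends \<gamma> \<xi>"
    by (rule tree_rays_limit[OF tree_boundary_rays[OF assms \<gamma>]])
  have "boundary_word p = \<xi>" using tends_boundary_word[OF assms \<gamma>] \<xi>(2) by (rule tends_unique)
  with \<xi>(1) show ?thesis by simp
qed

lemma boundary_point_in_tree_boundary: "\<xi> \<in> inf_words n \<Longrightarrow> boundary_point n \<xi> \<in> tree_boundary n"
  unfolding boundary_point_def boundary_def by (rule quotientI) (rule ray_of_in_tree_rays)

lemma boundary_word_boundary_point:
  assumes "\<xi> \<in> inf_words n"
  shows "boundary_word (boundary_point n \<xi>) = \<xi>"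
proof -
  have p: "boundary_point n \<xi> \<in> tree_boundary n" by (rule boundary_point_in_tree_boundary[OF assms])
  obtain \<gamma> where \<gamma>: "\<gamma> \<in> boundary_point n \<xi>" using tree_boundary_nonempty[OF p] ..
  then have "(ray_of \<xi>, \<gamma>) \<in> tree_asymptotic n" by (simp add: boundary_point_def)
  then have "tends \<gamma> \<xi>" using tends_ray_of by (rule tends_asymptotic)
  with tends_boundary_word[OF p \<gamma>] show ?thesis by (rule tends_unique)
qed

section \<open>Neighbourhoods and convergence in terms of initial segments\<close>

lemma tends_length: "tends x \<xi> \<Longrightarrow> \<exists>K. \<forall>k\<ge>K. R \<le> length (x k) \<and> take R (x k) = initial R \<xi>"
proof -
  assume "tends x \<xi>"
  then obtain K where K: "\<And>k. K \<le> k \<Longrightarrow> take R (x k) = initial R \<xi>"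
    unfolding tends_def by blast
  have "R \<le> length (x k)" if "K \<le> k" for k
    using arg_cong[OF K[OF that], of length] by simp
  with K show ?thesis by blast
qed

text \<open>Once both words have \<open>R\<close> settled letters, the inequality no longer depends
  on the indices, so it holds eventually iff it holds at one late pair.\<close>

lemma gromov_product_eventually_iff:
  assumes "tends x \<xi>" "tends y \<eta>" "\<And>k. x k \<in> carrier (free_group n)" "\<And>k. y k \<in> carrier (free_group n)"
  shows "eventually (\<lambda>(s, t). real R \<le> gromov_product (tree_edges n) [] (x s) (y t))
      (sequentially \<times>\<^sub>F sequentially) \<longleftrightarrow> initial R \<xi> = initial R \<eta>"
proof -
  obtain K L where K: "\<And>k. K \<le> k \<Longrightarrow> R \<le> length (x k) \<and> take R (x k) = initial R \<xi>"
    and L: "\<And>k. L \<le> k \<Longrightarrow> R \<le> length (y k) \<and> take R (y k) = initial R \<eta>"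
    using tends_length[OF assms(1)] tends_length[OF assms(2)] by meson
  have iff: "real R \<le> gromov_product (tree_edges n) [] (x s) (y t) \<longleftrightarrow> initial R \<xi> = initial R \<eta>"
    if "max K L \<le> s" "max K L \<le> t" for s t
    using K[of s] L[of t] that by (simp add: gromov_product_ge_iff assms(3,4))
  show ?thesis
    unfolding eventually_prod_sequentially
  proof
    assume "\<exists>N. \<forall>m\<ge>N. \<forall>k\<ge>N. case (k, m) of (s, t) \<Rightarrow> real R \<le> gromov_product (tree_edges n) [] (x s) (y t)"
    then obtain N where "real R \<le> gromov_product (tree_edges n) [] (x (max N (max K L))) (y (max N (max K L)))"
      by (metis case_prod_conv max.cobounded1)
    then show "initial R \<xi> = initial R \<eta>" by (simp add: iff)
  qed (auto intro!: exI[of _ "max K L"] simp: iff)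
qed

lemma boundary_nbhd_iff:
  assumes "p \<in> tree_boundary n"
  shows "q \<in> boundary_nbhd (carrier (free_group n)) (tree_edges n) [] p R \<longleftrightarrow>
    q \<in> tree_boundary n \<and> initial R (boundary_word p) = initial R (boundary_word q)"
proof (cases "q \<in> tree_boundary n")
  case True
  have "eventually (\<lambda>(s, t). real R \<le> gromov_product (tree_edges n) [] (\<gamma> s) (\<gamma>' t))
      (sequentially \<times>\<^sub>F sequentially) \<longleftrightarrow> initial R (boundary_word p) = initial R (boundary_word q)"
    if "\<gamma> \<in> p" "\<gamma>' \<in> q" for \<gamma> \<gamma>'
    using that assms True
    by (intro gromov_product_eventually_iff tends_boundary_word tree_rays_carrier tree_boundary_rays)
  then show ?thesis
    using True tree_boundary_nonempty[OF assms] tree_boundary_nonempty[OF True]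
    unfolding boundary_nbhd_def by blast
qed (simp add: boundary_nbhd_def)

lemma converges_to_boundary_iff:
  assumes "tends x \<xi>" "\<And>k. x k \<in> carrier (free_group n)"
  shows "converges_to_boundary (carrier (free_group n)) (tree_edges n) [] x p \<longleftrightarrow>
    p \<in> tree_boundary n \<and> boundary_word p = \<xi>"
proof (cases "p \<in> tree_boundary n")
  case True
  have ev: "(\<forall>R. eventually (\<lambda>(s, t). real R \<le> gromov_product (tree_edges n) [] (x s) (\<gamma> t))
      (sequentially \<times>\<^sub>F sequentially)) \<longleftrightarrow> \<xi> = boundary_word p" if "\<gamma> \<in> p" for \<gamma>
  proof -
    have "eventually (\<lambda>(s, t). real R \<le> gromov_product (tree_edges n) [] (x s) (\<gamma> t))
      (sequentially \<times>\<^sub>F sequentially) \<longleftrightarrow> initial R \<xi> = initial R (boundary_word p)" for R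
      using assms(2) tree_rays_carrier[OF tree_boundary_rays[OF True that]]
      by (rule gromov_product_eventually_iff[OF assms(1) tends_boundary_word[OF True that]])
    moreover have "(\<forall>R. initial R \<xi> = initial R \<eta>) \<longleftrightarrow> \<xi> = \<eta>" for \<eta>
      by (auto simp: initial_eq_iff)
    ultimately show ?thesis by simp
  qed
  have "filterlim f at_top F \<longleftrightarrow> (\<forall>R. eventually (\<lambda>z. real R \<le> f z) F)"
    for f :: "nat \<times> nat \<Rightarrow> real" and F
  proof
    assume *: "\<forall>R. eventually (\<lambda>z. real R \<le> f z) F"
    show "filterlim f at_top F"
      unfolding filterlim_at_top
    proof
      fix Z
      obtain R where "Z \<le> real R" using real_arch_simple by blast
      then show "eventually (\<lambda>z. Z \<le> f z) F"
        using *[rule_format, of R] by (elim eventually_mono) simp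
    qed
  qed (simp add: filterlim_at_top)
  then have "filterlim (\<lambda>(k, t). gromov_product (tree_edges n) [] (x k) (\<gamma> t)) at_top
      (sequentially \<times>\<^sub>F sequentially) \<longleftrightarrow> \<xi> = boundary_word p" if "\<gamma> \<in> p" for \<gamma>
    using ev[OF that] by (simp add: case_prod_unfold)
  then show ?thesis
    using True tree_boundary_nonempty[OF True] unfolding converges_to_boundary_def by blast
qed (simp add: converges_to_boundary_def)


section \<open>Connectedness of the decomposition space\<close>

lemma nat_pow_free_group:
  assumes "w \<in> carrier (free_group n)"
  shows "w [^]\<^bsub>free_group n\<^esub> (k :: nat) = free_reduce (power_word w k)"
proof -
  interpret group "free_group n" by (rule group_free_group)
  show ?thesis
    by (induction k)
      (simp_all add: one_free_group mult_free_group power_word_Suc2 free_reduce_append_left)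
qed

lemma inv_free_group:
  assumes "w \<in> carrier (free_group n)"
  shows "inv\<^bsub>free_group n\<^esub> w = inv_word w"
proof -
  interpret group "free_group n" by (rule group_free_group)
  have "inv_word w \<in> carrier (free_group n)"
    using assms by (simp add: carrier_free_group inv_word_words freely_reduced_inv_word)
  moreover have "inv_word w \<otimes>\<^bsub>free_group n\<^esub> w = \<one>\<^bsub>free_group n\<^esub>"
    using free_reduce_cancel_left[of w "[]"] by (simp add: mult_free_group one_free_group)
  ultimately show ?thesis using assms by (simp add: inv_equality)
qed

lemma line_pattern_eq:
  assumes "w \<in> carrier (free_group n)"
  shows "g \<otimes>\<^bsub>free_group n\<^esub> w [^]\<^bsub>free_group n\<^esub> int k = line_seq g w k"
    and "g \<otimes>\<^bsub>free_group n\<^esub> w [^]\<^bsub>free_group n\<^esub> (- int k) = line_seq g (inv_word w) k"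
proof -
  interpret group "free_group n" by (rule group_free_group)
  have inv_w: "inv_word w \<in> carrier (free_group n)" using inv_closed[OF assms] inv_free_group[OF assms] by simp
  have pow: "g \<otimes>\<^bsub>free_group n\<^esub> v [^]\<^bsub>free_group n\<^esub> k = line_seq g v k"
    if "v \<in> carrier (free_group n)" for v
    using that by (simp add: nat_pow_free_group mult_free_group line_seq_def free_reduce_append_right)
  show "g \<otimes>\<^bsub>free_group n\<^esub> w [^]\<^bsub>free_group n\<^esub> int k = line_seq g w k"
    using pow[OF assms] by (simp add: int_pow_int)
  have "w [^]\<^bsub>free_group n\<^esub> (- int k) = inv\<^bsub>free_group n\<^esub> (w [^]\<^bsub>free_group n\<^esub> k)"
    by (rule int_pow_neg_int[OF assms])
  also have "\<dots> = inv_word w [^]\<^bsub>free_group n\<^esub> k"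
    unfolding inv_free_group[OF assms, symmetric] using assms by (simp add: nat_pow_inv)
  finally have "w [^]\<^bsub>free_group n\<^esub> (- int k) = inv_word w [^]\<^bsub>free_group n\<^esub> k" .
  then show "g \<otimes>\<^bsub>free_group n\<^esub> w [^]\<^bsub>free_group n\<^esub> (- int k) = line_seq g (inv_word w) k"
    using pow[OF inv_w] by simp
qed

lemma generated_equiv_invariant:
  assumes "(p, q) \<in> generated_equiv B r" "\<And>a b. (a, b) \<in> r \<Longrightarrow> a \<in> S \<longleftrightarrow> b \<in> S"
  shows "p \<in> S \<longleftrightarrow> q \<in> S"
proof -
  have "(p, q) \<in> (r \<union> r\<inverse>)\<^sup>*" using assms(1) by (simp add: generated_equiv_def)
  then show ?thesis by (induction rule: rtrancl_induct) (use assms(2) in auto)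
qed

lemma Union_classes_subset:
  assumes "equiv B r" "S \<subseteq> B" "\<And>p q. (p, q) \<in> r \<Longrightarrow> p \<in> S \<longleftrightarrow> q \<in> S"
  shows "\<Union>{c \<in> B // r. c \<subseteq> S} = S"
proof
  show "S \<subseteq> \<Union>{c \<in> B // r. c \<subseteq> S}"
  proof
    fix p assume p: "p \<in> S"
    then have "p \<in> r `` {p}" "r `` {p} \<in> B // r" "r `` {p} \<subseteq> S"
      using assms equiv_class_self[OF assms(1)] quotientI[of p B r] by auto
    then show "p \<in> \<Union>{c \<in> B // r. c \<subseteq> S}" by blast
  qed
qed blast

text \<open>Compactness, by Koenig's lemma: if no depth suffices beyond a word, then none suffices beyond
  one of its extensions by a letter.\<close>

lemma locally_constant_imp_depth:
  assumes "\<And>\<xi>. \<xi> \<in> inf_words n \<Longrightarrow>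
    \<exists>R. \<forall>\<eta>\<in>inf_words n. initial R \<eta> = initial R \<xi> \<longrightarrow> (\<eta> \<in> A \<longleftrightarrow> \<xi> \<in> A)"
  shows "\<exists>R. \<forall>\<xi>\<in>inf_words n. \<forall>\<eta>\<in>inf_words n. initial R \<xi> = initial R \<eta> \<longrightarrow> (\<xi> \<in> A \<longleftrightarrow> \<eta> \<in> A)"
proof -
  define good where "good u \<longleftrightarrow> (\<exists>R. \<forall>\<xi>\<in>inf_words n. \<forall>\<eta>\<in>inf_words n.
    initial (length u) \<xi> = u \<longrightarrow> initial R \<xi> = initial R \<eta> \<longrightarrow> initial (length u) \<eta> = u \<longrightarrow>
    (\<xi> \<in> A \<longleftrightarrow> \<eta> \<in> A))" for u
  have extend: "\<exists>x. \<not> good (u @ [x])" if "\<not> good u" for u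
  proof (rule ccontr)
    assume "\<not> ?thesis"
    then have "\<forall>x. good (u @ [x])" by blast
    then obtain f where f: "\<And>x \<xi> \<eta>. \<xi> \<in> inf_words n \<Longrightarrow> \<eta> \<in> inf_words n \<Longrightarrow>
        initial (Suc (length u)) \<xi> = u @ [x] \<Longrightarrow> initial (f x) \<xi> = initial (f x) \<eta> \<Longrightarrow>
        initial (Suc (length u)) \<eta> = u @ [x] \<Longrightarrow> \<xi> \<in> A \<longleftrightarrow> \<eta> \<in> A"
      unfolding good_def length_append_singleton by metis
    \<comment> \<open>With \<open>Suc (length u)\<close> included, the first \<open>R\<close>
      letters determine the letter after \<open>u\<close>, so both words fall under the same
      \<open>f x\<close>.\<close>
    define R where "R = Max (insert (Suc (length u)) (f ` ({..<n} \<times> UNIV)))"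
    have R: "Suc (length u) \<le> R" "\<And>x. fst x < n \<Longrightarrow> f x \<le> R"
      unfolding R_def by (auto intro!: Max_ge simp: image_iff)
    have "\<xi> \<in> A \<longleftrightarrow> \<eta> \<in> A"
      if X: "\<xi> \<in> inf_words n" "\<eta> \<in> inf_words n" and u: "initial (length u) \<xi> = u"
        and eq: "initial R \<xi> = initial R \<eta>" for \<xi> \<eta>
    proof (rule f[OF X])
      let ?x = "\<xi> (length u)"
      show "initial (Suc (length u)) \<xi> = u @ [?x]" using u by (simp add: initial_def)
      then show "initial (Suc (length u)) \<eta> = u @ [?x]" using initial_mono[OF R(1) eq] by simp
      show "initial (f ?x) \<xi> = initial (f ?x) \<eta>"
        using X(1) by (intro initial_mono[OF R(2) eq]) (simp add: inf_words_def)
    qed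
    with \<open>\<not> good u\<close> show False unfolding good_def by blast
  qed
  have "good []"
  proof (rule ccontr)
    assume bad_Nil: "\<not> good []"
    define pick where "pick u = (SOME x. \<not> good (u @ [x]))" for u
    define U where "U = rec_nat [] (\<lambda>_ u. u @ [pick u])"
    define \<xi> where "\<xi> k = pick (U k)" for k
    have U_Suc: "U (Suc k) = U k @ [\<xi> k]" for k by (simp add: U_def \<xi>_def)
    have U: "U k = initial k \<xi>" for k
      by (induction k) (simp_all add: U_Suc, simp_all add: U_def initial_def)
    have bad: "\<not> good (initial k \<xi>)" for k
    proof (induction k)
      case (Suc k)
      then have "\<not> good (initial k \<xi> @ [pick (initial k \<xi>)])"
        unfolding pick_def using extend by (metis (no_types, lifting) someI_ex)
      moreover have "initial (Suc k) \<xi> = initial k \<xi> @ [pick (initial k \<xi>)]"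
        using U_Suc[of k] unfolding U[symmetric] by (simp add: \<xi>_def)
      ultimately show ?case by simp
    qed (use bad_Nil in \<open>simp add: initial_def\<close>)
    \<comment> \<open>A word that begins no infinite reduced word is good vacuously. So every bad
      \<open>initial k \<xi>\<close> begins one, which puts \<open>\<xi>\<close> itself into
      \<open>inf_words n\<close>.\<close>
    have occurs: "\<exists>\<eta>\<in>inf_words n. initial k \<eta> = initial k \<xi>" for k
      using bad[of k] unfolding good_def by auto
    have "\<xi> \<in> inf_words n"
      unfolding inf_words_def
    proof (intro CollectI conjI allI)
      fix i
      obtain \<eta> where \<eta>: "\<eta> \<in> inf_words n" "initial (Suc (Suc i)) \<eta> = initial (Suc (Suc i)) \<xi>"
        using occurs by blast
      then have "\<xi> i = \<eta> i" "\<xi> (Suc i) = \<eta> (Suc i)" by (simp_all add: initial_eq_iff)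
      then show "fst (\<xi> i) < n" "\<xi> (Suc i) \<noteq> letter_inv (\<xi> i)"
        using \<eta>(1) by (simp_all add: inf_words_def)
    qed
    then obtain R where "\<forall>\<eta>\<in>inf_words n. initial R \<eta> = initial R \<xi> \<longrightarrow> (\<eta> \<in> A \<longleftrightarrow> \<xi> \<in> A)"
      using assms by blast
    then have "good (initial R \<xi>)" unfolding good_def by auto
    with bad show False by blast
  qed
  then show ?thesis unfolding good_def by (auto simp: initial_def)
qed

section \<open>The decomposition space of the pattern\<close>

context reduced_words
begin

abbreviation boundary_space :: "(nat \<Rightarrow> letter list) set topology" where
  "boundary_space \<equiv>
    boundary_topology (carrier (free_group n)) (tree_edges n) \<one>\<^bsub>free_group n\<^esub>"

abbreviation ends_equiv :: "((nat \<Rightarrow> letter list) set \<times> (nat \<Rightarrow> letter list) set) set" where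
  "ends_equiv \<equiv> generated_equiv (tree_boundary n) (line_ends (free_group n) (free_basis n) ws)"

lemma openin_boundary_space:
  "openin boundary_space U \<longleftrightarrow> U \<subseteq> tree_boundary n \<and>
    (\<forall>p\<in>U. \<exists>R. \<forall>q\<in>tree_boundary n. initial R (boundary_word q) = initial R (boundary_word p) \<longrightarrow> q \<in> U)"
proof -
  have "boundary_nbhd (carrier (free_group n)) (tree_edges n) [] p R \<subseteq> U \<longleftrightarrow>
      (\<forall>q\<in>tree_boundary n. initial R (boundary_word q) = initial R (boundary_word p) \<longrightarrow> q \<in> U)"
    if "p \<in> tree_boundary n" for p R
    using boundary_nbhd_iff[OF that] by (auto simp: subset_iff)
  then show ?thesis unfolding openin_boundary_topology one_free_group by blast
qed

lemma line_ends_iff: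
  "(p, q) \<in> line_ends (free_group n) (free_basis n) ws \<longleftrightarrow>
    p \<in> tree_boundary n \<and> q \<in> tree_boundary n \<and> (boundary_word p, boundary_word q) \<in> pattern_ends n ws"
proof -
  have conv: "converges_to_boundary (carrier (free_group n)) (tree_edges n) [] (line_seq g v) p \<longleftrightarrow>
      p \<in> tree_boundary n \<and> boundary_word p = line_limit g v"
    if "g \<in> words n" "v \<in> words n" "freely_reduced v" "v \<noteq> []" for g v p
    using that by (intro converges_to_boundary_iff tends_line_limit)
      (simp_all add: carrier_free_group line_seq_words freely_reduced_line_seq)
  have w: "w \<in> words n" "w \<in> carrier (free_group n)" "freely_reduced w" "w \<noteq> []"
    "inv_word w \<in> words n" "freely_reduced (inv_word w)" "inv_word w \<noteq> []" if "w \<in> set ws" for w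
    using that ws_words ws_reduced ws_nonempty inv_ws inv_word_words
    by (auto simp: carrier_free_group)
  have "(p, q) \<in> line_ends (free_group n) (free_basis n) ws \<longleftrightarrow>
      (\<exists>g\<in>carrier (free_group n). \<exists>w\<in>set ws.
        converges_to_boundary (carrier (free_group n)) (tree_edges n) [] (line_seq g w) p \<and>
        converges_to_boundary (carrier (free_group n)) (tree_edges n) [] (line_seq g (inv_word w)) q)"
  proof -
    have "(\<lambda>k. g \<otimes>\<^bsub>free_group n\<^esub> w [^]\<^bsub>free_group n\<^esub> int k) = line_seq g w"
      "(\<lambda>k. g \<otimes>\<^bsub>free_group n\<^esub> w [^]\<^bsub>free_group n\<^esub> (- int k)) = line_seq g (inv_word w)"
      if "w \<in> set ws" for g w
      using line_pattern_eq[OF w(2)[OF that], of g] by (simp_all add: fun_eq_iff)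
    moreover have "(p, q) \<in> line_ends (free_group n) (free_basis n) ws \<longleftrightarrow>
      (\<exists>g\<in>carrier (free_group n). \<exists>w\<in>set ws.
        converges_to_boundary (carrier (free_group n)) (tree_edges n) []
          (\<lambda>k. g \<otimes>\<^bsub>free_group n\<^esub> w [^]\<^bsub>free_group n\<^esub> int k) p \<and>
        converges_to_boundary (carrier (free_group n)) (tree_edges n) []
          (\<lambda>k. g \<otimes>\<^bsub>free_group n\<^esub> w [^]\<^bsub>free_group n\<^esub> (- int k)) q)"
      by (auto simp: line_ends_def line_pattern_def one_free_group)
    ultimately show ?thesis by simp
  qed
  also have "\<dots> \<longleftrightarrow> p \<in> tree_boundary n \<and> q \<in> tree_boundary n \<and>
      (\<exists>g\<in>carrier (free_group n). \<exists>w\<in>set ws.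
        boundary_word p = line_limit g w \<and> boundary_word q = line_limit g (inv_word w))"
    using w conv by (auto simp: carrier_free_group)
  also have "(\<exists>g\<in>carrier (free_group n). \<exists>w\<in>set ws.
        boundary_word p = line_limit g w \<and> boundary_word q = line_limit g (inv_word w)) \<longleftrightarrow>
      (boundary_word p, boundary_word q) \<in> pattern_ends n ws"
  proof
    assume "(boundary_word p, boundary_word q) \<in> pattern_ends n ws"
    then obtain g w where g: "g \<in> words n" "w \<in> set ws" "tends (line_seq g w) (boundary_word p)"
        "tends (line_seq g (inv_word w)) (boundary_word q)"
      unfolding pattern_ends_def by blast
    have "line_seq (free_reduce g) v = line_seq g v" for v
      by (simp add: fun_eq_iff line_seq_def free_reduce_append_left)
    then have "boundary_word p = line_limit (free_reduce g) w"
        "boundary_word q = line_limit (free_reduce g) (inv_word w)"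
      using g(3,4) by (simp_all add: line_limit_eq)
    then show "\<exists>g\<in>carrier (free_group n). \<exists>w\<in>set ws.
        boundary_word p = line_limit g w \<and> boundary_word q = line_limit g (inv_word w)"
      using g(1,2) free_reduce_in_carrier by blast
  next
    assume "\<exists>g\<in>carrier (free_group n). \<exists>w\<in>set ws.
        boundary_word p = line_limit g w \<and> boundary_word q = line_limit g (inv_word w)"
    then show "(boundary_word p, boundary_word q) \<in> pattern_ends n ws"
      using pattern_ends_line_limit by (auto simp: carrier_free_group)
  qed
  finally show ?thesis .
qed

lemma equiv_ends: "equiv (topspace boundary_space) ends_equiv"
  by (simp add: topspace_boundary_topology equiv_generated_equiv)

lemma openin_decomposition_space:
  "openin (decomposition_space (free_group n) (free_basis n) ws) U \<longleftrightarrow>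
    U \<subseteq> tree_boundary n // ends_equiv \<and> openin boundary_space (\<Union>U)"
  unfolding decomposition_space_def openin_quotient_topology[OF equiv_ends]
  by (simp add: topspace_boundary_topology)

lemma topspace_decomposition_space:
  "topspace (decomposition_space (free_group n) (free_basis n) ws) = tree_boundary n // ends_equiv"
  unfolding decomposition_space_def topspace_quotient_topology[OF equiv_ends]
  by (simp add: topspace_boundary_topology)

text \<open>A set of depth \<open>R\<close> and its complement are both open, since neighbourhoods
  of radius \<open>R\<close> do not mix them; being saturated, both descend to the quotient.\<close>

lemma separated_imp_disconnected:
  assumes "separated R"
  shows "\<not> connected_space (decomposition_space (free_group n) (free_basis n) ws)"
proof -
  obtain A where A: "A \<subseteq> inf_words n" "has_depth R A"
      "\<And>\<xi> \<eta>. (\<xi>, \<eta>) \<in> pattern_ends n ws \<Longrightarrow> \<xi> \<in> A \<longleftrightarrow> \<eta> \<in> A" "A \<noteq> {}" "A \<noteq> inf_words n"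
    using assms unfolding separated_def by blast
  define U where "U = {p \<in> tree_boundary n. boundary_word p \<in> A}"
  define V where "V = {p \<in> tree_boundary n. boundary_word p \<notin> A}"
  have equiv: "equiv (tree_boundary n) ends_equiv" by (rule equiv_generated_equiv)
  have same: "boundary_word p \<in> A \<longleftrightarrow> boundary_word q \<in> A"
    if "initial R (boundary_word p) = initial R (boundary_word q)" "p \<in> tree_boundary n"
      "q \<in> tree_boundary n" for p q
    using that A(2) boundary_word_in_inf_words unfolding has_depth_def by blast
  have open_UV: "openin boundary_space U" "openin boundary_space V"
    unfolding openin_boundary_space U_def V_def using same by blast+
  have sat: "p \<in> U \<longleftrightarrow> q \<in> U" "p \<in> V \<longleftrightarrow> q \<in> V" if "(p, q) \<in> ends_equiv" for p q
    by (rule generated_equiv_invariant[OF that];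
        use A(3) in \<open>auto simp: line_ends_iff U_def V_def\<close>)+
  have Un: "\<Union>{c \<in> tree_boundary n // ends_equiv. c \<subseteq> U} = U"
    "\<Union>{c \<in> tree_boundary n // ends_equiv. c \<subseteq> V} = V"
    by (rule Union_classes_subset[OF equiv]; use sat in \<open>auto simp: U_def V_def\<close>)+
  define CU CV where "CU = {c \<in> tree_boundary n // ends_equiv. c \<subseteq> U}"
    and "CV = {c \<in> tree_boundary n // ends_equiv. c \<subseteq> V}"
  have "openin (decomposition_space (free_group n) (free_basis n) ws) CU"
    "openin (decomposition_space (free_group n) (free_basis n) ws) CV"
    using open_UV Un unfolding openin_decomposition_space CU_def CV_def by auto
  moreover have "tree_boundary n // ends_equiv \<subseteq> CU \<union> CV"
  proof
    fix c assume c: "c \<in> tree_boundary n // ends_equiv"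
    have "c \<subseteq> U \<union> V" using in_quotient_imp_subset[OF equiv c] by (auto simp: U_def V_def)
    moreover have "p \<in> U \<longleftrightarrow> q \<in> U" if "p \<in> c" "q \<in> c" for p q
      using quotient_eq_iff[OF equiv c c that] sat(1) by blast
    ultimately have "c \<subseteq> U \<or> c \<subseteq> V" by blast
    then show "c \<in> CU \<union> CV" using c by (auto simp: CU_def CV_def)
  qed
  moreover have "CU \<inter> CV = {}"
  proof -
    have "c = {}" if "c \<subseteq> U" "c \<subseteq> V" for c
      using that by (auto simp: U_def V_def)
    moreover have "{} \<notin> tree_boundary n // ends_equiv"
      using in_quotient_imp_non_empty[OF equiv] by blast
    ultimately show ?thesis unfolding CU_def CV_def by blast
  qed
  moreover have "CU \<noteq> {}" "CV \<noteq> {}"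
  proof -
    obtain \<xi> \<eta> where "\<xi> \<in> A" "\<xi> \<in> inf_words n" "\<eta> \<in> inf_words n" "\<eta> \<notin> A" using A(1,4,5) by blast
    then have "boundary_point n \<xi> \<in> U" "boundary_point n \<eta> \<in> V"
      by (simp_all add: U_def V_def boundary_word_boundary_point boundary_point_in_tree_boundary)
    then show "CU \<noteq> {}" "CV \<noteq> {}" using Un unfolding CU_def CV_def by blast+
  qed
  ultimately show ?thesis
    unfolding connected_space_def topspace_decomposition_space not_not
    by (intro exI[of _ CU] exI[of _ CV] conjI)
qed

lemma disconnected_imp_separated:
  assumes "\<not> connected_space (decomposition_space (free_group n) (free_basis n) ws)"
  shows "\<exists>R. separated R"
proof -
  obtain E1 E2 where open_E: "openin (decomposition_space (free_group n) (free_basis n) ws) E1"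
      "openin (decomposition_space (free_group n) (free_basis n) ws) E2"
    and cover: "tree_boundary n // ends_equiv \<subseteq> E1 \<union> E2" and disjoint: "E1 \<inter> E2 = {}"
    and nonempty: "E1 \<noteq> {}" "E2 \<noteq> {}"
    using assms unfolding connected_space_def topspace_decomposition_space by blast
  have equiv: "equiv (tree_boundary n) ends_equiv" by (rule equiv_generated_equiv)
  have E: "E1 \<subseteq> tree_boundary n // ends_equiv" "E2 \<subseteq> tree_boundary n // ends_equiv"
    and open_Un: "openin boundary_space (\<Union>E1)" "openin boundary_space (\<Union>E2)"
    using open_E unfolding openin_decomposition_space by auto
  have "\<Union>(tree_boundary n // ends_equiv) = tree_boundary n" by (rule Union_quotient[OF equiv])
  then have Un: "\<Union>E1 \<union> \<Union>E2 = tree_boundary n" using E cover by blast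
  have disj: "\<Union>E1 \<inter> \<Union>E2 = {}"
    using quotient_disj[OF equiv] E disjoint by blast
  have ne: "\<Union>E1 \<noteq> {}" "\<Union>E2 \<noteq> {}"
    using nonempty E in_quotient_imp_non_empty[OF equiv] by blast+
  define A where "A = {\<xi> \<in> inf_words n. boundary_point n \<xi> \<in> \<Union>E1}"
  have point: "boundary_point n \<xi> \<in> tree_boundary n" "boundary_word (boundary_point n \<xi>) = \<xi>"
    if "\<xi> \<in> inf_words n" for \<xi>
    using that by (simp_all add: boundary_word_boundary_point boundary_point_in_tree_boundary)
  \<comment> \<open>Both points have the same infinite word and therefore lie in the same open sets.
    This takes the place of injectivity of \<open>boundary_word\<close>.\<close>
  have mem: "p \<in> \<Union>E1 \<longleftrightarrow> boundary_point n (boundary_word p) \<in> \<Union>E1" if p: "p \<in> tree_boundary n" for p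
  proof -
    have "boundary_point n (boundary_word p) \<in> \<Union>E"
      if "openin boundary_space (\<Union>E)" "p \<in> \<Union>E" for E
      using that point[OF boundary_word_in_inf_words[OF p]] unfolding openin_boundary_space by metis
    from this[OF open_Un(1)] this[OF open_Un(2)] show ?thesis using p Un disj by blast
  qed
  \<comment> \<open>\<open>\<Union>E1\<close> and \<open>\<Union>E2\<close> are open and
    complementary, so \<open>A\<close> is locally constant; compactness turns this into a single
    depth.\<close>
  have "\<exists>R. \<forall>\<xi>\<in>inf_words n. \<forall>\<eta>\<in>inf_words n. initial R \<xi> = initial R \<eta> \<longrightarrow> (\<xi> \<in> A \<longleftrightarrow> \<eta> \<in> A)"
  proof (rule locally_constant_imp_depth)
    fix \<xi> assume \<xi>: "\<xi> \<in> inf_words n"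
    have near: "\<exists>R. \<forall>\<eta>\<in>inf_words n. initial R \<eta> = initial R \<xi> \<longrightarrow> boundary_point n \<eta> \<in> \<Union>E"
      if "openin boundary_space (\<Union>E)" "boundary_point n \<xi> \<in> \<Union>E" for E
      using that point \<xi> unfolding openin_boundary_space by metis
    show "\<exists>R. \<forall>\<eta>\<in>inf_words n. initial R \<eta> = initial R \<xi> \<longrightarrow> (\<eta> \<in> A \<longleftrightarrow> \<xi> \<in> A)"
    proof (cases "boundary_point n \<xi> \<in> \<Union>E1")
      case True
      with near[OF open_Un(1)] \<xi> show ?thesis unfolding A_def by blast
    next
      case False
      then have "boundary_point n \<xi> \<in> \<Union>E2" using point(1)[OF \<xi>] Un by blast
      with near[OF open_Un(2)] False \<xi> disj show ?thesis unfolding A_def by blast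
    qed
  qed
  then obtain R where "has_depth R A" unfolding has_depth_def by blast
  moreover have "\<forall>\<xi> \<eta>. (\<xi>, \<eta>) \<in> pattern_ends n ws \<union> (pattern_ends n ws)\<inverse> \<longrightarrow> (\<xi> \<in> A \<longleftrightarrow> \<eta> \<in> A)"
  proof -
    have "\<xi> \<in> A \<longleftrightarrow> \<eta> \<in> A" if "(\<xi>, \<eta>) \<in> pattern_ends n ws" for \<xi> \<eta>
    proof -
      have X: "\<xi> \<in> inf_words n" "\<eta> \<in> inf_words n" using pattern_ends_inf_words[OF that ws_words] .
      then have "(boundary_point n \<xi>, boundary_point n \<eta>) \<in> line_ends (free_group n) (free_basis n) ws"
        using that point by (simp add: line_ends_iff)
      then have rel: "(boundary_point n \<xi>, boundary_point n \<eta>) \<in> ends_equiv"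
        using point(1) X by (auto simp: generated_equiv_def)
      have "boundary_point n \<xi> \<in> c \<longleftrightarrow> boundary_point n \<eta> \<in> c" if "c \<in> tree_boundary n // ends_equiv" for c
        using that rel equiv by (metis equiv_def in_quotient_imp_closed symD)
      then show ?thesis using X E(1) unfolding A_def by blast
    qed
    then show ?thesis by blast
  qed
  moreover have "A \<noteq> {}" "A \<noteq> inf_words n"
  proof -
    obtain p q where p: "p \<in> \<Union>E1" and q: "q \<in> \<Union>E2" using ne by blast
    then have pq: "p \<in> tree_boundary n" "q \<in> tree_boundary n" "q \<notin> \<Union>E1" using Un disj by blast+
    then have "boundary_word p \<in> A" "boundary_word q \<in> inf_words n - A"
      using mem p by (auto simp: A_def boundary_word_in_inf_words)
    then show "A \<noteq> {}" "A \<noteq> inf_words n" by blast+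
  qed
  moreover have "A \<subseteq> inf_words n" by (auto simp: A_def)
  ultimately have "separated R" unfolding separated_def by (intro exI[of _ A] conjI)
  then show ?thesis ..
qed

lemma connected_iff:
  "connected_space (decomposition_space (free_group n) (free_basis n) ws) \<longleftrightarrow>
    \<not> disconnected_at n ws (Suc (depth_bound n ws))"
  using disconnected_at_depth_bound_iff separated_imp_disconnected disconnected_imp_separated by blast

end

theorem corollary3:
  shows "\<exists>alg. \<forall>n ws.
    set ws \<subseteq> words n \<and> malnormal_family (free_group n) (map free_reduce ws) \<longrightarrow>
    computes alg [n, words_code ws]
      (if connected_space (decomposition_space (free_group n) (free_basis n) (map free_reduce ws))
       then 1 else 0)"
proof -
  obtain alg where alg:
    "\<And>n ws. computes alg [n, words_code ws] (decide_connected n (map (map letter_code) ws))"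
    using exists_deciding_program by blast
  show ?thesis
  proof (intro exI[of _ alg] allI impI, elim conjE)
    fix n ws
    assume ws: "set ws \<subseteq> words n" and malnormal: "malnormal_family (free_group n) (map free_reduce ws)"
    \<comment> \<open>Malnormality enters through its clause that no generator is the identity,
      which is what gives every half-line a limit.\<close>
    interpret reduced_words n "map free_reduce ws"
      using ws malnormal
      by unfold_locales (auto simp: malnormal_family_def one_free_group reduced_reduce intro: reduce_words)
    have "map (\<lambda>w. free_reduce (map letter_of_code w)) (map (map letter_code) ws) = map free_reduce ws"
      by (simp add: comp_def letter_of_code_inverse)
    then have "decide_connected n (map (map letter_code) ws) =
        (if connected_space (decomposition_space (free_group n) (free_basis n) (map free_reduce ws))
         then 1 else 0)"
      unfolding decide_connected_def by (simp only: connected_iff) simp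
    with alg[of n ws] show "computes alg [n, words_code ws]
        (if connected_space (decomposition_space (free_group n) (free_basis n) (map free_reduce ws))
         then 1 else 0)"
      by (simp only:)
  qed
qed

end
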